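(* Let $\Gamma_1,\Gamma_2$ be tropical curves, let $\psi:\operatorname{Rat}(\Gamma_1)\to\operatorname{Rat}(\Gamma_2)$ be a semiring isomorphism, and let $\varphi:\Gamma_1\to\Gamma_2$ be the $\psi(1)$-expansive map induced by $\psi$. Then $\psi$ and $\varphi$ map zeros (resp. poles) to zeros (resp. poles) and preserve their degrees; that is, for every $f\in\operatorname{Rat}(\Gamma_1)\setminus\{-\infty\}$, if $x\in\Gamma_1$ is a zero (resp. pole) of $f$ of degree $d$, then $\varphi(x)$ is a zero (resp. pole) of $\psi(f)$ of degree $d$.
   Context: **Semirings.** A semiring is a commutative semiring with absorbing additive neutral element, multiplicative identity, and these two distinct. A semiring homomorphism preserves addition, multiplication, the additive neutral element and the multiplicative identity; a semiring isomorphism is a bijective one. **Tropical curves.** A graph is an unweighted, undirected, finite, connected nonempty multigraph, possibly with loops. A leaf end is a vertex of valence one (loops count twice); a leaf edge is an edge incident to a leaf end. An edge-weighted graph $(G,l)$ is a graph $G$ with a function $l : E(G) \to \mathbb{R}_{>0} \cup \{\infty\}$ that takes the value $\infty$ only on leaf edges. A tropical curve $\Gamma$ is the underlying topological space of some $(G,l)$ together with an identification of each edge $e$ with $[0,l(e)]$, where $[0,\infty]$ is the one-point compactification of $[0,\infty)$; if $l(e)=\infty$, the leaf end of $e$ is identified with $\infty$ (if $E(G)=\{e\}$ and $l(e)=\infty$, either leaf end may be chosen). Points identified with $\infty$ are points at infinity and form the set $\Gamma_\infty$; other points are finite points. $\operatorname{dist}$ is the path-length distance; the distance between a point at infinity and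 any other point is $\infty$. The valence $\operatorname{val}(x)$ of a finite point is the number of connected components of $U\setminus\{x\}$ for small connected neighborhoods $U$ of $x$; $\operatorname{val}(x)=1$ for a point at infinity. The canonical model $(G_\circ, l_\circ)$ has vertex set $\{x : \operatorname{val}(x)\neq 2\}$, except that if $\Gamma$ is homeomorphic to a circle the vertex set is one arbitrary point, and if $\Gamma$ is obtained from a tree with two edges, both of length $\infty$, sharing a vertex, the vertex set is the two points at infinity and an arbitrary finite point. "An edge of $\Gamma$" means an edge of $G_\circ$. **Rational functions.** A rational function on $\Gamma$ is either the constant function $-\infty$ or a continuous map $f:\Gamma\to\mathbb{R}\cup\{\pm\infty\}$ that is piecewise affine with integer slopes and finitely many pieces and takes values $\pm\infty$ only at points at infinity. $\operatorname{Rat}(\Gamma)$ is the set of these; with $(f\oplus g)(x)=\max\{f(x),g(x)\}$ and $(f\odot g)(x)=f(x)+g(x)$ at finite points, extended continuously to points at infinity (and $f\oplus(-\infty)=f$, $f\odot(-\infty)=-\infty$), it is a semifield. For $f\in\operatorname{Rat}(\Gamma)\setminus\{-\infty\}$, a point $x$ is a zero (resp. pole) of $f$ if the sum of the outgoing slopes of $f$ at $x$ is positive (resp. negative); its degree is the absolute value of the sum. If $x$ is a point at infinity, the outgoing slope of $f$ at $x$ is, by definition, minus the slope of $f$ from $y$ to $x$, where $y$ is a finite point on the leaf edge incident to $x$ such that $f$ has constant slope on $(y,x)$. **Expansive maps.** For $r\in\mathbb{R}_{>0}$, an $r$-expansive map $\varphi:\Gamma_1\to\Gamma_2$ is a continuous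 bijection that restricts to a bijection $\Gamma_1\setminus\Gamma_{1\infty}\to\Gamma_2\setminus\Gamma_{2\infty}$ with $r\cdot\operatorname{dist}(x,y)=\operatorname{dist}(\varphi(x),\varphi(y))$ for all $x,y\in\Gamma_1\setminus\Gamma_{1\infty}$. **The induced map.** Here $1$ in $\psi(1)$ is the constant function with value the real number $1$; $\psi(1)$ is a constant function with positive real value, identified with that value. A subgraph of $\Gamma$ is a compact subset with finitely many connected components. For a subgraph $\Gamma'$ with no connected component consisting only of a point at infinity and $l\in\mathbb{R}_{>0}\cup\{\infty\}$, $\operatorname{CF}(\Gamma';l)(x):=-\min(l,\operatorname{dist}(x,\Gamma'))$. The map $\varphi$ induced by $\psi$ is the following: for a finite point $x$ of $\Gamma_1$, $\varphi(x)$ is the unique finite point $x'$ of $\Gamma_2$ such that $\psi(\operatorname{CF}(\{x\};\varepsilon))=\operatorname{CF}(\{x'\};\psi(1)\cdot\varepsilon)$ for some $\varepsilon>0$; for $x\in\Gamma_{1\infty}$, $\varphi(x)$ is the unique $x'\in\Gamma_{2\infty}$ such that, for some finite point $y$ on the edge incident to $x$, $\varphi(y)$ lies on the edge incident to $x'$ and $\psi(\operatorname{CF}(\Gamma_1\setminus(y,x];\infty))=\operatorname{CF}(\Gamma_2\setminus(\varphi(y),x'];\infty)$. This map is well defined and $\psi(1)$-expansive. *)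

theory Defs
  imports
    "HOL-Analysis.Analysis"
    "HOL-Algebra.Ring"
    "Graph_Theory.Graph_Theory"
begin

section \<open>Tropical curves\<close>

text \<open>
  An undirected multigraph is a digraph of the graph library whose arcs carry an arbitrary
  orientation; the orientation records the identification of an edge \<open>e\<close> with \<open>[0, l(e)]\<close>:
  the tail of \<open>e\<close> is identified with \<open>0\<close> and the head with \<open>l(e)\<close>.
\<close>

record ('v, 'e) edge_weighted_graph =
  skeleton :: "('v, 'e) pre_digraph"
  len :: "'e \<Rightarrow> ereal"

text \<open>
  In-degree plus out-degree is the valence of a vertex in the undirected graph, with loops counted
  twice.  Since the head of an edge of infinite length is the end identified with \<open>\<infinity>\<close>, it has to be a
  leaf end.  Connectedness in the graph library refers to the symmetrized digraph and includes
  nonemptiness.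
\<close>

locale tropical_curve = fin_digraph "skeleton \<Gamma>"
  for \<Gamma> :: "('v, 'e) edge_weighted_graph" +
  assumes skeleton_connected: "Digraph_Component.connected (skeleton \<Gamma>)"
    and len_pos: "e \<in> arcs (skeleton \<Gamma>) \<Longrightarrow> 0 < len \<Gamma> e"
    and len_infinite_leaf: "e \<in> arcs (skeleton \<Gamma>) \<Longrightarrow> len \<Gamma> e = \<infinity> \<Longrightarrow>
      in_degree (skeleton \<Gamma>) (head (skeleton \<Gamma>) e)
        + out_degree (skeleton \<Gamma>) (head (skeleton \<Gamma>) e) = 1"

text \<open>
  The point set is the disjoint union of the vertices and the closed intervals \<open>[0, l(e)]\<close>, with the
  ends of the intervals glued to the vertices; \<open>edge_point \<Gamma> e t\<close> is the class of
  \<open>t \<in> [0, l(e)]\<close>.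
\<close>

datatype ('v, 'e) point = Vertex 'v | Inner 'e real

definition points :: "('v, 'e) edge_weighted_graph \<Rightarrow> ('v, 'e) point set" where
  "points \<Gamma> = Vertex ` verts (skeleton \<Gamma>)
     \<union> {Inner e t | e t. e \<in> arcs (skeleton \<Gamma>) \<and> 0 < t \<and> ereal t < len \<Gamma> e}"

definition edge_point :: "('v, 'e) edge_weighted_graph \<Rightarrow> 'e \<Rightarrow> ereal \<Rightarrow> ('v, 'e) point" where
  "edge_point \<Gamma> e t =
     (if t = 0 then Vertex (tail (skeleton \<Gamma>) e)
      else if t = len \<Gamma> e then Vertex (head (skeleton \<Gamma>) e)
      else Inner e (real_of_ereal t))"

definition infinite_points :: "('v, 'e) edge_weighted_graph \<Rightarrow> ('v, 'e) point set" where
  "infinite_points \<Gamma> = {edge_point \<Gamma> e \<infinity> | e. e \<in> arcs (skeleton \<Gamma>) \<and> len \<Gamma> e = \<infinity>}"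

definition finite_points :: "('v, 'e) edge_weighted_graph \<Rightarrow> ('v, 'e) point set" where
  "finite_points \<Gamma> = points \<Gamma> - infinite_points \<Gamma>"

text \<open>
  The quotient topology of the gluing.  As a subspace of the extended reals, \<open>[0, \<infinity>]\<close> is the one-point
  compactification of \<open>[0, \<infinity>)\<close>.
\<close>

definition curve_open :: "('v, 'e) edge_weighted_graph \<Rightarrow> ('v, 'e) point set \<Rightarrow> bool" where
  "curve_open \<Gamma> U \<longleftrightarrow> U \<subseteq> points \<Gamma> \<and>
     (\<forall>e\<in>arcs (skeleton \<Gamma>).
        openin (top_of_set {0..len \<Gamma> e}) {t \<in> {0..len \<Gamma> e}. edge_point \<Gamma> e t \<in> U})"

definition curve_topology :: "('v, 'e) edge_weighted_graph \<Rightarrow> ('v, 'e) point topology" where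
  "curve_topology \<Gamma> = topology (curve_open \<Gamma>)"

lemma istopology_curve_open: "istopology (curve_open \<Gamma>)"
  unfolding istopology_def
proof (intro conjI allI impI)
  fix S T assume ST: "curve_open \<Gamma> S" "curve_open \<Gamma> T"
  have eq: "{t \<in> {0..len \<Gamma> e}. edge_point \<Gamma> e t \<in> S \<inter> T}
      = {t \<in> {0..len \<Gamma> e}. edge_point \<Gamma> e t \<in> S} \<inter> {t \<in> {0..len \<Gamma> e}. edge_point \<Gamma> e t \<in> T}" for e
    by blast
  show "curve_open \<Gamma> (S \<inter> T)"
    using ST unfolding curve_open_def eq by (blast intro: openin_Int)
next
  fix \<K> assume \<K>: "\<forall>K\<in>\<K>. curve_open \<Gamma> K"
  have eq: "{t \<in> {0..len \<Gamma> e}. edge_point \<Gamma> e t \<in> \<Union>\<K>}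
      = (\<Union>K\<in>\<K>. {t \<in> {0..len \<Gamma> e}. edge_point \<Gamma> e t \<in> K})" for e
    by blast
  show "curve_open \<Gamma> (\<Union>\<K>)"
    using \<K> unfolding curve_open_def eq by (blast intro: openin_Union)
qed

lemma openin_curve_topology: "openin (curve_topology \<Gamma>) U \<longleftrightarrow> curve_open \<Gamma> U"
  by (simp add: curve_topology_def istopology_curve_open topology_inverse')

lemma (in tropical_curve) edge_point_in_points:
  assumes "e \<in> arcs (skeleton \<Gamma>)" "0 \<le> t" "t \<le> len \<Gamma> e"
  shows "edge_point \<Gamma> e t \<in> points \<Gamma>"
proof (cases t)
  case (real r)
  then show ?thesis
    using assms by (auto simp: edge_point_def points_def less_le)
qed (use assms in \<open>auto simp: edge_point_def points_def\<close>)

lemma (in tropical_curve) topspace_curve_topology: "topspace (curve_topology \<Gamma>) = points \<Gamma>"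
proof -
  have "{t \<in> {0..len \<Gamma> e}. edge_point \<Gamma> e t \<in> points \<Gamma>} = {0..len \<Gamma> e}"
    if "e \<in> arcs (skeleton \<Gamma>)" for e
    using edge_point_in_points[OF that] by auto
  then have "curve_open \<Gamma> (points \<Gamma>)"
    by (simp add: curve_open_def openin_subtopology_refl)
  then show ?thesis
    by (auto simp: topspace_def openin_curve_topology curve_open_def)
qed

text \<open>
  Path-length distance: a path is a finite concatenation of segments of edges.  A nonconstant path
  with an end at a point at infinity has length \<open>\<infinity>\<close>, because \<open>\<bar>\<infinity> - s\<bar> = \<infinity>\<close> in the extended reals.
\<close>

inductive path_of_length ::
    "('v, 'e) edge_weighted_graph \<Rightarrow> ('v, 'e) point \<Rightarrow> ('v, 'e) point \<Rightarrow> ereal \<Rightarrow> bool"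
  for \<Gamma> where
  trivial: "x \<in> points \<Gamma> \<Longrightarrow> path_of_length \<Gamma> x x 0"
| segment: "e \<in> arcs (skeleton \<Gamma>) \<Longrightarrow> s \<in> {0..len \<Gamma> e} \<Longrightarrow> t \<in> {0..len \<Gamma> e} \<Longrightarrow>
    path_of_length \<Gamma> (edge_point \<Gamma> e t) y L \<Longrightarrow>
    path_of_length \<Gamma> (edge_point \<Gamma> e s) y (\<bar>t - s\<bar> + L)"

definition curve_dist ::
    "('v, 'e) edge_weighted_graph \<Rightarrow> ('v, 'e) point \<Rightarrow> ('v, 'e) point \<Rightarrow> ereal" where
  "curve_dist \<Gamma> x y = Inf {L. path_of_length \<Gamma> x y L}"

definition curve_setdist ::
    "('v, 'e) edge_weighted_graph \<Rightarrow> ('v, 'e) point \<Rightarrow> ('v, 'e) point set \<Rightarrow> ereal" where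
  "curve_setdist \<Gamma> x S = (INF y\<in>S. curve_dist \<Gamma> x y)"

definition expansive_map ::
    "real \<Rightarrow> ('v1, 'e1) edge_weighted_graph \<Rightarrow> ('v2, 'e2) edge_weighted_graph \<Rightarrow>
      (('v1, 'e1) point \<Rightarrow> ('v2, 'e2) point) \<Rightarrow> bool" where
  "expansive_map r \<Gamma>1 \<Gamma>2 \<phi> \<longleftrightarrow>
     0 < r \<and>
     continuous_map (curve_topology \<Gamma>1) (curve_topology \<Gamma>2) \<phi> \<and>
     bij_betw \<phi> (points \<Gamma>1) (points \<Gamma>2) \<and>
     bij_betw \<phi> (finite_points \<Gamma>1) (finite_points \<Gamma>2) \<and>
     (\<forall>x\<in>finite_points \<Gamma>1. \<forall>y\<in>finite_points \<Gamma>1.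
        ereal r * curve_dist \<Gamma>1 x y = curve_dist \<Gamma>2 (\<phi> x) (\<phi> y))"


section \<open>The canonical model\<close>

definition valence :: "('v, 'e) edge_weighted_graph \<Rightarrow> ('v, 'e) point \<Rightarrow> nat" where
  "valence \<Gamma> x =
     (if x \<in> infinite_points \<Gamma> then 1
      else (THE n. \<exists>W. openin (curve_topology \<Gamma>) W \<and> x \<in> W \<and>
        (\<forall>U. openin (curve_topology \<Gamma>) U \<and> connectedin (curve_topology \<Gamma>) U \<and> x \<in> U \<and> U \<subseteq> W \<longrightarrow>
           card (connected_components_of (subtopology (curve_topology \<Gamma>) (U - {x}))) = n)))"

definition is_circle :: "('v, 'e) edge_weighted_graph \<Rightarrow> bool" where
  "is_circle \<Gamma> \<longleftrightarrow> curve_topology \<Gamma> homeomorphic_space top_of_set (sphere (0::complex) 1)"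

text \<open>The tree with two edges, both of length \<open>\<infinity>\<close>, sharing the vertex \<open>0\<close>.\<close>

definition two_rays :: "(nat, nat) edge_weighted_graph" where
  "two_rays =
     \<lparr>skeleton = \<lparr>verts = {0, 1, 2}, arcs = {1, 2}, tail = (\<lambda>_. 0), head = (\<lambda>e. e)\<rparr>, len = (\<lambda>_. \<infinity>)\<rparr>"

text \<open>A \<open>1\<close>-expansive map is an identification of tropical curves.\<close>

definition is_line :: "('v, 'e) edge_weighted_graph \<Rightarrow> bool" where
  "is_line \<Gamma> \<longleftrightarrow> (\<exists>\<phi>. expansive_map 1 two_rays \<Gamma> \<phi>)"

definition canonical_vertices :: "('v, 'e) edge_weighted_graph \<Rightarrow> ('v, 'e) point set" where
  "canonical_vertices \<Gamma> =
     (if is_circle \<Gamma> then {SOME p. p \<in> points \<Gamma>}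
      else if is_line \<Gamma> then insert (SOME p. p \<in> finite_points \<Gamma>) (infinite_points \<Gamma>)
      else {x \<in> points \<Gamma>. valence \<Gamma> x \<noteq> 2})"

text \<open>Edges of the canonical model, as closed subsets of the curve (that is, with their ends).\<close>

definition canonical_edges :: "('v, 'e) edge_weighted_graph \<Rightarrow> ('v, 'e) point set set" where
  "canonical_edges \<Gamma> =
     (\<lambda>C. curve_topology \<Gamma> closure_of C) `
       connected_components_of (subtopology (curve_topology \<Gamma>) (points \<Gamma> - canonical_vertices \<Gamma>))"

text \<open>
  For a point \<open>x\<close> at infinity, the canonical edge \<open>E\<close> incident to \<open>x\<close> and a finite point \<open>y\<close> of \<open>E\<close>,
  this is the half-open segment \<open>(y, x]\<close>: the part of \<open>E\<close> on the side of \<open>x\<close> from \<open>y\<close>.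
\<close>

definition end_segment ::
    "('v, 'e) edge_weighted_graph \<Rightarrow> ('v, 'e) point set \<Rightarrow> ('v, 'e) point \<Rightarrow> ('v, 'e) point \<Rightarrow>
      ('v, 'e) point set" where
  "end_segment \<Gamma> E y x =
     connected_component_of_set (subtopology (curve_topology \<Gamma>) (E - {y})) x"


section \<open>The semifield of rational functions\<close>

text \<open>
  Functions on a curve are total functions that are \<open>undefined\<close> outside the points of the curve.
\<close>

definition const_fun :: "('v, 'e) edge_weighted_graph \<Rightarrow> ereal \<Rightarrow> ('v, 'e) point \<Rightarrow> ereal" where
  "const_fun \<Gamma> c = (\<lambda>x\<in>points \<Gamma>. c)"

definition piecewise_affine ::
    "('v, 'e) edge_weighted_graph \<Rightarrow> (('v, 'e) point \<Rightarrow> ereal) \<Rightarrow> bool" where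
  "piecewise_affine \<Gamma> f \<longleftrightarrow>
     (\<forall>e\<in>arcs (skeleton \<Gamma>). \<exists>B::ereal set. finite B \<and>
        (\<forall>a b. a < b \<and> {a<..<b} \<subseteq> {0<..<len \<Gamma> e} - B \<longrightarrow>
           (\<exists>m::int. \<exists>c::real. \<forall>t::real. ereal t \<in> {a<..<b} \<longrightarrow>
              f (edge_point \<Gamma> e (ereal t)) = ereal (of_int m * t + c))))"

definition rational_functions ::
    "('v, 'e) edge_weighted_graph \<Rightarrow> (('v, 'e) point \<Rightarrow> ereal) set" where
  "rational_functions \<Gamma> = insert (const_fun \<Gamma> (-\<infinity>))
     {f \<in> extensional (points \<Gamma>).
        continuous_map (curve_topology \<Gamma>) euclidean f \<and>
        piecewise_affine \<Gamma> f \<and>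
        (\<forall>x\<in>finite_points \<Gamma>. \<bar>f x\<bar> \<noteq> \<infinity>)}"

definition continuous_extension ::
    "('v, 'e) edge_weighted_graph \<Rightarrow> (('v, 'e) point \<Rightarrow> ereal) \<Rightarrow> ('v, 'e) point \<Rightarrow> ereal" where
  "continuous_extension \<Gamma> h =
     (THE g. g \<in> extensional (points \<Gamma>) \<and> continuous_map (curve_topology \<Gamma>) euclidean g \<and>
        (\<forall>x\<in>finite_points \<Gamma>. g x = h x))"

text \<open>
  At finite points the values are real or \<open>-\<infinity>\<close>, so the conventions for the neutral element \<open>-\<infinity>\<close>
  are those of addition and maximum in the extended reals; \<open>\<infinity> + (-\<infinity>)\<close> does not occur.
\<close>

definition Rat :: "('v, 'e) edge_weighted_graph \<Rightarrow> (('v, 'e) point \<Rightarrow> ereal) ring" where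
  "Rat \<Gamma> =
     \<lparr>carrier = rational_functions \<Gamma>,
      mult = (\<lambda>f g. continuous_extension \<Gamma> (\<lambda>x. f x + g x)),
      one = const_fun \<Gamma> 0,
      zero = const_fun \<Gamma> (-\<infinity>),
      add = (\<lambda>f g. continuous_extension \<Gamma> (\<lambda>x. max (f x) (g x)))\<rparr>"

text \<open>The set \<open>ring_hom\<close> of the library does not ask for preservation of zero.\<close>

definition semiring_hom :: "('a, 'm) ring_scheme \<Rightarrow> ('b, 'n) ring_scheme \<Rightarrow> ('a \<Rightarrow> 'b) set" where
  "semiring_hom R S = {h \<in> ring_hom R S. h \<zero>\<^bsub>R\<^esub> = \<zero>\<^bsub>S\<^esub>}"

definition semiring_iso :: "('a, 'm) ring_scheme \<Rightarrow> ('b, 'n) ring_scheme \<Rightarrow> ('a \<Rightarrow> 'b) set" where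
  "semiring_iso R S = {h \<in> semiring_hom R S. bij_betw h (carrier R) (carrier S)}"


section \<open>Zeros and poles\<close>

text \<open>
  Directions at a point: \<open>(e, t, True)\<close> is the direction of increasing and \<open>(e, t, False)\<close> that of
  decreasing parameter on \<open>e\<close> at \<open>t\<close>.  A loop contributes two directions to its vertex, and a point at
  infinity has the single direction \<open>(e, \<infinity>, False)\<close>.
\<close>

definition directions ::
    "('v, 'e) edge_weighted_graph \<Rightarrow> ('v, 'e) point \<Rightarrow> ('e \<times> ereal \<times> bool) set" where
  "directions \<Gamma> x =
     {(e, t, True) | e t. e \<in> arcs (skeleton \<Gamma>) \<and> 0 \<le> t \<and> t < len \<Gamma> e \<and> edge_point \<Gamma> e t = x} \<union>
     {(e, t, False) | e t. e \<in> arcs (skeleton \<Gamma>) \<and> 0 < t \<and> t \<le> len \<Gamma> e \<and> edge_point \<Gamma> e t = x}"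

definition slope_along ::
    "('v, 'e) edge_weighted_graph \<Rightarrow> (('v, 'e) point \<Rightarrow> ereal) \<Rightarrow> 'e \<Rightarrow> ereal filter \<Rightarrow> int" where
  "slope_along \<Gamma> f e F =
     (THE m. \<exists>c::real. \<forall>\<^sub>F s in F.
        f (edge_point \<Gamma> e s) = ereal (of_int m * real_of_ereal s + c))"

text \<open>
  At \<open>(e, \<infinity>, False)\<close> this is the convention for points at infinity: minus the slope from a nearby
  finite point towards the point at infinity.
\<close>

fun outgoing_slope ::
    "('v, 'e) edge_weighted_graph \<Rightarrow> (('v, 'e) point \<Rightarrow> ereal) \<Rightarrow> 'e \<times> ereal \<times> bool \<Rightarrow> int" where
  "outgoing_slope \<Gamma> f (e, t, True) = slope_along \<Gamma> f e (at_right t)"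
| "outgoing_slope \<Gamma> f (e, t, False) = - slope_along \<Gamma> f e (at_left t)"

definition slope_sum ::
    "('v, 'e) edge_weighted_graph \<Rightarrow> (('v, 'e) point \<Rightarrow> ereal) \<Rightarrow> ('v, 'e) point \<Rightarrow> int" where
  "slope_sum \<Gamma> f x = (\<Sum>d\<in>directions \<Gamma> x. outgoing_slope \<Gamma> f d)"

definition is_zero_of_degree ::
    "('v, 'e) edge_weighted_graph \<Rightarrow> (('v, 'e) point \<Rightarrow> ereal) \<Rightarrow> nat \<Rightarrow> ('v, 'e) point \<Rightarrow> bool" where
  "is_zero_of_degree \<Gamma> f d x \<longleftrightarrow>
     f \<in> rational_functions \<Gamma> - {const_fun \<Gamma> (-\<infinity>)} \<and> x \<in> points \<Gamma> \<and>
     slope_sum \<Gamma> f x > 0 \<and> int d = \<bar>slope_sum \<Gamma> f x\<bar>"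

definition is_pole_of_degree ::
    "('v, 'e) edge_weighted_graph \<Rightarrow> (('v, 'e) point \<Rightarrow> ereal) \<Rightarrow> nat \<Rightarrow> ('v, 'e) point \<Rightarrow> bool" where
  "is_pole_of_degree \<Gamma> f d x \<longleftrightarrow>
     f \<in> rational_functions \<Gamma> - {const_fun \<Gamma> (-\<infinity>)} \<and> x \<in> points \<Gamma> \<and>
     slope_sum \<Gamma> f x < 0 \<and> int d = \<bar>slope_sum \<Gamma> f x\<bar>"


section \<open>The map induced by a semiring isomorphism\<close>

definition CF ::
    "('v, 'e) edge_weighted_graph \<Rightarrow> ('v, 'e) point set \<Rightarrow> ereal \<Rightarrow> ('v, 'e) point \<Rightarrow> ereal" where
  "CF \<Gamma> S l = (\<lambda>x\<in>points \<Gamma>. - min l (curve_setdist \<Gamma> x S))"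

text \<open>The real number \<open>\<psi>(1)\<close>, where \<open>1\<close> is the constant function with value \<open>1\<close>.\<close>

definition value_at_1 ::
    "('v1, 'e1) edge_weighted_graph \<Rightarrow> ('v2, 'e2) edge_weighted_graph \<Rightarrow>
      ((('v1, 'e1) point \<Rightarrow> ereal) \<Rightarrow> ('v2, 'e2) point \<Rightarrow> ereal) \<Rightarrow> real" where
  "value_at_1 \<Gamma>1 \<Gamma>2 \<psi> = (THE r. \<psi> (const_fun \<Gamma>1 1) = const_fun \<Gamma>2 (ereal r))"

definition corresponds_finite ::
    "('v1, 'e1) edge_weighted_graph \<Rightarrow> ('v2, 'e2) edge_weighted_graph \<Rightarrow>
      ((('v1, 'e1) point \<Rightarrow> ereal) \<Rightarrow> ('v2, 'e2) point \<Rightarrow> ereal) \<Rightarrow>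
      ('v1, 'e1) point \<Rightarrow> ('v2, 'e2) point \<Rightarrow> bool" where
  "corresponds_finite \<Gamma>1 \<Gamma>2 \<psi> x x' \<longleftrightarrow>
     x' \<in> finite_points \<Gamma>2 \<and>
     (\<exists>\<epsilon>::real. 0 < \<epsilon> \<and>
        \<psi> (CF \<Gamma>1 {x} (ereal \<epsilon>)) = CF \<Gamma>2 {x'} (ereal (value_at_1 \<Gamma>1 \<Gamma>2 \<psi> * \<epsilon>)))"

definition corresponds_infinite ::
    "('v1, 'e1) edge_weighted_graph \<Rightarrow> ('v2, 'e2) edge_weighted_graph \<Rightarrow>
      ((('v1, 'e1) point \<Rightarrow> ereal) \<Rightarrow> ('v2, 'e2) point \<Rightarrow> ereal) \<Rightarrow>
      (('v1, 'e1) point \<Rightarrow> ('v2, 'e2) point) \<Rightarrow> ('v1, 'e1) point \<Rightarrow> ('v2, 'e2) point \<Rightarrow> bool" where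
  "corresponds_infinite \<Gamma>1 \<Gamma>2 \<psi> \<phi> x x' \<longleftrightarrow>
     x' \<in> infinite_points \<Gamma>2 \<and>
     (\<exists>E\<in>canonical_edges \<Gamma>1. \<exists>E'\<in>canonical_edges \<Gamma>2. \<exists>y\<in>E \<inter> finite_points \<Gamma>1.
        x \<in> E \<and> x' \<in> E' \<and> \<phi> y \<in> E' \<and>
        \<psi> (CF \<Gamma>1 (points \<Gamma>1 - end_segment \<Gamma>1 E y x) \<infinity>)
          = CF \<Gamma>2 (points \<Gamma>2 - end_segment \<Gamma>2 E' (\<phi> y) x') \<infinity>)"

definition induced_map ::
    "('v1, 'e1) edge_weighted_graph \<Rightarrow> ('v2, 'e2) edge_weighted_graph \<Rightarrow>
      ((('v1, 'e1) point \<Rightarrow> ereal) \<Rightarrow> ('v2, 'e2) point \<Rightarrow> ereal) \<Rightarrow>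
      (('v1, 'e1) point \<Rightarrow> ('v2, 'e2) point) \<Rightarrow> bool" where
  "induced_map \<Gamma>1 \<Gamma>2 \<psi> \<phi> \<longleftrightarrow>
     (\<forall>x\<in>finite_points \<Gamma>1.
        corresponds_finite \<Gamma>1 \<Gamma>2 \<psi> x (\<phi> x) \<and>
        (\<forall>x'. corresponds_finite \<Gamma>1 \<Gamma>2 \<psi> x x' \<longrightarrow> x' = \<phi> x)) \<and>
     (\<forall>x\<in>infinite_points \<Gamma>1.
        corresponds_infinite \<Gamma>1 \<Gamma>2 \<psi> \<phi> x (\<phi> x) \<and>
        (\<forall>x'. corresponds_infinite \<Gamma>1 \<Gamma>2 \<psi> \<phi> x x' \<longrightarrow> x' = \<phi> x))"

end

theory Submission
  imports Defs
begin

text \<open>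
  The degree of a zero or pole is the slope sum of the function at the point, so the claim is that
  \<open>\<psi> f\<close> has the same slope sum at \<open>\<phi> x\<close> as \<open>f\<close> has at \<open>x\<close>.  Write \<open>r\<close> for \<open>\<psi>(1)\<close>.

  The heart of the proof is the identity \<open>\<psi> f (\<phi> x) = r * f x\<close> for finite points \<open>x\<close> (\<open>iso_value\<close>).  The
  isomorphism preserves the pointwise order, since \<open>f \<le> g\<close> means \<open>f \<oplus> g = g\<close>.  It sends the constant
  \<open>c\<close> to the constant \<open>r * c\<close>: apart from \<open>-\<infinity>\<close>, the constants are exactly the functions that have
  \<open>n\<close>-th roots for every \<open>n\<close>, because slopes are integers, and the map that \<open>\<psi>\<close> induces on them is additive and
  monotone (\<open>iso_const\<close>).  It sends the function \<open>CF {x} \<epsilon>\<close>, which has its strict maximum \<open>0\<close> at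
  \<open>x\<close>, to the corresponding function at \<open>\<phi> x\<close>; this is how \<open>\<phi>\<close> is induced.  Finally, the value of
  \<open>f\<close> at \<open>x\<close> can be expressed through constants and \<open>CF {x} \<epsilon>\<close> by inequalities: \<open>c \<le> f x\<close> implies
  \<open>c + n * CF {x} \<epsilon> \<le> max f (c - 1)\<close> for large \<open>n\<close>, and the latter, evaluated at \<open>x\<close>, implies
  \<open>c \<le> f x\<close>.  Transporting the inequality gives \<open>r * f x \<le> \<psi> f (\<phi> x)\<close>, and the same for the inverse
  of \<open>f\<close> gives equality.  To apply \<open>\<psi>\<close> to \<open>CF {x} \<epsilon>\<close> at all, one has to know that it is a rational
  function (\<open>CF_point_unit\<close>), for which the distance is computed along each edge.

  It remains to see that slope sums depend on values and distances only, because the two curves may be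
  given by unrelated graphs.  At a finite point, the points at a small distance \<open>s\<close> correspond to the
  directions (\<open>ray_point_sphere\<close>), so the sum of the increments of \<open>f\<close> over them is \<open>s\<close> times the slope
  sum.  Since \<open>\<phi>\<close> stretches distances by \<open>r\<close> and \<open>\<psi>\<close> stretches values by \<open>r\<close>, the slope sum is
  preserved.  A point at infinity has only one direction; continuity of \<open>\<phi>\<close> shows that the infinite
  edge is mapped to an infinite edge near its end, where slopes are compared by difference quotients.
\<close>

section \<open>Piecewise affine functions on an interval\<close>

definition affine_on :: "ereal \<Rightarrow> ereal \<Rightarrow> (real \<Rightarrow> real) \<Rightarrow> bool" where
  "affine_on a b F \<longleftrightarrow>
     (\<exists>m::int. \<exists>c::real. \<forall>t::real. ereal t \<in> {a<..<b} \<longrightarrow> F t = of_int m * t + c)"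

text \<open>
  The condition that piecewise affinity puts on a single edge of length \<open>L\<close>, for real-valued functions.
  Working with real values keeps the arithmetic of the extended reals out of the proofs; rational
  functions are real at every finite point, so nothing is lost.
\<close>

definition pa_on :: "ereal \<Rightarrow> (real \<Rightarrow> real) \<Rightarrow> bool" where
  "pa_on L F \<longleftrightarrow>
     (\<exists>B::ereal set. finite B \<and>
        (\<forall>a b. a < b \<and> {a<..<b} \<subseteq> {0<..<L} - B \<longrightarrow> affine_on a b F))"

lemma pa_onE:
  assumes "pa_on L F"
  obtains B :: "ereal set" where "finite B"
    "\<And>a b. a < b \<Longrightarrow> {a<..<b} \<subseteq> {0<..<L} - B \<Longrightarrow> affine_on a b F"
  using assms unfolding pa_on_def by metis

lemma pa_onI:
  assumes "finite B" "\<And>a b. a < b \<Longrightarrow> {a<..<b} \<subseteq> {0<..<L} - B \<Longrightarrow> affine_on a b F"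
  shows "pa_on L F"
  using assms unfolding pa_on_def by blast

lemma pa_on_affine: "pa_on L (\<lambda>t. of_int m * t + c)"
  by (rule pa_onI[of "{}"]) (auto simp: affine_on_def)

lemma pa_on_const: "pa_on L (\<lambda>t. c)"
  using pa_on_affine[of L 0 c] by simp

lemma pa_on_cong:
  assumes "pa_on L F" "\<And>t. 0 < t \<Longrightarrow> ereal t < L \<Longrightarrow> G t = F t"
  shows "pa_on L G"
proof -
  obtain B where "finite B"
    and B: "\<And>a b. a < b \<Longrightarrow> {a<..<b} \<subseteq> {0<..<L} - B \<Longrightarrow> affine_on a b F"
    using assms(1) by (rule pa_onE) blast
  show ?thesis
  proof (rule pa_onI[OF \<open>finite B\<close>])
    fix a b :: ereal assume ab: "a < b" "{a<..<b} \<subseteq> {0<..<L} - B"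
    then have "G t = F t" if "ereal t \<in> {a<..<b}" for t
      using that assms(2)[of t] by force
    with B[OF ab] show "affine_on a b G"
      unfolding affine_on_def by metis
  qed
qed

lemma pa_on_add:
  assumes "pa_on L F" "pa_on L G"
  shows "pa_on L (\<lambda>t. F t + G t)"
proof -
  obtain B where "finite B"
    and B: "\<And>a b. a < b \<Longrightarrow> {a<..<b} \<subseteq> {0<..<L} - B \<Longrightarrow> affine_on a b F"
    using assms(1) by (rule pa_onE) blast
  obtain B' where "finite B'"
    and B': "\<And>a b. a < b \<Longrightarrow> {a<..<b} \<subseteq> {0<..<L} - B' \<Longrightarrow> affine_on a b G"
    using assms(2) by (rule pa_onE) blast
  show ?thesis
  proof (rule pa_onI)
    show "finite (B \<union> B')" using \<open>finite B\<close> \<open>finite B'\<close> by simp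
    fix a b :: ereal assume ab: "a < b" "{a<..<b} \<subseteq> {0<..<L} - (B \<union> B')"
    then obtain m c m' c' where
      "\<forall>t. ereal t \<in> {a<..<b} \<longrightarrow> F t = of_int m * t + c"
      "\<forall>t. ereal t \<in> {a<..<b} \<longrightarrow> G t = of_int m' * t + c'"
      using B[of a b] B'[of a b] unfolding affine_on_def by blast
    then have "\<forall>t. ereal t \<in> {a<..<b} \<longrightarrow> F t + G t = of_int (m + m') * t + (c + c')"
      by (simp add: algebra_simps)
    then show "affine_on a b (\<lambda>t. F t + G t)"
      unfolding affine_on_def by blast
  qed
qed

lemma pa_on_scale:
  assumes "pa_on L F"
  shows "pa_on L (\<lambda>t. of_int k * F t)"
proof -
  obtain B where "finite B"
    and B: "\<And>a b. a < b \<Longrightarrow> {a<..<b} \<subseteq> {0<..<L} - B \<Longrightarrow> affine_on a b F"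
    using assms(1) by (rule pa_onE) blast
  show ?thesis
  proof (rule pa_onI[OF \<open>finite B\<close>])
    fix a b :: ereal assume ab: "a < b" "{a<..<b} \<subseteq> {0<..<L} - B"
    then obtain m c where "\<forall>t. ereal t \<in> {a<..<b} \<longrightarrow> F t = of_int m * t + c"
      using B[of a b] unfolding affine_on_def by blast
    then have "\<forall>t. ereal t \<in> {a<..<b} \<longrightarrow> of_int k * F t = of_int (k * m) * t + of_int k * c"
      by (simp add: algebra_simps)
    then show "affine_on a b (\<lambda>t. of_int k * F t)"
      unfolding affine_on_def by blast
  qed
qed

lemma affine_functions_comparable:
  assumes "affine_on a b F" "affine_on a b G" "\<And>t. ereal t \<in> {a<..<b} \<Longrightarrow> F t \<noteq> G t"
  shows "(\<forall>t. ereal t \<in> {a<..<b} \<longrightarrow> F t < G t) \<or> (\<forall>t. ereal t \<in> {a<..<b} \<longrightarrow> G t < F t)"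
proof (rule ccontr)
  assume "\<not> ?thesis"
  then obtain s u where su: "ereal s \<in> {a<..<b}" "F s \<ge> G s" "ereal u \<in> {a<..<b}" "F u \<le> G u"
    by (meson not_less)
  obtain m c m' c' where
    mc: "\<And>t. ereal t \<in> {a<..<b} \<Longrightarrow> F t = of_int m * t + c"
      "\<And>t. ereal t \<in> {a<..<b} \<Longrightarrow> G t = of_int m' * t + c'"
    using assms(1,2) unfolding affine_on_def by metis
  define d where "d t = of_int m * t + c - (of_int m' * t + c')" for t :: real
  have "0 \<in> closed_segment (d s) (d u)"
    using su mc[of s] mc[of u] by (auto simp: closed_segment_eq_real_ivl d_def)
  moreover have "continuous_on (closed_segment s u) d"
    unfolding d_def by (intro continuous_intros)
  ultimately obtain t where t: "t \<in> closed_segment s u" "d t = 0"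
    using IVT'_closed_segment_real by blast
  have "ereal t \<in> {a<..<b}"
  proof -
    have "(s \<le> t \<and> t \<le> u) \<or> (u \<le> t \<and> t \<le> s)"
      using t(1) by (auto simp: closed_segment_eq_real_ivl split: if_splits)
    then have "ereal (min s u) \<le> ereal t" "ereal t \<le> ereal (max s u)" by auto
    moreover have "a < ereal (min s u)" "ereal (max s u) < b"
      using su(1,3) by (auto simp: min_def max_def)
    ultimately show ?thesis
      by (meson le_less_trans less_le_trans greaterThanLessThan_iff)
  qed
  with assms(3) mc t(2) show False
    by (force simp: d_def)
qed

lemma affine_on_agree:
  assumes "affine_on a b F" "affine_on a b G"
    and "ereal u \<in> {a<..<b}" "ereal v \<in> {a<..<b}" "ereal s \<in> {a<..<b}" "u \<noteq> v" "F u = G u" "F v = G v"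
  shows "F s = G s"
proof -
  obtain m c m' c' where
    mc: "\<And>t. ereal t \<in> {a<..<b} \<Longrightarrow> F t = of_int m * t + c"
      "\<And>t. ereal t \<in> {a<..<b} \<Longrightarrow> G t = of_int m' * t + c'"
    using assms(1,2) unfolding affine_on_def by metis
  have 1: "of_int m * u + c = of_int m' * u + c'" "of_int m * v + c = of_int m' * v + c'"
    using mc assms(3-8) by auto
  then have "(of_int m - of_int m') * (u - v) = 0"
    by (simp add: algebra_simps)
  then have "of_int m = (of_int m' :: real)"
    using assms(6) by simp
  with 1 mc(1)[OF assms(5)] mc(2)[OF assms(5)] show ?thesis by simp
qed

text \<open>
  The new break points are the crossings of the two functions that lie in a gap between old break
  points without the functions agreeing on the whole gap.  Two affine functions that agree twice agree
  throughout, so a gap contains at most one such crossing; and a gap is determined by the set of old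
  break points to its left, of which there are finitely many.
\<close>

lemma pa_on_max:
  assumes "pa_on L F" "pa_on L G"
  shows "pa_on L (\<lambda>t. max (F t) (G t))"
proof -
  obtain B1 where "finite B1"
    and B1: "\<And>a b. a < b \<Longrightarrow> {a<..<b} \<subseteq> {0<..<L} - B1 \<Longrightarrow> affine_on a b F"
    using assms(1) by (rule pa_onE) blast
  obtain B2 where "finite B2"
    and B2: "\<And>a b. a < b \<Longrightarrow> {a<..<b} \<subseteq> {0<..<L} - B2 \<Longrightarrow> affine_on a b G"
    using assms(2) by (rule pa_onE) blast
  define B where "B = B1 \<union> B2"
  have "finite B" by (simp add: B_def \<open>finite B1\<close> \<open>finite B2\<close>)
  define gap where "gap a b \<longleftrightarrow> a < b \<and> {a<..<b} \<subseteq> {0<..<L} - B" for a b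
  have aff: "affine_on a b F" "affine_on a b G" if "gap a b" for a b
    using B1[of a b] B2[of a b] that unfolding gap_def B_def by blast+
  define C where "C = {ereal u | u. F u = G u \<and>
    (\<exists>a b s. gap a b \<and> ereal u \<in> {a<..<b} \<and> ereal s \<in> {a<..<b} \<and> F s \<noteq> G s)}"
  have less: False
    if C: "t \<in> C" "t' \<in> C" and eq: "{b \<in> B. b < t} = {b \<in> B. b < t'}" and "t < t'" for t t'
  proof -
    obtain u a b s where u: "t = ereal u" "F u = G u" "gap a b" "ereal u \<in> {a<..<b}"
        "ereal s \<in> {a<..<b}" "F s \<noteq> G s"
      using C(1) unfolding C_def by blast
    obtain u' a' b' where u': "t' = ereal u'" "F u' = G u'" "gap a' b'" "ereal u' \<in> {a'<..<b'}"
      using C(2) unfolding C_def by blast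
    \<comment> \<open>No break point separates the two gaps, so both crossings lie in one gap.\<close>
    have "gap a (max b b')"
      unfolding gap_def
    proof (intro conjI subsetI)
      show "a < max b b'" using u(3) by (auto simp: gap_def less_max_iff_disj)
      fix z assume z: "z \<in> {a<..<max b b'}"
      consider "z \<in> {a<..<b}" | "z \<in> {a'<..<b'}" | "b \<le> z" "z \<le> a'"
        using z by (cases "z < b"; cases "a' < z") (auto simp: less_max_iff_disj not_less)
      then show "z \<in> {0<..<L} - B"
      proof cases
        case 1 then show ?thesis using u(3) by (auto simp: gap_def)
      next
        case 2 then show ?thesis using u'(3) by (auto simp: gap_def)
      next
        case 3
        have "ereal u \<in> {0<..<L}" "ereal u' \<in> {0<..<L}"
          using u(3,4) u'(3,4) by (auto simp: gap_def)
        moreover have uz: "ereal u < z" "z < ereal u'" using 3 u(4) u'(4) by auto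
        moreover have "z \<notin> B"
        proof
          assume "z \<in> B"
          then have "z \<in> {b \<in> B. b < t}"
            unfolding eq using uz(2) u'(1) by simp
          then show False using uz(1) u(1) by auto
        qed
        ultimately show ?thesis
          using less_trans[of 0 "ereal u" z] less_trans[of z "ereal u'" L] by auto
      qed
    qed
    moreover have "a < ereal u'"
      using u(1,4) u'(1) \<open>t < t'\<close> less_trans[of a t t'] by auto
    ultimately have "F s = G s"
      using aff[of a "max b b'"]
        affine_on_agree[of a "max b b'" F G u u' s] u u' \<open>t < t'\<close>
      by (auto simp: less_max_iff_disj)
    with u(6) show False by simp
  qed
  have "inj_on (\<lambda>t. {b \<in> B. b < t}) C"
    by (rule inj_onI) (metis less linorder_neqE)
  moreover have "finite ((\<lambda>t. {b \<in> B. b < t}) ` C)"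
    by (rule finite_subset[of _ "Pow B"]) (use \<open>finite B\<close> in auto)
  ultimately have "finite C" by (rule finite_imageD[rotated])
  show ?thesis
  proof (rule pa_onI)
    show "finite (B \<union> C)" by (simp add: \<open>finite B\<close> \<open>finite C\<close>)
    fix a b :: ereal assume ab: "a < b" "{a<..<b} \<subseteq> {0<..<L} - (B \<union> C)"
    then have gap: "gap a b" by (auto simp: gap_def)
    show "affine_on a b (\<lambda>t. max (F t) (G t))"
    proof (cases "\<exists>u. ereal u \<in> {a<..<b} \<and> F u = G u")
      case True
      then obtain u where u: "ereal u \<in> {a<..<b}" "F u = G u" by blast
      have "ereal u \<notin> C" using u(1) ab by auto
      then have "\<forall>s. ereal s \<in> {a<..<b} \<longrightarrow> F s = G s"
        using u gap unfolding C_def by blast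
      then show ?thesis using aff(1)[OF gap] unfolding affine_on_def by auto
    next
      case False
      then have "(\<forall>t. ereal t \<in> {a<..<b} \<longrightarrow> F t < G t) \<or> (\<forall>t. ereal t \<in> {a<..<b} \<longrightarrow> G t < F t)"
        using affine_functions_comparable aff[OF gap] by blast
      then show ?thesis
      proof
        assume "\<forall>t. ereal t \<in> {a<..<b} \<longrightarrow> F t < G t"
        then show ?thesis
          using aff(2)[OF gap] unfolding affine_on_def by (metis max_absorb2 less_imp_le)
      next
        assume "\<forall>t. ereal t \<in> {a<..<b} \<longrightarrow> G t < F t"
        then show ?thesis
          using aff(1)[OF gap] unfolding affine_on_def by (metis max_absorb1 less_imp_le)
      qed
    qed
  qed
qed

lemma pa_on_abs: "pa_on L (\<lambda>t. - \<bar>t - c\<bar>)"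
proof -
  have "pa_on L (\<lambda>t. (-1) * max (of_int 1 * t + - c) (of_int (-1) * t + c))"
    using pa_on_scale[OF pa_on_max[OF pa_on_affine[of L 1 "-c"] pa_on_affine[of L "-1" c]], of "-1"]
    by simp
  then show ?thesis by (rule pa_on_cong) (simp add: abs_if max_def)
qed

section \<open>Germs\<close>

lemma gap_to_the_right:
  assumes "finite B" "0 \<le> t" "t < L"
  obtains b where "t < b" "{t<..<b} \<subseteq> {0<..<L::ereal} - B"
proof -
  define b where "b = Min {x \<in> insert L B. t < x}"
  have fin: "finite {x \<in> insert L B. t < x}" using assms(1) by simp
  have "b \<in> {x \<in> insert L B. t < x}"
    unfolding b_def by (rule Min_in[OF fin]) (use assms(3) in auto)
  then have "t < b" by simp
  moreover have "{t<..<b} \<subseteq> {0<..<L} - B"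
  proof
    fix z assume z: "z \<in> {t<..<b}"
    have "b \<le> x" if "x \<in> insert L B" "t < x" for x
      unfolding b_def by (rule Min_le[OF fin]) (use that in auto)
    then show "z \<in> {0<..<L} - B"
      using z assms by (fastforce simp: not_le[symmetric])
  qed
  ultimately show ?thesis by (rule that)
qed

lemma gap_to_the_left:
  assumes "finite B" "0 < t" "t \<le> L"
  obtains a where "a < t" "{a<..<t} \<subseteq> {0<..<L::ereal} - B"
proof -
  define a where "a = Max {x \<in> insert 0 B. x < t}"
  have fin: "finite {x \<in> insert 0 B. x < t}" using assms(1) by simp
  have "a \<in> {x \<in> insert 0 B. x < t}"
    unfolding a_def by (rule Max_in[OF fin]) (use assms(2) in auto)
  then have "a < t" by simp
  moreover have "{a<..<t} \<subseteq> {0<..<L} - B"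
  proof
    fix z assume z: "z \<in> {a<..<t}"
    have "x \<le> a" if "x \<in> insert 0 B" "x < t" for x
      unfolding a_def by (rule Max_ge[OF fin]) (use that in auto)
    then show "z \<in> {0<..<L} - B"
      using z assms by (fastforce simp: not_le[symmetric])
  qed
  ultimately show ?thesis by (rule that)
qed

lemma pa_on_germ_right:
  assumes "pa_on L F" "0 \<le> t" "ereal t < L"
  obtains m :: int and c where "\<forall>\<^sub>F s in at_right t. F s = of_int m * s + c"
proof -
  obtain B where "finite B"
    and B: "\<And>a b. a < b \<Longrightarrow> {a<..<b} \<subseteq> {0<..<L} - B \<Longrightarrow> affine_on a b F"
    using assms(1) by (rule pa_onE) blast
  obtain b where b: "ereal t < b" "{ereal t<..<b} \<subseteq> {0<..<L} - B"
    using gap_to_the_right[OF \<open>finite B\<close>, of "ereal t" L] assms(2,3) by auto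
  obtain m c where mc: "\<And>s. ereal s \<in> {ereal t<..<b} \<Longrightarrow> F s = of_int m * s + c"
    using B[OF b] unfolding affine_on_def by blast
  have "\<forall>\<^sub>F s in at_right (ereal t). s < b"
    using b(1) eventually_at_right by blast
  then have "\<forall>\<^sub>F s in at_right t. ereal s < b"
    unfolding at_right_ereal eventually_filtermap .
  moreover have "\<forall>\<^sub>F s in at_right t. t < s"
    by (simp add: eventually_at_right_less)
  ultimately have "\<forall>\<^sub>F s in at_right t. F s = of_int m * s + c"
    by eventually_elim (simp add: mc)
  then show ?thesis by (rule that)
qed

lemma pa_on_germ_left_ereal:
  assumes "pa_on L F" "0 < t" "t \<le> L"
  obtains m :: int and c where "\<forall>\<^sub>F s in at_left t. F (real_of_ereal s) = of_int m * real_of_ereal s + c"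
proof -
  obtain B where "finite B"
    and B: "\<And>a b. a < b \<Longrightarrow> {a<..<b} \<subseteq> {0<..<L} - B \<Longrightarrow> affine_on a b F"
    using assms(1) by (rule pa_onE) blast
  obtain a where a: "a < t" "{a<..<t} \<subseteq> {0<..<L} - B"
    using gap_to_the_left[OF \<open>finite B\<close>, of t L] assms(2,3) by auto
  obtain m c where mc: "\<And>s. ereal s \<in> {a<..<t} \<Longrightarrow> F s = of_int m * s + c"
    using B[OF a] unfolding affine_on_def by blast
  have "\<forall>\<^sub>F s in at_left t. max a 0 < s"
    using a(1) assms(2) eventually_at_left by (metis max_less_iff_conj)
  moreover have "\<forall>\<^sub>F s in at_left t. s < t"
    by (simp add: eventually_at_filter)
  ultimately have "\<forall>\<^sub>F s in at_left t. F (real_of_ereal s) = of_int m * real_of_ereal s + c"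
  proof eventually_elim
    case (elim s)
    then have "ereal (real_of_ereal s) = s" by (cases s) auto
    then show ?case using elim mc[of "real_of_ereal s"] by simp
  qed
  then show ?thesis by (rule that)
qed

lemma pa_on_germ_left:
  assumes "pa_on L F" "0 < t" "ereal t \<le> L"
  obtains m :: int and c where "\<forall>\<^sub>F s in at_left t. F s = of_int m * s + c"
  using pa_on_germ_left_ereal[of L F "ereal t"] assms
  unfolding at_left_ereal eventually_filtermap by auto

lemma pa_on_germ_infinity:
  assumes "pa_on \<infinity> F"
  obtains m :: int and c where "\<forall>\<^sub>F s in at_top. F s = of_int m * s + c"
  using pa_on_germ_left_ereal[of \<infinity> F \<infinity>] assms
  unfolding at_left_PInf eventually_filtermap by auto

section \<open>Functions on a tropical curve, edge by edge\<close>

text \<open>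
  An edge of infinite length is a real half-line with one more point, so continuity on it splits into
  continuity at the real parameters and a limit at \<open>\<infinity>\<close>.
\<close>

lemma continuous_on_ereal_atLeastAtMost:
  fixes F :: "ereal \<Rightarrow> ereal"
  shows "continuous_on {0..L} F \<longleftrightarrow>
    continuous_on {t. 0 \<le> t \<and> ereal t \<le> L} (\<lambda>t. F (ereal t)) \<and>
    (L = \<infinity> \<longrightarrow> ((\<lambda>t. F (ereal t)) \<longlongrightarrow> F \<infinity>) at_top)"
    (is "?L \<longleftrightarrow> continuous_on ?T _ \<and> ?lim")
proof -
  have inf: "at \<infinity> within {0..\<infinity>} = filtermap ereal at_top"
  proof -
    have "at \<infinity> within {0..\<infinity>} = at_left (\<infinity>::ereal)"
      by (rule at_within_nhd[of _ "{0<..}"]) auto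
    then show ?thesis by (simp add: at_left_PInf)
  qed
  show ?thesis
  proof (rule iffI)
    assume L: ?L
    have "continuous_on ?T (\<lambda>t. F (ereal t))"
      by (rule continuous_on_compose2[OF L]) (auto intro: continuous_on_ereal continuous_on_id)
    moreover have "((\<lambda>t. F (ereal t)) \<longlongrightarrow> F \<infinity>) at_top" if "L = \<infinity>"
    proof -
      have "(F \<longlongrightarrow> F \<infinity>) (at \<infinity> within {0..\<infinity>})"
        using L that by (auto simp: continuous_on_def)
      then show ?thesis
        by (simp add: inf filterlim_filtermap)
    qed
    ultimately show "continuous_on ?T (\<lambda>t. F (ereal t)) \<and> ?lim" by blast
  next
    assume *: "continuous_on ?T (\<lambda>t. F (ereal t)) \<and> ?lim"
    have real: "continuous_on ({0..L} - {\<infinity>}) real_of_ereal"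
      by (rule continuous_on_subset[OF continuous_on_real]) auto
    have sub: "real_of_ereal ` ({0..L} - {\<infinity>}) \<subseteq> ?T"
    proof (rule image_subsetI)
      fix x :: ereal assume "x \<in> {0..L} - {\<infinity>}"
      then show "real_of_ereal x \<in> ?T" by (cases x) auto
    qed
    have "continuous_on ({0..L} - {\<infinity>}) (\<lambda>x. F (ereal (real_of_ereal x)))"
      using * by (intro continuous_on_compose2[OF _ real sub]) blast
    then have fin: "continuous_on ({0..L} - {\<infinity>}) F"
    proof (rule continuous_on_eq)
      fix x :: ereal assume "x \<in> {0..L} - {\<infinity>}"
      then show "F (ereal (real_of_ereal x)) = F x" by (cases x) auto
    qed
    show ?L
      unfolding continuous_on_def
    proof
      fix x assume x: "x \<in> {0..L}"
      show "(F \<longlongrightarrow> F x) (at x within {0..L})"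
      proof (cases "x = \<infinity>")
        case True
        then have "L = \<infinity>" using x by simp
        with * True show ?thesis by (simp add: inf filterlim_filtermap)
      next
        case False
        have "at x within {0..L} = at x within ({0..L} - {\<infinity>})"
          by (rule at_within_nhd[of _ "{..<\<infinity>}"]) (use False in auto)
        then show ?thesis
          using fin x False by (auto simp: continuous_on_def)
      qed
    qed
  qed
qed

definition finite_parameters :: "('v, 'e) edge_weighted_graph \<Rightarrow> 'e \<Rightarrow> real set" where
  "finite_parameters \<Gamma> e = {t. 0 \<le> t \<and> ereal t \<le> len \<Gamma> e}"

definition pl_function :: "('v, 'e) edge_weighted_graph \<Rightarrow> (('v, 'e) point \<Rightarrow> real) \<Rightarrow> bool" where
  "pl_function \<Gamma> h \<longleftrightarrow> (\<forall>e\<in>arcs (skeleton \<Gamma>).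
     pa_on (len \<Gamma> e) (\<lambda>t. h (edge_point \<Gamma> e (ereal t))) \<and>
     continuous_on (finite_parameters \<Gamma> e) (\<lambda>t. h (edge_point \<Gamma> e (ereal t))))"

text \<open>
  The rational functions other than the constant \<open>-\<infinity>\<close>, which are the invertible elements of the
  semifield.  Real values at the finite points already exclude that constant.
\<close>

definition rational_units :: "('v, 'e) edge_weighted_graph \<Rightarrow> (('v, 'e) point \<Rightarrow> ereal) set" where
  "rational_units \<Gamma> = {f \<in> extensional (points \<Gamma>).
     continuous_map (curve_topology \<Gamma>) euclidean f \<and>
     piecewise_affine \<Gamma> f \<and>
     (\<forall>x\<in>finite_points \<Gamma>. \<bar>f x\<bar> \<noteq> \<infinity>)}"

lemma pl_function_const: "pl_function \<Gamma> (\<lambda>x. c)"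
  by (simp add: pl_function_def pa_on_const)

lemma pl_function_add: "pl_function \<Gamma> f \<Longrightarrow> pl_function \<Gamma> g \<Longrightarrow> pl_function \<Gamma> (\<lambda>x. f x + g x)"
  by (simp add: pl_function_def pa_on_add continuous_on_add)

lemma pl_function_max: "pl_function \<Gamma> f \<Longrightarrow> pl_function \<Gamma> g \<Longrightarrow> pl_function \<Gamma> (\<lambda>x. max (f x) (g x))"
  by (simp add: pl_function_def pa_on_max continuous_on_max)

lemma pl_function_scale: "pl_function \<Gamma> f \<Longrightarrow> pl_function \<Gamma> (\<lambda>x. of_int k * f x)"
  by (simp add: pl_function_def pa_on_scale continuous_on_mult_left)

lemma affine_limit_at_top:
  fixes m c :: real
  shows "\<exists>l::ereal. ((\<lambda>t. ereal (m * t + c)) \<longlongrightarrow> l) at_top"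
proof -
  have pos: "((\<lambda>t. ereal (m * t + c)) \<longlongrightarrow> \<infinity>) at_top" if "m > 0" for m c :: real
    unfolding tendsto_PInfty_eq_at_top filterlim_at_top
  proof
    fix Z
    show "\<forall>\<^sub>F t in at_top. Z \<le> m * t + c"
      using eventually_ge_at_top[of "(Z - c) / m"]
      by eventually_elim (use that in \<open>simp add: field_simps\<close>)
  qed
  consider "m = 0" | "m > 0" | "m < 0" by linarith
  then show ?thesis
  proof cases
    case 3
    have "((\<lambda>t. - ereal ((-m) * t + (-c))) \<longlongrightarrow> - \<infinity>) at_top"
      by (intro tendsto_uminus_ereal pos) (use 3 in simp)
    then have "((\<lambda>t. ereal (m * t + c)) \<longlongrightarrow> - \<infinity>) at_top"
      by (simp add: algebra_simps)
    then show ?thesis by blast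
  qed (use pos in auto)
qed

context tropical_curve
begin

text \<open>
  The head of an edge of infinite length has valence one, and that edge alone uses the valence up.
\<close>

lemma infinite_edge_unique:
  assumes e: "e \<in> arcs (skeleton \<Gamma>)" "len \<Gamma> e = \<infinity>" and e': "e' \<in> arcs (skeleton \<Gamma>)"
  shows "tail (skeleton \<Gamma>) e' \<noteq> head (skeleton \<Gamma>) e"
    and "head (skeleton \<Gamma>) e' = head (skeleton \<Gamma>) e \<Longrightarrow> e' = e"
proof -
  let ?v = "head (skeleton \<Gamma>) e"
  have 1: "card (in_arcs (skeleton \<Gamma>) ?v) + card (out_arcs (skeleton \<Gamma>) ?v) = 1"
    using len_infinite_leaf[OF e] by (simp add: in_degree_def out_degree_def)
  have fin: "finite (in_arcs (skeleton \<Gamma>) ?v)" "finite (out_arcs (skeleton \<Gamma>) ?v)"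
    by auto
  have "e \<in> in_arcs (skeleton \<Gamma>) ?v" using e by simp
  then have "card (in_arcs (skeleton \<Gamma>) ?v) \<noteq> 0" using fin by auto
  with 1 have 2: "card (in_arcs (skeleton \<Gamma>) ?v) = 1" "card (out_arcs (skeleton \<Gamma>) ?v) = 0"
    by linarith+
  then have "out_arcs (skeleton \<Gamma>) ?v = {}" using fin by simp
  then show "tail (skeleton \<Gamma>) e' \<noteq> ?v" using e' by auto
  obtain a where "in_arcs (skeleton \<Gamma>) ?v = {a}"
    using 2(1) by (auto simp: card_1_singleton_iff)
  then show "e' = e" if "head (skeleton \<Gamma>) e' = ?v"
    using that e e' by (metis in_in_arcs_conv singletonD)
qed

lemma finite_points_edge_point:
  assumes "e \<in> arcs (skeleton \<Gamma>)" "t \<in> finite_parameters \<Gamma> e"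
  shows "edge_point \<Gamma> e (ereal t) \<in> finite_points \<Gamma>"
proof -
  have "edge_point \<Gamma> e (ereal t) \<in> points \<Gamma>"
    using assms edge_point_in_points[of e "ereal t"] by (simp add: finite_parameters_def)
  moreover have "edge_point \<Gamma> e (ereal t) \<noteq> edge_point \<Gamma> e' \<infinity>"
    if "e' \<in> arcs (skeleton \<Gamma>)" "len \<Gamma> e' = \<infinity>" for e'
    using that assms infinite_edge_unique[of e' e] by (auto simp: edge_point_def)
  ultimately show ?thesis
    by (auto simp: finite_points_def infinite_points_def)
qed

lemma Inner_finite_points:
  "Inner e t \<in> finite_points \<Gamma> \<longleftrightarrow> e \<in> arcs (skeleton \<Gamma>) \<and> 0 < t \<and> ereal t < len \<Gamma> e"
  by (auto simp: finite_points_def infinite_points_def points_def edge_point_def)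

lemma infinite_points_cases:
  assumes "x \<in> points \<Gamma>" "x \<notin> finite_points \<Gamma>"
  obtains e where "e \<in> arcs (skeleton \<Gamma>)" "len \<Gamma> e = \<infinity>" "x = edge_point \<Gamma> e \<infinity>"
  using assms by (auto simp: finite_points_def infinite_points_def)

lemma finite_points_nonempty: "finite_points \<Gamma> \<noteq> {}"
proof -
  obtain v where v: "v \<in> verts (skeleton \<Gamma>)"
    using skeleton_connected by (auto simp: connected_def strongly_connected_def)
  show ?thesis
  proof (cases "Vertex v \<in> finite_points \<Gamma>")
    case False
    moreover have "Vertex v \<in> points \<Gamma>" using v by (simp add: points_def)
    ultimately obtain e where "e \<in> arcs (skeleton \<Gamma>)" "len \<Gamma> e = \<infinity>"
      using infinite_points_cases by blast
    then show ?thesis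
      using finite_points_edge_point[of e 0] by (auto simp: finite_parameters_def)
  qed auto
qed

text \<open>
  This is the universal property of the quotient topology.
\<close>

lemma continuous_map_edges:
  fixes f :: "('v, 'e) point \<Rightarrow> 'a::topological_space"
  shows "continuous_map (curve_topology \<Gamma>) euclidean f \<longleftrightarrow>
    (\<forall>e\<in>arcs (skeleton \<Gamma>). continuous_on {0..len \<Gamma> e} (\<lambda>t. f (edge_point \<Gamma> e t)))"
proof -
  have eq: "{t \<in> {0..len \<Gamma> e}. edge_point \<Gamma> e t \<in> {x \<in> points \<Gamma>. f x \<in> U}}
      = {t \<in> {0..len \<Gamma> e}. f (edge_point \<Gamma> e t) \<in> U}" if "e \<in> arcs (skeleton \<Gamma>)" for e U
    using edge_point_in_points[OF that] by auto
  have "continuous_map (curve_topology \<Gamma>) euclidean f \<longleftrightarrow>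
    (\<forall>e\<in>arcs (skeleton \<Gamma>). \<forall>U. open U \<longrightarrow>
      openin (top_of_set {0..len \<Gamma> e}) {t \<in> {0..len \<Gamma> e}. f (edge_point \<Gamma> e t) \<in> U})"
    unfolding continuous_map_def topspace_curve_topology openin_curve_topology curve_open_def
    using eq by auto
  also have "\<dots> \<longleftrightarrow>
    (\<forall>e\<in>arcs (skeleton \<Gamma>). continuous_on {0..len \<Gamma> e} (\<lambda>t. f (edge_point \<Gamma> e t)))"
    unfolding continuous_map_iff_continuous[symmetric] continuous_map_def by simp
  finally show ?thesis .
qed

lemma rational_functions_nonzero:
  "rational_functions \<Gamma> - {const_fun \<Gamma> (-\<infinity>)} = rational_units \<Gamma>"
proof -
  obtain x where "x \<in> finite_points \<Gamma>" using finite_points_nonempty by blast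
  then have "const_fun \<Gamma> (-\<infinity>) \<notin> rational_units \<Gamma>"
    by (auto simp: rational_units_def const_fun_def finite_points_def)
  then show ?thesis
    by (auto simp: rational_functions_def rational_units_def)
qed

lemma rational_units_finite:
  "f \<in> rational_units \<Gamma> \<Longrightarrow> x \<in> finite_points \<Gamma> \<Longrightarrow> ereal (real_of_ereal (f x)) = f x"
  by (simp add: rational_units_def ereal_real)

lemma piecewise_affine_iff_pa_on:
  assumes "\<And>x. x \<in> finite_points \<Gamma> \<Longrightarrow> \<bar>f x\<bar> \<noteq> \<infinity>"
  shows "piecewise_affine \<Gamma> f \<longleftrightarrow>
    (\<forall>e\<in>arcs (skeleton \<Gamma>). pa_on (len \<Gamma> e) (\<lambda>t. real_of_ereal (f (edge_point \<Gamma> e (ereal t)))))"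
proof -
  have key: "(a < b \<and> {a<..<b} \<subseteq> {0<..<len \<Gamma> e} - B \<longrightarrow>
          (\<exists>m::int. \<exists>c::real. \<forall>t::real. ereal t \<in> {a<..<b} \<longrightarrow>
            f (edge_point \<Gamma> e (ereal t)) = ereal (of_int m * t + c))) \<longleftrightarrow>
        (a < b \<and> {a<..<b} \<subseteq> {0<..<len \<Gamma> e} - B \<longrightarrow>
          affine_on a b (\<lambda>t. real_of_ereal (f (edge_point \<Gamma> e (ereal t)))))"
    if e: "e \<in> arcs (skeleton \<Gamma>)" for e a b B
  proof (intro imp_cong refl)
    assume ab: "a < b \<and> {a<..<b} \<subseteq> {0<..<len \<Gamma> e} - B"
    have "f (edge_point \<Gamma> e (ereal t)) = ereal y \<longleftrightarrow>
        real_of_ereal (f (edge_point \<Gamma> e (ereal t))) = y" if "ereal t \<in> {a<..<b}" for t y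
    proof -
      have "ereal t \<in> {0<..<len \<Gamma> e}" using that ab by auto
      then have "\<bar>f (edge_point \<Gamma> e (ereal t))\<bar> \<noteq> \<infinity>"
        using finite_points_edge_point[OF e, of t] by (intro assms) (simp add: finite_parameters_def less_imp_le)
      then show ?thesis by (cases "f (edge_point \<Gamma> e (ereal t))") auto
    qed
    then show "(\<exists>m::int. \<exists>c::real. \<forall>t::real. ereal t \<in> {a<..<b} \<longrightarrow>
            f (edge_point \<Gamma> e (ereal t)) = ereal (of_int m * t + c)) \<longleftrightarrow>
          affine_on a b (\<lambda>t. real_of_ereal (f (edge_point \<Gamma> e (ereal t))))"
      unfolding affine_on_def by (simp cong: imp_cong)
  qed
  show ?thesis
    unfolding piecewise_affine_def pa_on_def by (rule ball_cong[OF refl]) (simp only: key)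
qed

lemma rational_units_pl:
  assumes f: "f \<in> rational_units \<Gamma>"
  shows "pl_function \<Gamma> (\<lambda>x. real_of_ereal (f x))"
  unfolding pl_function_def
proof (intro ballI conjI)
  fix e assume e: "e \<in> arcs (skeleton \<Gamma>)"
  show "pa_on (len \<Gamma> e) (\<lambda>t. real_of_ereal (f (edge_point \<Gamma> e (ereal t))))"
    using f e piecewise_affine_iff_pa_on[of f] by (auto simp: rational_units_def)
  have "continuous_on {0..len \<Gamma> e} (\<lambda>t. f (edge_point \<Gamma> e t))"
    using f e unfolding rational_units_def continuous_map_edges by blast
  then have "continuous_on (finite_parameters \<Gamma> e) (\<lambda>t. f (edge_point \<Gamma> e (ereal t)))"
    unfolding continuous_on_ereal_atLeastAtMost finite_parameters_def by blast
  moreover have "\<bar>f (edge_point \<Gamma> e (ereal t))\<bar> \<noteq> \<infinity>" if "t \<in> finite_parameters \<Gamma> e" for t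
    using f finite_points_edge_point[OF e that] by (simp add: rational_units_def)
  ultimately show "continuous_on (finite_parameters \<Gamma> e) (\<lambda>t. real_of_ereal (f (edge_point \<Gamma> e (ereal t))))"
    by (subst (asm) continuous_on_iff_real) (auto simp: o_def)
qed

lemma rational_units_limit:
  assumes f: "f \<in> rational_units \<Gamma>" and e: "e \<in> arcs (skeleton \<Gamma>)" "len \<Gamma> e = \<infinity>"
  shows "((\<lambda>t. f (edge_point \<Gamma> e (ereal t))) \<longlongrightarrow> f (edge_point \<Gamma> e \<infinity>)) at_top"
proof -
  have "continuous_on {0..len \<Gamma> e} (\<lambda>t. f (edge_point \<Gamma> e t))"
    using f e(1) unfolding rational_units_def continuous_map_edges by blast
  then show ?thesis
    unfolding continuous_on_ereal_atLeastAtMost using e(2) by blast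
qed

lemma rational_unitsI:
  assumes ext: "f \<in> extensional (points \<Gamma>)"
    and fin: "\<And>x. x \<in> finite_points \<Gamma> \<Longrightarrow> f x = ereal (h x)"
    and pl: "pl_function \<Gamma> h"
    and lim: "\<And>e. e \<in> arcs (skeleton \<Gamma>) \<Longrightarrow> len \<Gamma> e = \<infinity> \<Longrightarrow>
      ((\<lambda>t. ereal (h (edge_point \<Gamma> e (ereal t)))) \<longlongrightarrow> f (edge_point \<Gamma> e \<infinity>)) at_top"
  shows "f \<in> rational_units \<Gamma>"
proof -
  have edge: "f (edge_point \<Gamma> e (ereal t)) = ereal (h (edge_point \<Gamma> e (ereal t)))"
    if "e \<in> arcs (skeleton \<Gamma>)" "t \<in> finite_parameters \<Gamma> e" for e t
    using fin finite_points_edge_point that by blast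
  have "piecewise_affine \<Gamma> f"
  proof (subst piecewise_affine_iff_pa_on)
    show "\<bar>f x\<bar> \<noteq> \<infinity>" if "x \<in> finite_points \<Gamma>" for x using fin that by simp
    show "\<forall>e\<in>arcs (skeleton \<Gamma>). pa_on (len \<Gamma> e) (\<lambda>t. real_of_ereal (f (edge_point \<Gamma> e (ereal t))))"
    proof
      fix e assume e: "e \<in> arcs (skeleton \<Gamma>)"
      show "pa_on (len \<Gamma> e) (\<lambda>t. real_of_ereal (f (edge_point \<Gamma> e (ereal t))))"
        by (rule pa_on_cong[of _ "\<lambda>t. h (edge_point \<Gamma> e (ereal t))"])
          (use pl e edge[OF e] in \<open>auto simp: pl_function_def finite_parameters_def\<close>)
    qed
  qed
  moreover have "continuous_map (curve_topology \<Gamma>) euclidean f"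
    unfolding continuous_map_edges continuous_on_ereal_atLeastAtMost
  proof (intro ballI conjI impI)
    fix e assume e: "e \<in> arcs (skeleton \<Gamma>)"
    have "continuous_on (finite_parameters \<Gamma> e) (\<lambda>t. ereal (h (edge_point \<Gamma> e (ereal t))))"
      using pl e by (auto simp: pl_function_def intro: continuous_on_ereal)
    then show "continuous_on {t. 0 \<le> t \<and> ereal t \<le> len \<Gamma> e} (\<lambda>t. f (edge_point \<Gamma> e (ereal t)))"
      using edge[OF e] unfolding finite_parameters_def by (subst continuous_on_cong[OF refl]) auto
    assume inf: "len \<Gamma> e = \<infinity>"
    have "\<forall>\<^sub>F t in at_top. f (edge_point \<Gamma> e (ereal t)) = ereal (h (edge_point \<Gamma> e (ereal t)))"
      using eventually_ge_at_top[of 0] by eventually_elim (simp add: edge[OF e] finite_parameters_def inf)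
    then show "((\<lambda>t. f (edge_point \<Gamma> e (ereal t))) \<longlongrightarrow> f (edge_point \<Gamma> e \<infinity>)) at_top"
      using lim[OF e inf] by (simp add: tendsto_cong)
  qed
  ultimately show ?thesis
    using ext fin by (auto simp: rational_units_def)
qed

lemma continuous_map_eq_if_eq_on_finite_points:
  fixes f g :: "('v, 'e) point \<Rightarrow> ereal"
  assumes f: "f \<in> extensional (points \<Gamma>)" "continuous_map (curve_topology \<Gamma>) euclidean f"
    and g: "g \<in> extensional (points \<Gamma>)" "continuous_map (curve_topology \<Gamma>) euclidean g"
    and eq: "\<And>x. x \<in> finite_points \<Gamma> \<Longrightarrow> f x = g x"
  shows "f = g"
proof
  fix x
  consider "x \<notin> points \<Gamma>" | "x \<in> finite_points \<Gamma>" | "x \<in> points \<Gamma>" "x \<notin> finite_points \<Gamma>" by blast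
  then show "f x = g x"
  proof cases
    case 1 then show ?thesis using f(1) g(1) by (simp add: extensional_def)
  next
    case 2 then show ?thesis by (rule eq)
  next
    case 3
    then obtain e where e: "e \<in> arcs (skeleton \<Gamma>)" "len \<Gamma> e = \<infinity>" "x = edge_point \<Gamma> e \<infinity>"
      by (rule infinite_points_cases)
    have f': "((\<lambda>t. f (edge_point \<Gamma> e (ereal t))) \<longlongrightarrow> f x) at_top"
      and g': "((\<lambda>t. g (edge_point \<Gamma> e (ereal t))) \<longlongrightarrow> g x) at_top"
      using f(2) g(2) e unfolding continuous_map_edges continuous_on_ereal_atLeastAtMost by auto
    have "\<forall>\<^sub>F t in at_top. f (edge_point \<Gamma> e (ereal t)) = g (edge_point \<Gamma> e (ereal t))"
      using eventually_ge_at_top[of 0]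
      by eventually_elim (auto intro!: eq finite_points_edge_point simp: e finite_parameters_def)
    with f' have "((\<lambda>t. g (edge_point \<Gamma> e (ereal t))) \<longlongrightarrow> f x) at_top"
      by (simp add: tendsto_cong)
    then show ?thesis
      using g' tendsto_unique[OF trivial_limit_at_top_linorder] by blast
  qed
qed

text \<open>
  Near the end of an infinite edge the function is affine, so it has a limit in the extended reals.
  Hence sums and maxima of rational functions, which are defined pointwise only at finite points,
  extend to rational functions.
\<close>

lemma pl_function_extension:
  assumes pl: "pl_function \<Gamma> h"
  obtains f where "f \<in> rational_units \<Gamma>" "\<And>x. x \<in> finite_points \<Gamma> \<Longrightarrow> f x = ereal (h x)"
proof -
  have lim: "\<exists>l::ereal. ((\<lambda>t. ereal (h (edge_point \<Gamma> e (ereal t)))) \<longlongrightarrow> l) at_top"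
    if e: "e \<in> arcs (skeleton \<Gamma>)" "len \<Gamma> e = \<infinity>" for e
  proof -
    obtain m c where "\<forall>\<^sub>F t in at_top. h (edge_point \<Gamma> e (ereal t)) = of_int m * t + c"
      using pl e pa_on_germ_infinity unfolding pl_function_def by metis
    then have "\<forall>\<^sub>F t in at_top. ereal (of_int m * t + c) = ereal (h (edge_point \<Gamma> e (ereal t)))"
      by eventually_elim simp
    moreover obtain l where "((\<lambda>t. ereal (of_int m * t + c)) \<longlongrightarrow> l) at_top"
      using affine_limit_at_top by blast
    ultimately show ?thesis by (blast intro: Lim_transform_eventually)
  qed
  define L where "L e = (SOME l. ((\<lambda>t. ereal (h (edge_point \<Gamma> e (ereal t)))) \<longlongrightarrow> l) at_top)" for e
  have L: "((\<lambda>t. ereal (h (edge_point \<Gamma> e (ereal t)))) \<longlongrightarrow> L e) at_top"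
    if "e \<in> arcs (skeleton \<Gamma>)" "len \<Gamma> e = \<infinity>" for e
    unfolding L_def by (rule someI_ex[OF lim[OF that]])
  define f where "f = (\<lambda>x\<in>points \<Gamma>. if x \<in> finite_points \<Gamma> then ereal (h x) else
    L (THE e. e \<in> arcs (skeleton \<Gamma>) \<and> len \<Gamma> e = \<infinity> \<and> edge_point \<Gamma> e \<infinity> = x))"
  have fin: "f x = ereal (h x)" if "x \<in> finite_points \<Gamma>" for x
    using that by (auto simp: f_def finite_points_def)
  moreover have "f \<in> rational_units \<Gamma>"
  proof (rule rational_unitsI[OF _ fin pl])
    show "f \<in> extensional (points \<Gamma>)" by (simp add: f_def)
    fix e assume e: "e \<in> arcs (skeleton \<Gamma>)" "len \<Gamma> e = \<infinity>"
    have "(THE e'. e' \<in> arcs (skeleton \<Gamma>) \<and> len \<Gamma> e' = \<infinity> \<and> edge_point \<Gamma> e' \<infinity> = edge_point \<Gamma> e \<infinity>) = e"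
      by (rule the_equality) (use e infinite_edge_unique(2)[OF e] in \<open>auto simp: edge_point_def\<close>)
    moreover have "edge_point \<Gamma> e \<infinity> \<in> points \<Gamma>" "edge_point \<Gamma> e \<infinity> \<notin> finite_points \<Gamma>"
      using e edge_point_in_points[of e \<infinity>] by (auto simp: finite_points_def infinite_points_def)
    ultimately have "f (edge_point \<Gamma> e \<infinity>) = L e" by (simp add: f_def)
    then show "((\<lambda>t. ereal (h (edge_point \<Gamma> e (ereal t)))) \<longlongrightarrow> f (edge_point \<Gamma> e \<infinity>)) at_top"
      using L[OF e] by simp
  qed
  ultimately show ?thesis by (rule that[rotated])
qed

lemma continuous_extension_unit:
  assumes f: "f \<in> rational_units \<Gamma>" and eq: "\<And>x. x \<in> finite_points \<Gamma> \<Longrightarrow> f x = h x"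
  shows "continuous_extension \<Gamma> h = f"
  unfolding continuous_extension_def
proof (rule the_equality)
  show "f \<in> extensional (points \<Gamma>) \<and> continuous_map (curve_topology \<Gamma>) euclidean f \<and>
      (\<forall>x\<in>finite_points \<Gamma>. f x = h x)"
    using f eq by (simp add: rational_units_def)
next
  fix g assume "g \<in> extensional (points \<Gamma>) \<and> continuous_map (curve_topology \<Gamma>) euclidean g \<and>
      (\<forall>x\<in>finite_points \<Gamma>. g x = h x)"
  then show "g = f"
    using f eq by (intro continuous_map_eq_if_eq_on_finite_points) (auto simp: rational_units_def)
qed

lemma rational_units_eqI:
  assumes "f \<in> rational_units \<Gamma>" "g \<in> rational_units \<Gamma>" "\<And>x. x \<in> finite_points \<Gamma> \<Longrightarrow> f x = g x"
  shows "f = g"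
  using assms by (intro continuous_map_eq_if_eq_on_finite_points) (auto simp: rational_units_def)

lemma Rat_add_units:
  assumes "f \<in> rational_units \<Gamma>" "g \<in> rational_units \<Gamma>"
  shows "f \<oplus>\<^bsub>Rat \<Gamma>\<^esub> g \<in> rational_units \<Gamma>"
    and "x \<in> finite_points \<Gamma> \<Longrightarrow> (f \<oplus>\<^bsub>Rat \<Gamma>\<^esub> g) x = max (f x) (g x)"
proof -
  obtain h where h: "h \<in> rational_units \<Gamma>"
    "\<And>x. x \<in> finite_points \<Gamma> \<Longrightarrow> h x = ereal (max (real_of_ereal (f x)) (real_of_ereal (g x)))"
    using pl_function_extension[OF pl_function_max[OF assms[THEN rational_units_pl]]] by auto
  have eq: "h x = max (f x) (g x)" if "x \<in> finite_points \<Gamma>" for x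
    using h(2)[OF that] rational_units_finite[OF assms(1) that] rational_units_finite[OF assms(2) that]
    by (metis ereal_max)
  then have "f \<oplus>\<^bsub>Rat \<Gamma>\<^esub> g = h"
    using continuous_extension_unit[OF h(1)] by (simp add: Rat_def)
  with eq h(1) show "f \<oplus>\<^bsub>Rat \<Gamma>\<^esub> g \<in> rational_units \<Gamma>"
    and "x \<in> finite_points \<Gamma> \<Longrightarrow> (f \<oplus>\<^bsub>Rat \<Gamma>\<^esub> g) x = max (f x) (g x)" by auto
qed

lemma Rat_mult_units:
  assumes "f \<in> rational_units \<Gamma>" "g \<in> rational_units \<Gamma>"
  shows "f \<otimes>\<^bsub>Rat \<Gamma>\<^esub> g \<in> rational_units \<Gamma>"
    and "x \<in> finite_points \<Gamma> \<Longrightarrow> (f \<otimes>\<^bsub>Rat \<Gamma>\<^esub> g) x = f x + g x"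
proof -
  obtain h where h: "h \<in> rational_units \<Gamma>"
    "\<And>x. x \<in> finite_points \<Gamma> \<Longrightarrow> h x = ereal (real_of_ereal (f x) + real_of_ereal (g x))"
    using pl_function_extension[OF pl_function_add[OF assms[THEN rational_units_pl]]] by auto
  have eq: "h x = f x + g x" if "x \<in> finite_points \<Gamma>" for x
    using h(2)[OF that] rational_units_finite[OF assms(1) that] rational_units_finite[OF assms(2) that]
    by (metis plus_ereal.simps(1))
  then have "f \<otimes>\<^bsub>Rat \<Gamma>\<^esub> g = h"
    using continuous_extension_unit[OF h(1)] by (simp add: Rat_def)
  with eq h(1) show "f \<otimes>\<^bsub>Rat \<Gamma>\<^esub> g \<in> rational_units \<Gamma>"
    and "x \<in> finite_points \<Gamma> \<Longrightarrow> (f \<otimes>\<^bsub>Rat \<Gamma>\<^esub> g) x = f x + g x" by auto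
qed

lemma const_fun_unit: "const_fun \<Gamma> (ereal c) \<in> rational_units \<Gamma>"
proof (rule rational_unitsI[where h = "\<lambda>_. c"])
  show "const_fun \<Gamma> (ereal c) \<in> extensional (points \<Gamma>)" by (simp add: const_fun_def)
  show "const_fun \<Gamma> (ereal c) x = ereal c" if "x \<in> finite_points \<Gamma>" for x
    using that by (simp add: const_fun_def finite_points_def)
  show "pl_function \<Gamma> (\<lambda>_. c)" by (rule pl_function_const)
  fix e assume "e \<in> arcs (skeleton \<Gamma>)" "len \<Gamma> e = \<infinity>"
  then have "edge_point \<Gamma> e \<infinity> \<in> points \<Gamma>" using edge_point_in_points[of e \<infinity>] by simp
  then show "((\<lambda>t. ereal c) \<longlongrightarrow> const_fun \<Gamma> (ereal c) (edge_point \<Gamma> e \<infinity>)) at_top"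
    by (simp add: const_fun_def)
qed

end

section \<open>Distances to a finite point\<close>

lemma finite_positive_lower_bound:
  fixes S :: "ereal set"
  assumes "finite S" "\<And>x. x \<in> S \<Longrightarrow> 0 < x"
  shows "\<exists>\<delta>::real. 0 < \<delta> \<and> (\<forall>x\<in>S. ereal \<delta> \<le> x)"
proof -
  have "0 < Min (insert 1 S)"
    by (subst Min_gr_iff) (use assms in auto)
  then obtain \<delta> where \<delta>: "0 < ereal \<delta>" "ereal \<delta> < Min (insert 1 S)"
    using ereal_dense2 by blast
  then have "ereal \<delta> \<le> x" if "x \<in> S" for x
    using Min_le[of "insert 1 S" x] assms(1) that by auto
  with \<delta>(1) show ?thesis by auto
qed

definition ray_point ::
    "('v, 'e) edge_weighted_graph \<Rightarrow> 'e \<times> ereal \<times> bool \<Rightarrow> real \<Rightarrow> ('v, 'e) point" where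
  "ray_point \<Gamma> d s = (case d of (e, t, b) \<Rightarrow>
     edge_point \<Gamma> e (if b then t + ereal s else t - ereal s))"

definition marked_parameters ::
    "('v, 'e) edge_weighted_graph \<Rightarrow> ('v, 'e) point \<Rightarrow> 'e \<Rightarrow> ereal set" where
  "marked_parameters \<Gamma> x e = {0, len \<Gamma> e} \<union> {t \<in> {0..len \<Gamma> e}. edge_point \<Gamma> e t = x}"

text \<open>
  On every edge, the ends and the occurrences of \<open>x\<close> are at least \<open>\<delta>\<close> apart.  Within distance
  \<open>\<delta> / 2\<close> of \<open>x\<close> the curve is then a star, whose rays are the directions at \<open>x\<close>.
\<close>

definition parameter_gap ::
    "('v, 'e) edge_weighted_graph \<Rightarrow> ('v, 'e) point \<Rightarrow> real \<Rightarrow> bool" where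
  "parameter_gap \<Gamma> x \<delta> \<longleftrightarrow> 0 < \<delta> \<and>
     (\<forall>e\<in>arcs (skeleton \<Gamma>). \<forall>a\<in>marked_parameters \<Gamma> x e. \<forall>b\<in>marked_parameters \<Gamma> x e.
        a \<noteq> b \<longrightarrow> ereal \<delta> \<le> \<bar>a - b\<bar>)"

context tropical_curve
begin

lemma path_of_length_nonneg: "path_of_length \<Gamma> x y L \<Longrightarrow> 0 \<le> L"
  by (induction rule: path_of_length.induct) auto

lemma curve_dist_le: "path_of_length \<Gamma> x y L \<Longrightarrow> curve_dist \<Gamma> x y \<le> L"
  unfolding curve_dist_def by (rule Inf_lower) simp

lemma curve_dist_nonneg: "0 \<le> curve_dist \<Gamma> x y"
  unfolding curve_dist_def by (rule Inf_greatest) (auto dest: path_of_length_nonneg)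

lemma curve_dist_self: "x \<in> points \<Gamma> \<Longrightarrow> curve_dist \<Gamma> x x = 0"
  using curve_dist_le[OF path_of_length.trivial, of x] curve_dist_nonneg[of x x] by auto

lemma curve_dist_segment:
  assumes "e \<in> arcs (skeleton \<Gamma>)" "s \<in> {0..len \<Gamma> e}" "t \<in> {0..len \<Gamma> e}"
  shows "curve_dist \<Gamma> (edge_point \<Gamma> e s) y \<le> \<bar>t - s\<bar> + curve_dist \<Gamma> (edge_point \<Gamma> e t) y"
proof (cases "\<bar>t - s\<bar>")
  case (real r)
  have "curve_dist \<Gamma> (edge_point \<Gamma> e s) y - ereal r \<le> curve_dist \<Gamma> (edge_point \<Gamma> e t) y"
    unfolding curve_dist_def[of _ "edge_point \<Gamma> e t"]
  proof (rule Inf_greatest)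
    fix L assume "L \<in> {L. path_of_length \<Gamma> (edge_point \<Gamma> e t) y L}"
    then have "curve_dist \<Gamma> (edge_point \<Gamma> e s) y \<le> \<bar>t - s\<bar> + L"
      by (intro curve_dist_le path_of_length.segment assms) simp
    then show "curve_dist \<Gamma> (edge_point \<Gamma> e s) y - ereal r \<le> L"
      by (simp add: real ereal_minus_le add.commute)
  qed
  then show ?thesis by (simp add: real ereal_minus_le add.commute)
next
  case PInf
  then show ?thesis using curve_dist_nonneg by simp
next
  case MInf
  then show ?thesis by (cases "t - s") auto
qed

lemma edge_point_Inner:
  assumes "0 < s" "ereal s < len \<Gamma> e"
  shows "edge_point \<Gamma> e (ereal s) = Inner e s"
  using assms by (auto simp: edge_point_def)

lemma edge_point_eq_Inner:
  assumes "edge_point \<Gamma> e' s' = Inner e s" "s' \<in> {0..len \<Gamma> e'}"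
  shows "e' = e \<and> s' = ereal s \<and> 0 < s \<and> ereal s < len \<Gamma> e"
  using assms by (cases s') (auto simp: edge_point_def less_le split: if_splits)

lemma edge_point_eq_Vertex:
  assumes "edge_point \<Gamma> e t = Vertex v"
  shows "t = 0 \<or> t = len \<Gamma> e"
  using assms by (auto simp: edge_point_def split: if_splits)

lemma finite_edge_parameter:
  assumes "e \<in> arcs (skeleton \<Gamma>)" "t \<in> {0..len \<Gamma> e}" "edge_point \<Gamma> e t \<in> finite_points \<Gamma>"
  shows "\<bar>t\<bar> \<noteq> \<infinity>"
  using assms by (auto simp: finite_points_def infinite_points_def)

text \<open>
  A path that starts inside an edge either leaves the edge through one of its two ends or reaches its
  target on the edge.  Hence along an edge the distance to a fixed point is a minimum of at most
  three piecewise affine functions.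
\<close>

lemma path_from_Inner_lower_bound:
  assumes "path_of_length \<Gamma> (Inner e s) x L"
  shows "curve_dist \<Gamma> (Vertex (tail (skeleton \<Gamma>) e)) x + ereal s \<le> L \<or>
    (len \<Gamma> e \<noteq> \<infinity> \<and> curve_dist \<Gamma> (Vertex (head (skeleton \<Gamma>) e)) x + (len \<Gamma> e - ereal s) \<le> L) \<or>
    (\<exists>t. x = Inner e t \<and> ereal \<bar>s - t\<bar> \<le> L)"
  using assms
proof (induction "Inner e s :: ('v, 'e) point" x L arbitrary: s rule: path_of_length.induct)
  case trivial
  then show ?case by auto
next
  case (segment e' s' t y L)
  have s: "e' = e" "s' = ereal s" "0 < s" "ereal s < len \<Gamma> e"
    using edge_point_eq_Inner[of e' s' e s] segment.hyps(2,6) by auto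
  note path = segment.hyps(4)
  have L: "0 \<le> L" using path_of_length_nonneg[OF path] .
  consider "t = 0" | "t = len \<Gamma> e" "t \<noteq> 0" "t \<noteq> \<infinity>" | "t = \<infinity>"
    | u where "t = ereal u" "0 < u" "ereal u < len \<Gamma> e"
    using segment.hyps(3) s(1) by (cases t) (force simp: less_le)+
  then show ?case
  proof cases
    case 1
    then have "curve_dist \<Gamma> (Vertex (tail (skeleton \<Gamma>) e)) y \<le> L"
      using curve_dist_le[OF path] by (simp add: s(1) edge_point_def)
    from add_right_mono[OF this, of "ereal s"]
    have "curve_dist \<Gamma> (Vertex (tail (skeleton \<Gamma>) e)) y + ereal s \<le> \<bar>t - s'\<bar> + L"
      using 1 s by (simp add: add.commute)
    then show ?thesis by blast
  next
    case 2
    then have "curve_dist \<Gamma> (Vertex (head (skeleton \<Gamma>) e)) y \<le> L"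
      using curve_dist_le[OF path] by (simp add: s(1) edge_point_def)
    from add_right_mono[OF this, of "len \<Gamma> e - ereal s"]
    have "curve_dist \<Gamma> (Vertex (head (skeleton \<Gamma>) e)) y + (len \<Gamma> e - ereal s) \<le> L + (len \<Gamma> e - ereal s)" .
    moreover have "\<bar>t - s'\<bar> = len \<Gamma> e - ereal s"
      using 2 s by (cases "len \<Gamma> e") auto
    ultimately have "curve_dist \<Gamma> (Vertex (head (skeleton \<Gamma>) e)) y + (len \<Gamma> e - ereal s) \<le> \<bar>t - s'\<bar> + L"
      by (simp add: add.commute)
    then show ?thesis using 2 by blast
  next
    case 3
    then have inf: "\<bar>t - s'\<bar> + L = \<infinity>" using s L by simp
    show ?thesis unfolding inf by simp
  next
    case (4 u)
    have tri: "D + ereal c \<le> \<bar>t - s'\<bar> + L" if "D + ereal c' \<le> L" "c \<le> c' + \<bar>u - s\<bar>" for D c c'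
      using that 4 s by (cases D; cases L) auto
    have len: "len \<Gamma> e - ereal v = ereal (l - v)" if "len \<Gamma> e = ereal l" for v l
      using that by simp
    have "edge_point \<Gamma> e' t = Inner e u"
      using 4 s edge_point_Inner by simp
    from segment.hyps(5)[OF this] show ?thesis
    proof (elim disjE conjE exE)
      assume "curve_dist \<Gamma> (Vertex (tail (skeleton \<Gamma>) e)) y + ereal u \<le> L"
      then show ?thesis using tri[of _ u s] by auto
    next
      assume *: "len \<Gamma> e \<noteq> \<infinity>"
        "curve_dist \<Gamma> (Vertex (head (skeleton \<Gamma>) e)) y + (len \<Gamma> e - ereal u) \<le> L"
      then obtain l where l: "len \<Gamma> e = ereal l" using s by (cases "len \<Gamma> e") auto
      then show ?thesis using * tri[of _ "l - u" "l - s"] by (auto simp: len)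
    next
      fix v assume v: "y = Inner e v" "ereal \<bar>u - v\<bar> \<le> L"
      then have "ereal \<bar>s - v\<bar> \<le> \<bar>t - s'\<bar> + L"
        using tri[of 0 "\<bar>u - v\<bar>" "\<bar>s - v\<bar>"] by simp
      then show ?thesis using v by blast
    qed
  qed
qed

section \<open>Small spheres\<close>

lemma finite_marked_parameters: "finite (marked_parameters \<Gamma> x e)"
proof -
  have "marked_parameters \<Gamma> x e \<subseteq> {0, len \<Gamma> e} \<union> (case x of Inner _ t \<Rightarrow> {ereal t} | Vertex _ \<Rightarrow> {})"
    by (cases x) (auto simp: marked_parameters_def dest: edge_point_eq_Vertex edge_point_eq_Inner)
  then show ?thesis by (rule finite_subset) (auto split: point.split)
qed

lemma parameter_gap_exists: obtains \<delta> where "parameter_gap \<Gamma> x \<delta>"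
proof -
  define S where "S = (\<Union>e\<in>arcs (skeleton \<Gamma>). (\<lambda>(a, b). \<bar>a - b\<bar>) `
    {(a, b) \<in> marked_parameters \<Gamma> x e \<times> marked_parameters \<Gamma> x e. a \<noteq> b})"
  have "finite S"
    unfolding S_def
    by (intro finite_UN_I finite_imageI finite_subset[OF _ finite_cartesian_product[OF finite_marked_parameters finite_marked_parameters]])
      auto
  moreover have "0 < z" if z: "z \<in> S" for z
  proof -
    obtain a b where "z = \<bar>a - b\<bar>" "a \<noteq> b" using z by (auto simp: S_def)
    then show ?thesis by (cases a; cases b) auto
  qed
  ultimately obtain \<delta> :: real where "0 < \<delta>" "\<forall>z\<in>S. ereal \<delta> \<le> z"
    using finite_positive_lower_bound[of S] by blast
  moreover have "\<bar>a - b\<bar> \<in> S"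
    if "e \<in> arcs (skeleton \<Gamma>)" "a \<in> marked_parameters \<Gamma> x e" "b \<in> marked_parameters \<Gamma> x e" "a \<noteq> b"
    for e a b
    unfolding S_def by (rule UN_I[OF that(1)], rule image_eqI[of _ _ "(a, b)"]) (use that in auto)
  ultimately have "parameter_gap \<Gamma> x \<delta>"
    unfolding parameter_gap_def by blast
  then show ?thesis by (rule that)
qed

lemma parameter_gapD:
  assumes "parameter_gap \<Gamma> x \<delta>" "e \<in> arcs (skeleton \<Gamma>)" "a \<in> marked_parameters \<Gamma> x e"
    "b \<in> marked_parameters \<Gamma> x e" "\<bar>a - b\<bar> < ereal \<delta>"
  shows "a = b"
  using assms unfolding parameter_gap_def by (meson not_le)

lemma parameter_gap_le:
  assumes "parameter_gap \<Gamma> x \<delta>" "e \<in> arcs (skeleton \<Gamma>)" "a \<in> marked_parameters \<Gamma> x e"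
    "b \<in> marked_parameters \<Gamma> x e" "a \<noteq> b"
  shows "ereal \<delta> \<le> \<bar>a - b\<bar>"
  using assms unfolding parameter_gap_def by blast

lemma marked_parameters_ends: "0 \<in> marked_parameters \<Gamma> x e" "len \<Gamma> e \<in> marked_parameters \<Gamma> x e"
  by (auto simp: marked_parameters_def)

lemma marked_parametersI:
  "edge_point \<Gamma> e t = x \<Longrightarrow> t \<in> {0..len \<Gamma> e} \<Longrightarrow> t \<in> marked_parameters \<Gamma> x e"
  "edge_point \<Gamma> e t = Vertex v \<Longrightarrow> t \<in> marked_parameters \<Gamma> x e"
  by (auto simp: marked_parameters_def dest: edge_point_eq_Vertex)

text \<open>
  Read backwards from \<open>x\<close>, a path can change edges only at a vertex, and a vertex other than \<open>x\<close> is
  at least \<open>\<delta>\<close> away from \<open>x\<close> along the edge.  A short path therefore moves within the star at \<open>x\<close>.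
\<close>

lemma short_path_stays_on_edge:
  assumes "path_of_length \<Gamma> p x L" "L < ereal \<delta>" and gap: "parameter_gap \<Gamma> x \<delta>"
    and x: "x \<in> finite_points \<Gamma>"
    and "e \<in> arcs (skeleton \<Gamma>)" "t \<in> {0..len \<Gamma> e}" "p = edge_point \<Gamma> e t"
  shows "\<exists>t0\<in>{0..len \<Gamma> e}. edge_point \<Gamma> e t0 = x \<and> \<bar>t - t0\<bar> \<le> L"
  using assms
proof (induction p x L arbitrary: e t rule: path_of_length.induct)
  case (trivial x)
  then have "\<bar>t - t\<bar> = 0"
    using finite_edge_parameter[of e t] by (cases t) auto
  then show ?case using trivial by auto
next
  case (segment e' s t' y L e1 s1)
  have L: "0 \<le> L" using path_of_length_nonneg segment.hyps(4) .
  have short: "\<bar>t' - s\<bar> + L < ereal \<delta>" by (rule segment.prems(1))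
  have "0 \<le> \<bar>t' - s\<bar>" by (cases "t' - s") auto
  then have "L \<le> \<bar>t' - s\<bar> + L" using add_mono[of 0 "\<bar>t' - s\<bar>" L L] by simp
  then have "L < ereal \<delta>" using short by (rule le_less_trans)
  then obtain t0 where t0: "t0 \<in> {0..len \<Gamma> e'}" "edge_point \<Gamma> e' t0 = y" "\<bar>t' - t0\<bar> \<le> L"
    using segment.IH[of e' t'] segment.prems(2,3) segment.hyps(1-3) by blast
  have "\<bar>t0\<bar> \<noteq> \<infinity>"
    using finite_edge_parameter[of e' t0] t0 segment.prems(3) segment.hyps(1) by simp
  then have st0: "\<bar>s - t0\<bar> \<le> \<bar>t' - s\<bar> + L"
    using t0(3) short by (cases t0; cases s; cases t'; cases L) auto
  show ?case
  proof (cases "edge_point \<Gamma> e' s")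
    case (Inner a b)
    then have "e1 = e'" "s1 = s"
      using edge_point_eq_Inner[of e' s a b] edge_point_eq_Inner[of e1 s1 a b] segment.prems segment.hyps(2)
      by auto
    then show ?thesis using t0 st0 by blast
  next
    case (Vertex v)
    have "s = t0"
    proof (rule parameter_gapD[OF segment.prems(2) segment.hyps(1)])
      show "s \<in> marked_parameters \<Gamma> y e'" using Vertex by (rule marked_parametersI)
      show "t0 \<in> marked_parameters \<Gamma> y e'" using t0 by (intro marked_parametersI) auto
      show "\<bar>s - t0\<bar> < ereal \<delta>" using st0 short by simp
    qed
    then have y: "edge_point \<Gamma> e1 s1 = y" using t0 segment.prems by simp
    then have "\<bar>s1\<bar> \<noteq> \<infinity>"
      using finite_edge_parameter[of e1 s1] segment.prems by auto
    then have "\<bar>s1 - s1\<bar> \<le> \<bar>t' - s\<bar> + L"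
      using L by (cases s1) auto
    then show ?thesis using y segment.prems(5) by blast
  qed
qed

lemma directionsE:
  assumes "(e, t, b) \<in> directions \<Gamma> x" "x \<in> finite_points \<Gamma>"
  obtains u where "t = ereal u" "e \<in> arcs (skeleton \<Gamma>)" "t \<in> {0..len \<Gamma> e}" "edge_point \<Gamma> e t = x"
    "b \<Longrightarrow> t < len \<Gamma> e" "\<not> b \<Longrightarrow> 0 < t"
proof -
  have *: "e \<in> arcs (skeleton \<Gamma>)" "t \<in> {0..len \<Gamma> e}" "edge_point \<Gamma> e t = x"
    "b \<Longrightarrow> t < len \<Gamma> e" "\<not> b \<Longrightarrow> 0 < t"
    using assms by (auto simp: directions_def)
  moreover have "\<bar>t\<bar> \<noteq> \<infinity>" using finite_edge_parameter[OF *(1,2)] *(3) assms(2) by simp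
  ultimately show ?thesis using that by (cases t) auto
qed

lemma ray_point_Inner:
  assumes gap: "parameter_gap \<Gamma> x \<delta>" and x: "x \<in> finite_points \<Gamma>" and s: "0 < s" "s < \<delta>"
    and d: "(e, ereal u, b) \<in> directions \<Gamma> x"
  defines "w \<equiv> (if b then u + s else u - s)"
  shows "ray_point \<Gamma> (e, ereal u, b) s = Inner e w" "0 < w" "ereal w < len \<Gamma> e"
proof -
  have d': "e \<in> arcs (skeleton \<Gamma>)" "ereal u \<in> {0..len \<Gamma> e}" "edge_point \<Gamma> e (ereal u) = x"
    "b \<Longrightarrow> ereal u < len \<Gamma> e" "\<not> b \<Longrightarrow> 0 < u"
    using directionsE[OF d x] by auto
  have u: "ereal u \<in> marked_parameters \<Gamma> x e" using d' by (auto intro: marked_parametersI)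
  have "0 < w \<and> ereal w < len \<Gamma> e"
  proof (cases b)
    case True
    have "ereal \<delta> \<le> \<bar>len \<Gamma> e - ereal u\<bar>"
      by (rule parameter_gap_le[OF gap d'(1) marked_parameters_ends(2) u]) (use d'(4)[OF True] in auto)
    then show ?thesis
      using d'(2,4) s True by (cases "len \<Gamma> e") (auto simp: w_def)
  next
    case False
    have "ereal \<delta> \<le> \<bar>ereal u - 0\<bar>"
      by (rule parameter_gap_le[OF gap d'(1) u marked_parameters_ends(1)]) (use d'(5)[OF False] in auto)
    then show ?thesis
      using d'(2,5) s False by (cases "len \<Gamma> e") (auto simp: w_def)
  qed
  then show "0 < w" "ereal w < len \<Gamma> e" by auto
  then show "ray_point \<Gamma> (e, ereal u, b) s = Inner e w"
    using edge_point_Inner[of w e] by (auto simp: ray_point_def w_def)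
qed

lemma curve_dist_ray_point:
  assumes gap: "parameter_gap \<Gamma> x \<delta>" and x: "x \<in> finite_points \<Gamma>" and s: "0 < s" "s < \<delta> / 2"
    and d: "d \<in> directions \<Gamma> x"
  shows "curve_dist \<Gamma> (ray_point \<Gamma> d s) x = ereal s"
proof -
  obtain e t b where d_eq: "d = (e, t, b)" by (cases d)
  obtain u where u: "t = ereal u" "e \<in> arcs (skeleton \<Gamma>)" "t \<in> {0..len \<Gamma> e}" "edge_point \<Gamma> e t = x"
    using directionsE[of e t b x] d d_eq x by metis
  define w where "w = (if b then u + s else u - s)"
  have w: "ray_point \<Gamma> d s = Inner e w" "0 < w" "ereal w < len \<Gamma> e"
    using ray_point_Inner[OF gap x, of s e u b] s d d_eq u(1) by (auto simp: w_def)
  have ws: "\<bar>w - u\<bar> = s" using s(1) by (simp add: w_def)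
  have wE: "Inner e w = edge_point \<Gamma> e (ereal w)" using w edge_point_Inner by simp
  show ?thesis
  proof (rule antisym)
    have "curve_dist \<Gamma> (edge_point \<Gamma> e (ereal w)) x \<le> \<bar>t - ereal w\<bar> + curve_dist \<Gamma> (edge_point \<Gamma> e t) x"
      by (rule curve_dist_segment) (use u w in auto)
    also have "\<dots> = ereal s"
      using x ws u(1,4) by (simp add: curve_dist_self finite_points_def abs_minus_commute)
    finally show "curve_dist \<Gamma> (ray_point \<Gamma> d s) x \<le> ereal s" by (simp add: w wE)
  next
    show "ereal s \<le> curve_dist \<Gamma> (ray_point \<Gamma> d s) x"
      unfolding curve_dist_def
    proof (rule Inf_greatest, rule ccontr)
      fix L assume "L \<in> {L. path_of_length \<Gamma> (ray_point \<Gamma> d s) x L}" and less: "\<not> ereal s \<le> L"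
      then have path: "path_of_length \<Gamma> (edge_point \<Gamma> e (ereal w)) x L" by (simp add: w wE)
      have "ereal s < ereal \<delta>" using s by simp
      then have "L < ereal \<delta>" using less by (meson not_le less_trans)
      then obtain t0 where t0: "t0 \<in> {0..len \<Gamma> e}" "edge_point \<Gamma> e t0 = x" "\<bar>ereal w - t0\<bar> \<le> L"
        using short_path_stays_on_edge[OF path _ gap x u(2) _ refl] w by (auto simp: less_imp_le)
      have wt0: "\<bar>ereal w - t0\<bar> < ereal s" using t0(3) less by (meson not_le le_less_trans)
      have "t = t0"
      proof (rule parameter_gapD[OF gap u(2)])
        show "t \<in> marked_parameters \<Gamma> x e" "t0 \<in> marked_parameters \<Gamma> x e"
          using u t0 by (auto intro: marked_parametersI)
        show "\<bar>t - t0\<bar> < ereal \<delta>"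
          using wt0 ws s u(1) by (cases t0) auto
      qed
      then have "t0 = ereal u" using u(1) by simp
      then show False using wt0 ws by auto
    qed
  qed
qed

lemma ray_point_inj:
  assumes gap: "parameter_gap \<Gamma> x \<delta>" and x: "x \<in> finite_points \<Gamma>" and s: "0 < s" "s < \<delta> / 2"
  shows "inj_on (\<lambda>d. ray_point \<Gamma> d s) (directions \<Gamma> x)"
proof (rule inj_onI)
  fix d d' assume d: "d \<in> directions \<Gamma> x" and d': "d' \<in> directions \<Gamma> x"
    and eq: "ray_point \<Gamma> d s = ray_point \<Gamma> d' s"
  obtain e t b where d_eq: "d = (e, t, b)" by (cases d)
  obtain e' t' b' where d'_eq: "d' = (e', t', b')" by (cases d')
  obtain u where u: "t = ereal u" "e \<in> arcs (skeleton \<Gamma>)" "t \<in> {0..len \<Gamma> e}" "edge_point \<Gamma> e t = x"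
    using directionsE[of e t b x] d d_eq x by metis
  obtain u' where u': "t' = ereal u'" "e' \<in> arcs (skeleton \<Gamma>)" "t' \<in> {0..len \<Gamma> e'}" "edge_point \<Gamma> e' t' = x"
    using directionsE[of e' t' b' x] d' d'_eq x by metis
  have s': "s < \<delta>" using s by simp
  have "Inner e (if b then u + s else u - s) = (Inner e' (if b' then u' + s else u' - s) :: ('v, 'e) point)"
    using ray_point_Inner(1)[OF gap x s(1) s', of e u b] ray_point_Inner(1)[OF gap x s(1) s', of e' u' b']
      eq d d' d_eq d'_eq u(1) u'(1) by simp
  then have *: "e = e'" "(if b then u + s else u - s) = (if b' then u' + s else u' - s)" by auto
  have "\<bar>u - u'\<bar> < \<delta>" using *(2) s by (auto split: if_splits)
  moreover have "t \<in> marked_parameters \<Gamma> x e" "t' \<in> marked_parameters \<Gamma> x e"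
    using u u' *(1) by (auto simp: marked_parameters_def)
  ultimately have "t = t'"
    using parameter_gapD[OF gap u(2), of t t'] u(1) u'(1) by simp
  then show "d = d'"
    using * d_eq d'_eq u(1) u'(1) s(1) by (auto split: if_splits)
qed

lemma small_distance_ray_point:
  assumes gap: "parameter_gap \<Gamma> x \<delta>" and x: "x \<in> finite_points \<Gamma>"
    and y: "y \<noteq> x" "curve_dist \<Gamma> y x < ereal (\<delta> / 2)"
  obtains d s where "d \<in> directions \<Gamma> x" "0 < s" "s < \<delta> / 2" "y = ray_point \<Gamma> d s"
proof -
  obtain L where path: "path_of_length \<Gamma> y x L" and L: "L < ereal (\<delta> / 2)"
    using y(2) unfolding curve_dist_def by (auto simp: Inf_less_iff)
  have "0 < \<delta>" using gap by (simp add: parameter_gap_def)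
  then have "ereal (\<delta> / 2) < ereal \<delta>" by simp
  with L have L': "L < ereal \<delta>" by (rule less_trans)
  obtain e t where e: "e \<in> arcs (skeleton \<Gamma>)" "t \<in> {0..len \<Gamma> e}" "y = edge_point \<Gamma> e t"
    using path y(1) by cases auto
  obtain t0 where t0: "t0 \<in> {0..len \<Gamma> e}" "edge_point \<Gamma> e t0 = x" "\<bar>t - t0\<bar> \<le> L"
    using short_path_stays_on_edge[OF path L' gap x e] by blast
  have "\<bar>t0\<bar> \<noteq> \<infinity>" using finite_edge_parameter[OF e(1) t0(1)] t0(2) x by simp
  then obtain u where u: "t0 = ereal u" by (cases t0) auto
  then obtain w where w: "t = ereal w" using t0(3) L by (cases t) auto
  have "ereal \<bar>w - u\<bar> \<le> L" using t0(3) by (simp add: w u)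
  then have "ereal \<bar>w - u\<bar> < ereal (\<delta> / 2)" using L by (rule le_less_trans)
  then have wu: "\<bar>w - u\<bar> < \<delta> / 2" by simp
  have "w \<noteq> u" using y(1) e(3) t0(2) u w by auto
  define d where "d = (e, t0, u < w)"
  have "d \<in> directions \<Gamma> x"
  proof (cases "u < w")
    case True
    have "t0 < t" using True by (simp add: u w)
    also have "t \<le> len \<Gamma> e" using e by simp
    finally have "t0 < len \<Gamma> e" .
    then show ?thesis using e(1) t0 True by (simp add: d_def directions_def)
  next
    case False
    then have "w < u" using \<open>w \<noteq> u\<close> by simp
    then have "0 < t0" using e(2) by (simp add: u w)
    then show ?thesis using e(1) t0 False by (simp add: d_def directions_def)
  qed
  moreover have "y = ray_point \<Gamma> d \<bar>w - u\<bar>"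
    using e(3) w u \<open>w \<noteq> u\<close> by (auto simp: d_def ray_point_def)
  ultimately show ?thesis
    using wu \<open>w \<noteq> u\<close> by (intro that[of d "\<bar>w - u\<bar>"]) simp_all
qed

text \<open>
  Small spheres around a finite point are in bijection with the directions at it.  They are defined by
  the distance alone, so unlike the directions they do not depend on the model of the curve and can be
  transported along an expansive map.
\<close>

lemma ray_point_sphere:
  assumes gap: "parameter_gap \<Gamma> x \<delta>" and x: "x \<in> finite_points \<Gamma>" and s: "0 < s" "s < \<delta> / 2"
  shows "bij_betw (\<lambda>d. ray_point \<Gamma> d s) (directions \<Gamma> x)
    {y \<in> finite_points \<Gamma>. curve_dist \<Gamma> y x = ereal s}"
proof (rule bij_betw_imageI[OF ray_point_inj[OF assms]])
  show "(\<lambda>d. ray_point \<Gamma> d s) ` directions \<Gamma> x = {y \<in> finite_points \<Gamma>. curve_dist \<Gamma> y x = ereal s}"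
  proof (intro equalityI subsetI)
    fix y assume "y \<in> (\<lambda>d. ray_point \<Gamma> d s) ` directions \<Gamma> x"
    then obtain d where d: "d \<in> directions \<Gamma> x" "y = ray_point \<Gamma> d s" by blast
    obtain e t b where d_eq: "d = (e, t, b)" by (cases d)
    obtain u where u: "t = ereal u" "e \<in> arcs (skeleton \<Gamma>)"
      using directionsE[of e t b x] d d_eq x by metis
    have "s < \<delta>" using s by simp
    then have "y \<in> finite_points \<Gamma>"
      using ray_point_Inner[OF gap x s(1), of e u b] d d_eq u by (simp add: Inner_finite_points)
    then show "y \<in> {y \<in> finite_points \<Gamma>. curve_dist \<Gamma> y x = ereal s}"
      using curve_dist_ray_point[OF gap x s d(1)] d(2) by simp
  next
    fix y assume y: "y \<in> {y \<in> finite_points \<Gamma>. curve_dist \<Gamma> y x = ereal s}"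
    then have "y \<noteq> x" using curve_dist_self[of x] s(1) x by (auto simp: finite_points_def)
    moreover have "curve_dist \<Gamma> y x < ereal (\<delta> / 2)" using y s by simp
    ultimately obtain d s' where d: "d \<in> directions \<Gamma> x" "0 < s'" "s' < \<delta> / 2" "y = ray_point \<Gamma> d s'"
      using small_distance_ray_point[OF gap x] by blast
    then have "s' = s" using curve_dist_ray_point[OF gap x d(2,3,1)] y by simp
    then show "y \<in> (\<lambda>d. ray_point \<Gamma> d s) ` directions \<Gamma> x" using d by blast
  qed
qed

lemma finite_directions: assumes x: "x \<in> finite_points \<Gamma>" shows "finite (directions \<Gamma> x)"
proof (rule finite_subset)
  show "directions \<Gamma> x \<subseteq> (\<Union>e\<in>arcs (skeleton \<Gamma>). {e} \<times> marked_parameters \<Gamma> x e \<times> UNIV)"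
    by (auto simp: directions_def marked_parameters_def)
  show "finite (\<Union>e\<in>arcs (skeleton \<Gamma>). {e} \<times> marked_parameters \<Gamma> x e \<times> (UNIV :: bool set))"
    by (intro finite_UN_I finite_cartesian_product finite_marked_parameters) auto
qed

section \<open>Points at infinity\<close>

text \<open>
  The coordinate along \<open>e\<close>, extended by \<open>0\<close> to the rest of the curve, changes along a segment by at
  most the length of the segment, even if the segment reaches a point at infinity, where that length is
  infinite.  So no detour is shorter than the segment of \<open>e\<close> itself.
\<close>

lemma curve_dist_infinite_edge:
  assumes e: "e \<in> arcs (skeleton \<Gamma>)" "len \<Gamma> e = \<infinity>" and ab: "0 < a" "0 < b"
  shows "curve_dist \<Gamma> (Inner e a) (Inner e b) = ereal \<bar>a - b\<bar>"
proof (rule antisym)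
  have "curve_dist \<Gamma> (edge_point \<Gamma> e (ereal a)) (Inner e b)
      \<le> \<bar>ereal b - ereal a\<bar> + curve_dist \<Gamma> (edge_point \<Gamma> e (ereal b)) (Inner e b)"
    by (rule curve_dist_segment) (use e ab in auto)
  then show "curve_dist \<Gamma> (Inner e a) (Inner e b) \<le> ereal \<bar>a - b\<bar>"
    using curve_dist_self[of "Inner e b"] e ab
    by (simp add: edge_point_Inner points_def abs_minus_commute)
next
  define g where "g p = (case p of Inner e' t \<Rightarrow> if e' = e then t else 0 | Vertex v \<Rightarrow> 0)"
    for p :: "('v, 'e) point"
  have lip: "ereal \<bar>g (edge_point \<Gamma> e' s) - g (edge_point \<Gamma> e' t)\<bar> \<le> \<bar>t - s\<bar>"
    if "s \<in> {0..len \<Gamma> e'}" "t \<in> {0..len \<Gamma> e'}" for e' s t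
  proof (cases "\<bar>t - s\<bar> = \<infinity>")
    case False
    then obtain s' t' where st: "s = ereal s'" "t = ereal t'"
      using that by (cases s; cases t) auto
    then show ?thesis using that e(2)
      by (cases "e' = e") (auto simp: g_def edge_point_def)
  qed simp
  have bound: "ereal \<bar>g p - b\<bar> \<le> L" if "path_of_length \<Gamma> p y L" "y = Inner e b" for p y L
    using that
  proof (induction rule: path_of_length.induct)
    case (trivial x)
    then show ?case by (simp add: g_def)
  next
    case (segment e' s t y L)
    then have "ereal \<bar>g (edge_point \<Gamma> e' s) - g (edge_point \<Gamma> e' t)\<bar> +
        ereal \<bar>g (edge_point \<Gamma> e' t) - b\<bar> \<le> \<bar>t - s\<bar> + L"
      by (intro add_mono lip) auto
    moreover have "ereal \<bar>u - b\<bar> \<le> ereal \<bar>u - v\<bar> + ereal \<bar>v - b\<bar>" for u v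
      by simp
    ultimately show ?case by (rule order_trans[rotated])
  qed
  show "ereal \<bar>a - b\<bar> \<le> curve_dist \<Gamma> (Inner e a) (Inner e b)"
    unfolding curve_dist_def
  proof (rule Inf_greatest)
    fix L assume "L \<in> {L. path_of_length \<Gamma> (Inner e a) (Inner e b) L}"
    then have "path_of_length \<Gamma> (Inner e a) (Inner e b) L" by simp
    then have "ereal \<bar>g (Inner e a) - b\<bar> \<le> L" using bound by blast
    then show "ereal \<bar>a - b\<bar> \<le> L" by (simp add: g_def)
  qed
qed

lemma curve_dist_from_infinity:
  assumes e: "e \<in> arcs (skeleton \<Gamma>)" "len \<Gamma> e = \<infinity>" and x: "x \<in> finite_points \<Gamma>"
  shows "curve_dist \<Gamma> (edge_point \<Gamma> e \<infinity>) x = \<infinity>"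
proof -
  have "L = \<infinity>" if "path_of_length \<Gamma> (edge_point \<Gamma> e \<infinity>) x L" for L
    using that
  proof cases
    case trivial
    then show ?thesis using x e by (auto simp: finite_points_def infinite_points_def)
  next
    case (segment e' s t L')
    have s: "s = \<infinity>"
    proof (rule ccontr)
      assume "s \<noteq> \<infinity>"
      then have "edge_point \<Gamma> e' s \<in> finite_points \<Gamma>"
        using segment by (cases s) (auto intro!: finite_points_edge_point simp: finite_parameters_def)
      then show False
        using segment e by (auto simp: finite_points_def infinite_points_def)
    qed
    then have "\<bar>t - s\<bar> = \<infinity>" by (cases t) auto
    then show ?thesis using segment path_of_length_nonneg[OF segment(6)] by simp
  qed
  then have "\<infinity> \<le> curve_dist \<Gamma> (edge_point \<Gamma> e \<infinity>) x"
    unfolding curve_dist_def by (intro Inf_greatest) (metis mem_Collect_eq order_refl)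
  then show ?thesis by simp
qed

section \<open>Chip-firing moves at a point\<close>

text \<open>
  Inside an edge the function is the maximum of the constant \<open>- \<epsilon>\<close> and of affine functions that come
  from the ways to reach \<open>x\<close>: through the tail (\<open>- h - s\<close>), through the head (\<open>U\<close>), or directly along
  the edge (\<open>V\<close>).  Here \<open>h\<close> is the distance to \<open>x\<close> cut off at \<open>\<epsilon>\<close>, which is real at every point.
\<close>

lemma CF_point_unit:
  assumes x: "x \<in> finite_points \<Gamma>" and "0 < \<epsilon>"
  shows "CF \<Gamma> {x} (ereal \<epsilon>) \<in> rational_units \<Gamma>"
proof -
  define h where "h y = real_of_ereal (min (ereal \<epsilon>) (curve_dist \<Gamma> y x))" for y
  have h: "min (ereal \<epsilon>) (curve_dist \<Gamma> y x) = ereal (h y)" for y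
    using curve_dist_nonneg[of y x] \<open>0 < \<epsilon>\<close>
    by (cases "curve_dist \<Gamma> y x") (auto simp: h_def min_def)
  have CF_eq: "CF \<Gamma> {x} (ereal \<epsilon>) y = ereal (- h y)" if "y \<in> points \<Gamma>" for y
    using that h[of y] by (simp add: CF_def curve_setdist_def)
  have h_le: "h y \<le> \<epsilon>" for y using h[of y] by (metis ereal_less_eq(3) min.cobounded1)
  have h_dist: "ereal (h y) \<le> curve_dist \<Gamma> y x" for y using h[of y] by (metis min.cobounded2)
  have h_nonneg: "0 \<le> h y" for y
    using curve_dist_nonneg[of y x] \<open>0 < \<epsilon>\<close> unfolding h_def by (intro real_of_ereal_pos) simp
  have h_step: "h p \<le> c + h q"
    if "curve_dist \<Gamma> p x \<le> ereal c + curve_dist \<Gamma> q x" "0 \<le> c" for p q c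
  proof -
    have "min (ereal \<epsilon>) (curve_dist \<Gamma> p x) \<le> ereal c + min (ereal \<epsilon>) (curve_dist \<Gamma> q x)"
      using that \<open>0 < \<epsilon>\<close> by (cases "curve_dist \<Gamma> q x"; cases "curve_dist \<Gamma> p x")
        (auto simp: min_def)
    then show ?thesis by (simp add: h)
  qed
  have hx: "h x = 0"
    using curve_dist_self[of x] x \<open>0 < \<epsilon>\<close> by (simp add: finite_points_def h_def)
  define U where "U e s = (if len \<Gamma> e = \<infinity> then - \<epsilon>
    else s - (real_of_ereal (len \<Gamma> e) + h (Vertex (head (skeleton \<Gamma>) e))))" for e s
  define V where "V e s = (case x of Vertex v \<Rightarrow> - \<epsilon>
    | Inner e' t \<Rightarrow> if e' = e then - \<bar>s - t\<bar> else - \<epsilon>)" for e s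
  define F where "F e s = max (- \<epsilon>) (max (- h (Vertex (tail (skeleton \<Gamma>) e)) - s) (max (U e s) (V e s)))"
    for e s
  have formula: "- h (Inner e s) = F e s"
    if e: "e \<in> arcs (skeleton \<Gamma>)" and s: "0 < s" "ereal s < len \<Gamma> e" for e s
  proof (rule antisym)
    have p: "edge_point \<Gamma> e (ereal s) = Inner e s" using s by (rule edge_point_Inner)
    have step: "h (Inner e s) \<le> \<bar>t - s\<bar> + h (edge_point \<Gamma> e (ereal t))"
      if "ereal t \<in> {0..len \<Gamma> e}" for t
      using curve_dist_segment[OF e _ that, of "ereal s" x] s unfolding p
      by (intro h_step) (auto simp: less_imp_le)
    have "U e s \<le> - h (Inner e s)"
    proof (cases "len \<Gamma> e")
      case (real l)
      then show ?thesis
        using step[of l] s by (simp add: U_def edge_point_def)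
    qed (use h_le[of "Inner e s"] len_pos[OF e] in \<open>auto simp: U_def\<close>)
    moreover have "V e s \<le> - h (Inner e s)"
    proof (cases "\<exists>t. x = Inner e t")
      case True
      then obtain t where t: "x = Inner e t" by blast
      then show ?thesis
        using step[of t] x hx by (simp add: V_def Inner_finite_points less_imp_le edge_point_Inner abs_minus_commute)
    next
      case False
      then have "V e s = - \<epsilon>" by (auto simp: V_def split: point.split)
      then show ?thesis using h_le[of "Inner e s"] by simp
    qed
    moreover have "- h (Vertex (tail (skeleton \<Gamma>) e)) - s \<le> - h (Inner e s)"
      using step[of 0] s less_imp_le[OF len_pos[OF e]]
      by (simp add: edge_point_def zero_ereal_def[symmetric])
    ultimately show "F e s \<le> - h (Inner e s)"
      using h_le[of "Inner e s"] by (simp add: F_def)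
    have "ereal (- F e s) \<le> L" if L: "path_of_length \<Gamma> (Inner e s) x L" for L
      using path_from_Inner_lower_bound[OF L]
    proof (elim disjE conjE exE)
      assume "curve_dist \<Gamma> (Vertex (tail (skeleton \<Gamma>) e)) x + ereal s \<le> L"
      with add_right_mono[OF h_dist, of "Vertex (tail (skeleton \<Gamma>) e)" "ereal s"]
      have "ereal (h (Vertex (tail (skeleton \<Gamma>) e)) + s) \<le> L" by auto
      moreover have "ereal (- F e s) \<le> ereal (h (Vertex (tail (skeleton \<Gamma>) e)) + s)"
        by (simp add: F_def)
      ultimately show ?thesis by (rule order_trans[rotated])
    next
      assume *: "len \<Gamma> e \<noteq> \<infinity>"
        "curve_dist \<Gamma> (Vertex (head (skeleton \<Gamma>) e)) x + (len \<Gamma> e - ereal s) \<le> L"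
      then obtain l where l: "len \<Gamma> e = ereal l" using s by (cases "len \<Gamma> e") auto
      have "ereal (h (Vertex (head (skeleton \<Gamma>) e)) + (l - s)) \<le> L"
        using add_right_mono[OF h_dist, of "Vertex (head (skeleton \<Gamma>) e)" "ereal (l - s)"] *(2)
        unfolding l by auto
      moreover have "- F e s \<le> - U e s" by (simp add: F_def)
      then have "ereal (- F e s) \<le> ereal (h (Vertex (head (skeleton \<Gamma>) e)) + (l - s))"
        by (simp add: U_def l)
      ultimately show ?thesis by (rule order_trans[rotated])
    next
      fix t assume t: "x = Inner e t" "ereal \<bar>s - t\<bar> \<le> L"
      have "- F e s \<le> - V e s" by (simp add: F_def)
      then have "ereal (- F e s) \<le> ereal \<bar>s - t\<bar>" using t by (simp add: V_def)
      then show ?thesis using t(2) by (rule order_trans)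
    qed
    then have "ereal (- F e s) \<le> curve_dist \<Gamma> (Inner e s) x"
      unfolding curve_dist_def by (intro Inf_greatest) simp
    moreover have "- F e s \<le> \<epsilon>" by (simp add: F_def)
    ultimately have "ereal (- F e s) \<le> ereal (h (Inner e s))"
      unfolding h[symmetric] by simp
    then show "- h (Inner e s) \<le> F e s" by simp
  qed
  show ?thesis
  proof (rule rational_unitsI)
    show "CF \<Gamma> {x} (ereal \<epsilon>) \<in> extensional (points \<Gamma>)" by (simp add: CF_def)
    show "CF \<Gamma> {x} (ereal \<epsilon>) y = ereal (- h y)" if "y \<in> finite_points \<Gamma>" for y
      using that by (simp add: CF_eq finite_points_def)
    show "pl_function \<Gamma> (\<lambda>y. - h y)"
      unfolding pl_function_def
    proof (intro ballI conjI)
      fix e assume e: "e \<in> arcs (skeleton \<Gamma>)"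
      have "pa_on (len \<Gamma> e) (U e)"
      proof (cases "len \<Gamma> e = \<infinity>")
        case False
        then show ?thesis
          by (intro pa_on_cong[OF pa_on_affine[of _ 1 "- (real_of_ereal (len \<Gamma> e) + h (Vertex (head (skeleton \<Gamma>) e)))"]])
            (simp add: U_def)
      qed (intro pa_on_cong[OF pa_on_const[of _ "- \<epsilon>"]], simp add: U_def)
      moreover have "pa_on (len \<Gamma> e) (V e)"
      proof (cases "\<exists>t. x = Inner e t")
        case True
        then obtain t where "x = Inner e t" by blast
        then show ?thesis by (intro pa_on_cong[OF pa_on_abs[of _ t]]) (simp add: V_def)
      next
        case False
        then show ?thesis
          by (intro pa_on_cong[OF pa_on_const[of _ "- \<epsilon>"]]) (auto simp: V_def split: point.split)
      qed
      moreover have "pa_on (len \<Gamma> e) (\<lambda>s. - h (Vertex (tail (skeleton \<Gamma>) e)) - s)"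
        by (rule pa_on_cong[OF pa_on_affine[of _ "- 1" "- h (Vertex (tail (skeleton \<Gamma>) e))"]]) simp
      ultimately have "pa_on (len \<Gamma> e) (F e)"
        unfolding F_def by (intro pa_on_max pa_on_const)
      then show "pa_on (len \<Gamma> e) (\<lambda>t. - h (edge_point \<Gamma> e (ereal t)))"
        by (rule pa_on_cong) (simp add: formula[OF e] edge_point_Inner)
      have "h (edge_point \<Gamma> e (ereal s)) \<le> \<bar>t - s\<bar> + h (edge_point \<Gamma> e (ereal t))"
        if "s \<in> finite_parameters \<Gamma> e" "t \<in> finite_parameters \<Gamma> e" for s t
        using curve_dist_segment[OF e, of "ereal s" "ereal t" x] that
        by (intro h_step) (auto simp: finite_parameters_def)
      then have "\<bar>- h (edge_point \<Gamma> e (ereal s)) - - h (edge_point \<Gamma> e (ereal t))\<bar> \<le> 1 * \<bar>s - t\<bar>"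
        if "s \<in> finite_parameters \<Gamma> e" "t \<in> finite_parameters \<Gamma> e" for s t
        using that by (smt (verit))
      then have "1-lipschitz_on (finite_parameters \<Gamma> e) (\<lambda>t. - h (edge_point \<Gamma> e (ereal t)))"
        by (intro lipschitz_onI) (auto simp: dist_real_def)
      then show "continuous_on (finite_parameters \<Gamma> e) (\<lambda>t. - h (edge_point \<Gamma> e (ereal t)))"
        by (rule lipschitz_on_continuous_on)
    qed
    fix e assume e: "e \<in> arcs (skeleton \<Gamma>)" "len \<Gamma> e = \<infinity>"
    have "edge_point \<Gamma> e \<infinity> \<in> points \<Gamma>" using e edge_point_in_points[of e \<infinity>] by simp
    then have "CF \<Gamma> {x} (ereal \<epsilon>) (edge_point \<Gamma> e \<infinity>) = ereal (- \<epsilon>)"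
      using curve_dist_from_infinity[OF e x] by (simp add: CF_def curve_setdist_def)
    moreover have "\<forall>\<^sub>F s in at_top. ereal (- h (edge_point \<Gamma> e (ereal s))) = ereal (- \<epsilon>)"
      using eventually_gt_at_top[of "\<epsilon> + (case x of Vertex v \<Rightarrow> 0 | Inner e' t \<Rightarrow> \<bar>t\<bar>)"]
    proof eventually_elim
      case (elim s)
      then have s: "\<epsilon> < s" by (cases x) auto
      have "V e s \<le> - \<epsilon>" using elim by (auto simp: V_def split: point.splits)
      moreover have "U e s = - \<epsilon>" using e by (simp add: U_def)
      ultimately have "F e s = - \<epsilon>"
        using s h_nonneg[of "Vertex (tail (skeleton \<Gamma>) e)"] by (auto simp: F_def)
      then show ?case
        using formula[OF e(1), of s] s e \<open>0 < \<epsilon>\<close> by (simp add: edge_point_Inner)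
    qed
    ultimately show "((\<lambda>s. ereal (- h (edge_point \<Gamma> e (ereal s)))) \<longlongrightarrow>
        CF \<Gamma> {x} (ereal \<epsilon>) (edge_point \<Gamma> e \<infinity>)) at_top"
      by (simp add: tendsto_eventually)
  qed
qed

end

section \<open>Slopes\<close>

lemma eventually_affine_unique:
  fixes m c m' c' :: real
  assumes "F \<noteq> bot" "\<And>k. \<forall>\<^sub>F s in F. s \<noteq> k" "\<forall>\<^sub>F s in F. m * s + c = m' * s + c'"
  shows "m = m'"
proof (rule ccontr)
  assume "m \<noteq> m'"
  have "\<forall>\<^sub>F s in F. False"
    using assms(3) assms(2)[of "(c' - c) / (m - m')"]
    by eventually_elim (use \<open>m \<noteq> m'\<close> in \<open>auto simp: field_simps\<close>)
  then show False using assms(1) by (simp add: eventually_False)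
qed

lemma slope_along_eqI:
  assumes "F \<noteq> bot" "\<And>k. \<forall>\<^sub>F s in F. s \<noteq> k"
    and f: "\<forall>\<^sub>F s in F. f (edge_point \<Gamma> e (ereal s)) = ereal (of_int m * s + c)"
  shows "slope_along \<Gamma> f e (filtermap ereal F) = m"
  unfolding slope_along_def eventually_filtermap
proof (rule the_equality)
  show "\<exists>c. \<forall>\<^sub>F s in F. f (edge_point \<Gamma> e (ereal s)) = ereal (of_int m * real_of_ereal (ereal s) + c)"
    using f by auto
  fix m' assume "\<exists>c. \<forall>\<^sub>F s in F. f (edge_point \<Gamma> e (ereal s)) = ereal (of_int m' * real_of_ereal (ereal s) + c)"
  then obtain c' where "\<forall>\<^sub>F s in F. f (edge_point \<Gamma> e (ereal s)) = ereal (of_int m' * s + c')" by auto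
  with f have "\<forall>\<^sub>F s in F. of_int m' * s + c' = of_int m * s + c"
    by eventually_elim simp
  then have "(of_int m' :: real) = of_int m"
    by (rule eventually_affine_unique[OF assms(1,2)])
  then show "m' = m" by simp
qed

lemma eventually_at_left_iff_at_right_0:
  fixes a :: real
  shows "eventually P (at_left a) \<longleftrightarrow> (\<forall>\<^sub>F s in at_right 0. P (a - s))"
proof -
  have "eventually P (at_left a) \<longleftrightarrow> (\<forall>\<^sub>F s in at_right (- a). P (- s))"
    by (simp add: at_left_minus eventually_filtermap)
  also have "\<dots> \<longleftrightarrow> (\<forall>\<^sub>F s in at_right 0. P (a - s))"
    by (simp add: eventually_at_right_to_0[of _ "- a"])
  finally show ?thesis .
qed

context tropical_curve
begin

text \<open>
  The slope is defined through some affine germ on the open side of the parameter; continuity at the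
  parameter identifies the constant term of the germ with the value at \<open>x\<close>.
\<close>

lemma outgoing_slope_ray_point:
  assumes f: "f \<in> rational_units \<Gamma>" and x: "x \<in> finite_points \<Gamma>" and d: "d \<in> directions \<Gamma> x"
  shows "\<forall>\<^sub>F s in at_right 0. real_of_ereal (f (ray_point \<Gamma> d s))
    = real_of_ereal (f x) + s * of_int (outgoing_slope \<Gamma> f d)"
proof -
  obtain e t b where d_eq: "d = (e, t, b)" by (cases d)
  obtain u where u: "t = ereal u" "e \<in> arcs (skeleton \<Gamma>)" "t \<in> {0..len \<Gamma> e}" "edge_point \<Gamma> e t = x"
    "b \<Longrightarrow> t < len \<Gamma> e" "\<not> b \<Longrightarrow> 0 < t"
    using directionsE[of e t b x] d d_eq x by metis
  define F where "F s = real_of_ereal (f (edge_point \<Gamma> e (ereal s)))" for s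
  have pa: "pa_on (len \<Gamma> e) F" and cont: "continuous_on (finite_parameters \<Gamma> e) F"
    using rational_units_pl[OF f] u(2) by (auto simp: pl_function_def F_def[abs_def])
  have fF: "f (edge_point \<Gamma> e (ereal s)) = ereal (F s)" if "s \<in> finite_parameters \<Gamma> e" for s
    using rational_units_finite[OF f finite_points_edge_point[OF u(2) that]] by (simp add: F_def)
  have Fu: "F u = real_of_ereal (f x)" using u by (simp add: F_def)
  show ?thesis
  proof (cases b)
    case True
    obtain l where l: "ereal u < ereal l" "ereal l < len \<Gamma> e"
      using u(1) u(5)[OF True] ereal_dense2 by blast
    then have dom: "{u..l} \<subseteq> finite_parameters \<Gamma> e"
      using u(1,3) by (auto simp: finite_parameters_def intro: order_trans[of _ "ereal l"] less_imp_le)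
    obtain m c where mc: "\<forall>\<^sub>F s in at_right u. F s = of_int m * s + c"
      using pa_on_germ_right[OF pa, of u] u True by auto
    have "(F \<longlongrightarrow> F u) (at_right u)"
      using continuous_on_Icc_at_rightD[OF continuous_on_subset[OF cont dom]] l by simp
    moreover have "(F \<longlongrightarrow> of_int m * u + c) (at_right u)"
    proof (rule Lim_transform_eventually)
      show "((\<lambda>s. of_int m * s + c) \<longlongrightarrow> of_int m * u + c) (at_right u)"
        by (intro tendsto_intros)
      show "\<forall>\<^sub>F s in at_right u. of_int m * s + c = F s" using mc by eventually_elim simp
    qed
    ultimately have Fu': "F u = of_int m * u + c"
      using tendsto_unique[OF trivial_limit_at_right_real] by blast
    have "\<forall>\<^sub>F s in at_right u. s < l" using l eventually_at_right by auto
    moreover have "\<forall>\<^sub>F s in at_right u. u < s" by (simp add: eventually_at_right_less)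
    ultimately have "\<forall>\<^sub>F s in at_right u. f (edge_point \<Gamma> e (ereal s)) = ereal (of_int m * s + c)"
      using mc
    proof eventually_elim
      case (elim s)
      then have "s \<in> finite_parameters \<Gamma> e" using dom by auto
      then show ?case using elim fF by simp
    qed
    then have "slope_along \<Gamma> f e (filtermap ereal (at_right u)) = m"
      by (intro slope_along_eqI) (auto simp: eventually_neq_at_within)
    then have slope: "outgoing_slope \<Gamma> f d = m"
      by (simp add: d_eq u(1) True at_right_ereal)
    have "\<forall>\<^sub>F s in at_right 0. F (s + u) = of_int m * (s + u) + c"
      using mc by (simp add: eventually_at_right_to_0[of _ u])
    then show ?thesis
      by eventually_elim
        (use Fu Fu' slope True in \<open>simp add: ray_point_def d_eq u(1) F_def algebra_simps\<close>)
  next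
    case False
    have "0 < u" using u(1) u(6)[OF False] by simp
    have dom: "{0..u} \<subseteq> finite_parameters \<Gamma> e"
      using u(1,3) by (auto simp: finite_parameters_def intro: order_trans[of _ "ereal u"])
    obtain m c where mc: "\<forall>\<^sub>F s in at_left u. F s = of_int m * s + c"
      using pa_on_germ_left[OF pa, of u] u \<open>0 < u\<close> by auto
    have "(F \<longlongrightarrow> F u) (at_left u)"
      using continuous_on_Icc_at_leftD[OF continuous_on_subset[OF cont dom]] \<open>0 < u\<close> by simp
    moreover have "(F \<longlongrightarrow> of_int m * u + c) (at_left u)"
    proof (rule Lim_transform_eventually)
      show "((\<lambda>s. of_int m * s + c) \<longlongrightarrow> of_int m * u + c) (at_left u)"
        by (intro tendsto_intros)
      show "\<forall>\<^sub>F s in at_left u. of_int m * s + c = F s" using mc by eventually_elim simp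
    qed
    ultimately have Fu': "F u = of_int m * u + c"
      using tendsto_unique[OF trivial_limit_at_left_real] by blast
    have "\<forall>\<^sub>F s in at_left u. 0 < s" using \<open>0 < u\<close> eventually_at_left by auto
    moreover have "\<forall>\<^sub>F s in at_left u. s < u" by (simp add: eventually_at_filter)
    ultimately have "\<forall>\<^sub>F s in at_left u. f (edge_point \<Gamma> e (ereal s)) = ereal (of_int m * s + c)"
      using mc
    proof eventually_elim
      case (elim s)
      then have "s \<in> finite_parameters \<Gamma> e" using dom by auto
      then show ?case using elim fF by simp
    qed
    then have "slope_along \<Gamma> f e (filtermap ereal (at_left u)) = m"
      by (intro slope_along_eqI) (auto simp: eventually_neq_at_within)
    then have slope: "outgoing_slope \<Gamma> f d = - m"
      by (simp add: d_eq u(1) False at_left_ereal)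
    have "\<forall>\<^sub>F s in at_right 0. F (u - s) = of_int m * (u - s) + c"
      using mc by (simp add: eventually_at_left_iff_at_right_0)
    then show ?thesis
      by eventually_elim
        (use Fu Fu' slope False in \<open>simp add: ray_point_def d_eq u(1) F_def algebra_simps\<close>)
  qed
qed

lemma eventually_ray_points:
  assumes f: "f \<in> rational_units \<Gamma>" and x: "x \<in> finite_points \<Gamma>"
  shows "\<forall>\<^sub>F s in at_right 0. \<forall>d\<in>directions \<Gamma> x. real_of_ereal (f (ray_point \<Gamma> d s))
    = real_of_ereal (f x) + s * of_int (outgoing_slope \<Gamma> f d)"
  using outgoing_slope_ray_point[OF f x] finite_directions[OF x]
  by (intro eventually_ball_finite) auto

text \<open>
  An expression of the slope sum through distances and values alone: on each ray at \<open>x\<close> the function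
  grows over the length \<open>s\<close> by \<open>s\<close> times its slope.
\<close>

lemma sum_over_sphere:
  assumes f: "f \<in> rational_units \<Gamma>" and x: "x \<in> finite_points \<Gamma>"
  shows "\<forall>\<^sub>F s in at_right 0.
    (\<Sum>y | y \<in> finite_points \<Gamma> \<and> curve_dist \<Gamma> y x = ereal s. real_of_ereal (f y) - real_of_ereal (f x))
      = s * of_int (slope_sum \<Gamma> f x)"
proof -
  obtain \<delta> where gap: "parameter_gap \<Gamma> x \<delta>" by (rule parameter_gap_exists)
  then have "0 < \<delta> / 2" by (simp add: parameter_gap_def)
  then have "\<forall>\<^sub>F s in at_right 0. s < \<delta> / 2" using eventually_at_right by blast
  moreover have "\<forall>\<^sub>F s in at_right (0::real). 0 < s" by (simp add: eventually_at_right_less)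
  ultimately show ?thesis
    using eventually_ray_points[OF f x]
  proof eventually_elim
    case (elim s)
    have "(\<Sum>y | y \<in> finite_points \<Gamma> \<and> curve_dist \<Gamma> y x = ereal s. real_of_ereal (f y) - real_of_ereal (f x))
      = (\<Sum>d\<in>directions \<Gamma> x. real_of_ereal (f (ray_point \<Gamma> d s)) - real_of_ereal (f x))"
      by (rule sum.reindex_bij_betw[OF ray_point_sphere[OF gap x elim(2,1)], symmetric])
    also have "\<dots> = (\<Sum>d\<in>directions \<Gamma> x. s * of_int (outgoing_slope \<Gamma> f d))"
      using elim(3) by (intro sum.cong) auto
    finally show ?case by (simp add: slope_sum_def sum_distrib_left)
  qed
qed

lemma rational_unit_locally_bounded_below:
  assumes f: "f \<in> rational_units \<Gamma>" and x: "x \<in> finite_points \<Gamma>"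
  obtains K \<delta> where "0 \<le> K" "0 < \<delta>"
    "\<And>y s. y \<in> finite_points \<Gamma> \<Longrightarrow> curve_dist \<Gamma> y x = ereal s \<Longrightarrow> s < \<delta> \<Longrightarrow>
      real_of_ereal (f x) - K * s \<le> real_of_ereal (f y)"
proof -
  obtain \<delta> where gap: "parameter_gap \<Gamma> x \<delta>" by (rule parameter_gap_exists)
  obtain b where "0 < b" and b: "\<And>s d. 0 < s \<Longrightarrow> s < b \<Longrightarrow> d \<in> directions \<Gamma> x \<Longrightarrow>
    real_of_ereal (f (ray_point \<Gamma> d s)) = real_of_ereal (f x) + s * of_int (outgoing_slope \<Gamma> f d)"
    using eventually_ray_points[OF f x] unfolding eventually_at_right_field by blast
  define K where "K = (\<Sum>d\<in>directions \<Gamma> x. \<bar>of_int (outgoing_slope \<Gamma> f d) :: real\<bar>)"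
  have "0 \<le> K" by (simp add: K_def sum_nonneg)
  moreover have "0 < min b (\<delta> / 2)" using gap \<open>0 < b\<close> by (simp add: parameter_gap_def)
  moreover have "real_of_ereal (f x) - K * s \<le> real_of_ereal (f y)"
    if y: "y \<in> finite_points \<Gamma>" "curve_dist \<Gamma> y x = ereal s" "s < min b (\<delta> / 2)" for y s
  proof (cases "y = x")
    case True
    then have "s = 0" using y curve_dist_self[of x] by (simp add: finite_points_def)
    then show ?thesis using True by simp
  next
    case False
    have "curve_dist \<Gamma> y x < ereal (\<delta> / 2)" using y by simp
    with False obtain d s' where d: "d \<in> directions \<Gamma> x" "0 < s'" "s' < \<delta> / 2" "y = ray_point \<Gamma> d s'"
      using small_distance_ray_point[OF gap x] by blast
    have s': "s' = s" using curve_dist_ray_point[OF gap x d(2,3,1)] d(4) y(2) by simp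
    have "\<bar>of_int (outgoing_slope \<Gamma> f d) :: real\<bar> \<le> K"
      unfolding K_def by (rule member_le_sum[OF d(1)]) (auto simp: finite_directions[OF x])
    then have "s * (- K) \<le> s * of_int (outgoing_slope \<Gamma> f d)"
      using d(2) s' by (intro mult_left_mono) auto
    then show ?thesis
      using b[of s d] d s' y(3) by (simp add: algebra_simps)
  qed
  ultimately show ?thesis by (rule that)
qed

text \<open>
  This turns a lower bound for one value of \<open>f\<close> into an inequality between elements of the semifield.
  Close to \<open>x\<close> the inequality holds because \<open>f\<close> has bounded slopes there; farther away the multiple of
  \<open>CF \<Gamma> {x} \<epsilon>\<close> is at most \<open>-1\<close>.  The maximum with \<open>c - 1\<close> is needed because \<open>f\<close> may be unbounded
  below, namely if it takes the value \<open>-\<infinity>\<close> at a point at infinity.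
\<close>

lemma multiple_of_CF_below:
  assumes f: "f \<in> rational_units \<Gamma>" and x: "x \<in> finite_points \<Gamma>" and "0 < \<epsilon>"
    and c: "c \<le> real_of_ereal (f x)"
  obtains n :: nat where "\<And>y. y \<in> finite_points \<Gamma> \<Longrightarrow>
    c + real n * real_of_ereal (CF \<Gamma> {x} (ereal \<epsilon>) y) \<le> max (real_of_ereal (f y)) (c - 1)"
proof -
  obtain K \<delta> where K: "0 \<le> K" "0 < \<delta>"
    "\<And>y s. y \<in> finite_points \<Gamma> \<Longrightarrow> curve_dist \<Gamma> y x = ereal s \<Longrightarrow> s < \<delta> \<Longrightarrow>
      real_of_ereal (f x) - K * s \<le> real_of_ereal (f y)"
    using rational_unit_locally_bounded_below[OF f x] by blast
  define a where "a = min \<epsilon> \<delta>"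
  have "0 < a" using \<open>0 < \<epsilon>\<close> K(2) by (simp add: a_def)
  \<comment> \<open>The bound \<open>K\<close> lets the multiple fall at least as fast as \<open>f\<close> near \<open>x\<close>, the bound \<open>1 / a\<close> gives the drop by \<open>1\<close> farther away.\<close>
  obtain n :: nat where n: "max K (1 / a) \<le> real n" using real_arch_simple by blast
  then have n: "K \<le> real n" "1 \<le> real n * a" using \<open>0 < a\<close> by (auto simp: field_simps)
  have "c + real n * real_of_ereal (CF \<Gamma> {x} (ereal \<epsilon>) y) \<le> max (real_of_ereal (f y)) (c - 1)"
    if y: "y \<in> finite_points \<Gamma>" for y
  proof -
    have CF: "CF \<Gamma> {x} (ereal \<epsilon>) y = - min (ereal \<epsilon>) (curve_dist \<Gamma> y x)"
      using y by (simp add: CF_def curve_setdist_def finite_points_def)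
    show ?thesis
    proof (cases "curve_dist \<Gamma> y x < ereal a")
      case True
      then obtain s where s: "curve_dist \<Gamma> y x = ereal s" "0 \<le> s" "s < a"
        using curve_dist_nonneg[of y x] by (cases "curve_dist \<Gamma> y x") auto
      then have "s < \<epsilon>" by (simp add: a_def)
      then have "CF \<Gamma> {x} (ereal \<epsilon>) y = ereal (- s)" by (simp add: CF s(1) min_def)
      moreover have "K * s \<le> real n * s" using n(1) s(2) by (rule mult_right_mono)
      ultimately show ?thesis
        using K(3)[OF y s(1)] s(3) c by (simp add: a_def)
    next
      case False
      moreover have "ereal a \<le> ereal \<epsilon>" by (simp add: a_def)
      ultimately have "ereal a \<le> min (ereal \<epsilon>) (curve_dist \<Gamma> y x)" by simp
      moreover have "\<bar>min (ereal \<epsilon>) (curve_dist \<Gamma> y x)\<bar> \<noteq> \<infinity>"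
        using curve_dist_nonneg[of y x] by (cases "curve_dist \<Gamma> y x") (auto simp: min_def)
      then obtain w where w: "min (ereal \<epsilon>) (curve_dist \<Gamma> y x) = ereal w"
        by (cases "min (ereal \<epsilon>) (curve_dist \<Gamma> y x)") auto
      ultimately have "real n * a \<le> real n * w" by (intro mult_left_mono) auto
      then show ?thesis using n(2) by (simp add: CF w)
    qed
  qed
  then show ?thesis by (rule that)
qed

lemma edge_point_eq_infinity:
  assumes e: "e \<in> arcs (skeleton \<Gamma>)" "len \<Gamma> e = \<infinity>"
    and e': "e' \<in> arcs (skeleton \<Gamma>)" "t \<in> {0..len \<Gamma> e'}" "edge_point \<Gamma> e' t = edge_point \<Gamma> e \<infinity>"
  shows "e' = e \<and> t = \<infinity>"
proof -
  have "\<not> \<bar>t\<bar> \<noteq> \<infinity>"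
  proof
    assume "\<bar>t\<bar> \<noteq> \<infinity>"
    then have "edge_point \<Gamma> e' t \<in> finite_points \<Gamma>"
      using e' finite_points_edge_point[of e' "real_of_ereal t"] by (cases t) (auto simp: finite_parameters_def)
    then show False using e' e by (auto simp: finite_points_def infinite_points_def)
  qed
  then have "t = \<infinity>" using e'(2) by auto
  then show ?thesis
    using e' e infinite_edge_unique(2)[OF e, of e'] by (auto simp: edge_point_def)
qed

lemma directions_at_infinity:
  assumes e: "e \<in> arcs (skeleton \<Gamma>)" "len \<Gamma> e = \<infinity>"
  shows "directions \<Gamma> (edge_point \<Gamma> e \<infinity>) = {(e, \<infinity>, False)}"
proof -
  have "e' = e \<and> t = \<infinity> \<and> \<not> b" if "(e', t, b) \<in> directions \<Gamma> (edge_point \<Gamma> e \<infinity>)" for e' t b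
    using that edge_point_eq_infinity[OF e, of e' t] by (auto simp: directions_def less_imp_le)
  moreover have "(e, \<infinity>, False) \<in> directions \<Gamma> (edge_point \<Gamma> e \<infinity>)"
    using e by (simp add: directions_def)
  ultimately show ?thesis by fast
qed

text \<open>
  A point at infinity has a single direction, in which the slope is read off with a minus sign.
\<close>

lemma slope_sum_at_infinity:
  assumes f: "f \<in> rational_units \<Gamma>" and e: "e \<in> arcs (skeleton \<Gamma>)" "len \<Gamma> e = \<infinity>"
  obtains c where "\<forall>\<^sub>F s in at_top. real_of_ereal (f (Inner e s))
    = - of_int (slope_sum \<Gamma> f (edge_point \<Gamma> e \<infinity>)) * s + c"
proof -
  have "pa_on \<infinity> (\<lambda>t. real_of_ereal (f (edge_point \<Gamma> e (ereal t))))"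
    using rational_units_pl[OF f] e by (auto simp: pl_function_def)
  then obtain m c where mc:
    "\<forall>\<^sub>F s in at_top. real_of_ereal (f (edge_point \<Gamma> e (ereal s))) = of_int m * s + c"
    by (rule pa_on_germ_infinity)
  then have "\<forall>\<^sub>F s in at_top. f (edge_point \<Gamma> e (ereal s)) = ereal (of_int m * s + c)"
    using eventually_gt_at_top[of 0]
  proof eventually_elim
    case (elim s)
    then have "edge_point \<Gamma> e (ereal s) \<in> finite_points \<Gamma>"
      using finite_points_edge_point[of e s] e by (simp add: finite_parameters_def)
    then show ?case using elim(1) rational_units_finite[OF f] by metis
  qed
  then have "slope_along \<Gamma> f e (filtermap ereal at_top) = m"
    by (intro slope_along_eqI) (auto simp: eventually_at_top_not_equal)
  then have "slope_sum \<Gamma> f (edge_point \<Gamma> e \<infinity>) = - m"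
    by (simp add: slope_sum_def directions_at_infinity[OF e] at_left_PInf)
  moreover have "\<forall>\<^sub>F s in at_top. real_of_ereal (f (Inner e s)) = of_int m * s + c"
    using mc eventually_gt_at_top[of 0] by eventually_elim (use e in \<open>simp add: edge_point_Inner\<close>)
  ultimately show ?thesis using that by simp
qed

lemma neighbourhood_of_infinity:
  assumes e: "e \<in> arcs (skeleton \<Gamma>)" "len \<Gamma> e = \<infinity>" and "0 \<le> T"
  shows "curve_open \<Gamma> (insert (edge_point \<Gamma> e \<infinity>) {Inner e t | t. T < t})"
  unfolding curve_open_def
proof (intro conjI ballI)
  let ?U = "insert (edge_point \<Gamma> e \<infinity>) {Inner e t | t. T < t}"
  show "?U \<subseteq> points \<Gamma>"
    using e edge_point_in_points[of e \<infinity>] \<open>0 \<le> T\<close> by (auto simp: points_def)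
  fix e' assume e': "e' \<in> arcs (skeleton \<Gamma>)"
  have "{t \<in> {0..len \<Gamma> e'}. edge_point \<Gamma> e' t \<in> ?U} = (if e' = e then {0..len \<Gamma> e'} \<inter> {ereal T<..} else {})"
  proof (intro equalityI subsetI)
    fix t assume t: "t \<in> {t \<in> {0..len \<Gamma> e'}. edge_point \<Gamma> e' t \<in> ?U}"
    show "t \<in> (if e' = e then {0..len \<Gamma> e'} \<inter> {ereal T<..} else {})"
    proof (cases "edge_point \<Gamma> e' t = edge_point \<Gamma> e \<infinity>")
      case True
      then show ?thesis using edge_point_eq_infinity[OF e e', of t] t by auto
    next
      case False
      then obtain s where "edge_point \<Gamma> e' t = Inner e s" "T < s" using t by auto
      then show ?thesis using edge_point_eq_Inner[of e' t e s] t by auto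
    qed
  next
    fix t assume t: "t \<in> (if e' = e then {0..len \<Gamma> e'} \<inter> {ereal T<..} else {})"
    then have [simp]: "e' = e" and T: "ereal T < t" by (auto split: if_splits)
    show "t \<in> {t \<in> {0..len \<Gamma> e'}. edge_point \<Gamma> e' t \<in> ?U}"
    proof (cases t)
      case (real s)
      then have "edge_point \<Gamma> e t = Inner e s"
        using edge_point_Inner[of s e] e T \<open>0 \<le> T\<close> by simp
      then show ?thesis using t real T by simp
    qed (use t in auto)
  qed
  then show "openin (top_of_set {0..len \<Gamma> e'}) {t \<in> {0..len \<Gamma> e'}. edge_point \<Gamma> e' t \<in> ?U}"
    by (auto intro: openin_open_Int)
qed

lemma neighbourhood_of_infinity_contains_ray:
  assumes e: "e \<in> arcs (skeleton \<Gamma>)" "len \<Gamma> e = \<infinity>"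
    and U: "curve_open \<Gamma> U" "edge_point \<Gamma> e \<infinity> \<in> U"
  shows "\<forall>\<^sub>F t in at_top. Inner e t \<in> U"
proof -
  have "openin (top_of_set {0..\<infinity>}) {t \<in> {0..\<infinity>}. edge_point \<Gamma> e t \<in> U}"
    using U(1) e unfolding curve_open_def by metis
  then obtain V where V: "open V" "{t \<in> {0..\<infinity>}. edge_point \<Gamma> e t \<in> U} = {0..\<infinity>} \<inter> V"
    unfolding openin_open by metis
  have "\<infinity> \<in> {t \<in> {0..\<infinity>}. edge_point \<Gamma> e t \<in> U}" using U(2) by simp
  then have "\<infinity> \<in> V" unfolding V(2) by simp
  then obtain a where a: "{ereal a<..} \<subseteq> V" using open_PInfty[OF V(1)] by metis
  show ?thesis
    using eventually_gt_at_top[of "max a 0"]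
  proof eventually_elim
    case (elim t)
    then have "ereal t \<in> {0..\<infinity>} \<inter> V" using a by auto
    then have "edge_point \<Gamma> e (ereal t) \<in> U" using V(2) by blast
    then show ?case using elim e by (simp add: edge_point_Inner)
  qed
qed

end

section \<open>Divisible rational functions are constant\<close>

context tropical_curve
begin

text \<open>
  An integer that is divisible by every positive integer is \<open>0\<close>; it suffices to try \<open>\<bar>m\<bar> + 1\<close>.
\<close>

lemma divisible_slope_zero:
  assumes "F \<noteq> bot" "\<And>k. \<forall>\<^sub>F s in F. s \<noteq> k"
    and G: "\<forall>\<^sub>F s in F. G s = of_int m * s + c"
    and div: "\<And>n::nat. 0 < n \<Longrightarrow> \<exists>m'::int. \<exists>c'. \<forall>\<^sub>F s in F. G s = real n * (of_int m' * s + c')"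
  shows "m = 0"
proof -
  obtain m' :: int and c' where
    "\<forall>\<^sub>F s in F. G s = real (nat \<bar>m\<bar> + 1) * (of_int m' * s + c')"
    using div[of "nat \<bar>m\<bar> + 1"] by auto
  with G have "\<forall>\<^sub>F s in F. of_int m * s + c
      = (real (nat \<bar>m\<bar> + 1) * of_int m') * s + real (nat \<bar>m\<bar> + 1) * c'"
    by eventually_elim (simp add: algebra_simps)
  then have "of_int m = real (nat \<bar>m\<bar> + 1) * of_int m'"
    by (rule eventually_affine_unique[OF assms(1,2)])
  then have "real_of_int m = real_of_int ((\<bar>m\<bar> + 1) * m')" by (simp add: add.commute)
  then have eq: "m = (\<bar>m\<bar> + 1) * m'" by (simp only: of_int_eq_iff)
  show ?thesis
  proof (rule ccontr)
    assume "m \<noteq> 0"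
    then have "\<bar>m\<bar> + 1 \<le> \<bar>m\<bar>" using zdvd_imp_le[of "\<bar>m\<bar> + 1" "\<bar>m\<bar>"] eq
      by (metis abs_dvd_iff dvd_abs_iff dvd_triv_left zero_less_abs_iff)
    then show False by simp
  qed
qed

lemma divisible_constant_on_edge:
  assumes G: "G \<in> rational_units \<Gamma>"
    and div: "\<And>n::nat. 0 < n \<Longrightarrow> \<exists>g\<in>rational_units \<Gamma>. \<forall>x\<in>finite_points \<Gamma>.
      real_of_ereal (G x) = real n * real_of_ereal (g x)"
    and e: "e \<in> arcs (skeleton \<Gamma>)" and st: "s \<in> finite_parameters \<Gamma> e" "t \<in> finite_parameters \<Gamma> e" "s \<le> t"
  shows "G (edge_point \<Gamma> e (ereal t)) = G (edge_point \<Gamma> e (ereal s))"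
proof -
  define F where "F u = real_of_ereal (G (edge_point \<Gamma> e (ereal u)))" for u
  have pa: "pa_on (len \<Gamma> e) F" and cont: "continuous_on (finite_parameters \<Gamma> e) F"
    using rational_units_pl[OF G] e by (auto simp: pl_function_def F_def[abs_def])
  obtain B where "finite B"
    and B: "\<And>a b. a < b \<Longrightarrow> {a<..<b} \<subseteq> {0<..<len \<Gamma> e} - B \<Longrightarrow> affine_on a b F"
    using pa by (rule pa_onE) blast
  have sub: "{s..t} \<subseteq> finite_parameters \<Gamma> e"
    using st by (auto simp: finite_parameters_def intro: order_trans[of _ "ereal t"])
  have "F t = F s"
  proof (rule has_derivative_zero_unique_strong_interval
      [where f = F and a = s and b = t and k = "ereal -` B \<union> {s, t}"])
    show "finite (ereal -` B \<union> {s, t})"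
      using finite_vimageI[OF \<open>finite B\<close>, of ereal] by (simp add: inj_on_def)
    show "continuous_on {s..t} F" using cont sub by (rule continuous_on_subset)
    show "F s = F s" by simp
    show "t \<in> {s..t}" using st by simp
    fix u assume u: "u \<in> {s..t} - (ereal -` B \<union> {s, t})"
    have u0: "0 < u" using u st by (auto simp: finite_parameters_def)
    have "ereal u < ereal t" using u by auto
    also have "ereal t \<le> len \<Gamma> e" using st by (simp add: finite_parameters_def)
    finally have ul: "ereal u < len \<Gamma> e" .
    obtain b where b: "ereal u < b" "{ereal u<..<b} \<subseteq> {0<..<len \<Gamma> e} - B"
      using gap_to_the_right[OF \<open>finite B\<close>, of "ereal u" "len \<Gamma> e"] u0 ul by auto
    obtain a where a: "a < ereal u" "{a<..<ereal u} \<subseteq> {0<..<len \<Gamma> e} - B"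
      using gap_to_the_left[OF \<open>finite B\<close>, of "ereal u" "len \<Gamma> e"] u0 less_imp_le[OF ul] by auto
    have "{a<..<b} \<subseteq> {0<..<len \<Gamma> e} - B"
    proof
      fix z assume "z \<in> {a<..<b}"
      then consider "z \<in> {a<..<ereal u}" | "z = ereal u" | "z \<in> {ereal u<..<b}" by fastforce
      then show "z \<in> {0<..<len \<Gamma> e} - B" using a b u u0 ul by cases auto
    qed
    then obtain m c where mc: "\<And>v. ereal v \<in> {a<..<b} \<Longrightarrow> F v = of_int m * v + c"
      using B[of a b] a(1) b(1) unfolding affine_on_def by (meson less_trans)
    have "\<forall>\<^sub>F v in at_right u. ereal v < b"
    proof -
      have "\<forall>\<^sub>F v in at_right (ereal u). v < b" using b(1) eventually_at_right by blast
      then show ?thesis unfolding at_right_ereal eventually_filtermap .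
    qed
    moreover have gt: "\<forall>\<^sub>F v in at_right u. u < v" by (simp add: eventually_at_right_less)
    ultimately have "\<forall>\<^sub>F v in at_right u. F v = of_int m * v + c"
    proof eventually_elim
      case (elim v)
      then have "a < ereal v" using a(1) less_trans[of a "ereal u" "ereal v"] by simp
      then show ?case using elim by (intro mc) simp
    qed
    then have "m = 0"
    proof (rule divisible_slope_zero[rotated 2])
      show "at_right u \<noteq> bot" by simp
      show "\<forall>\<^sub>F v in at_right u. v \<noteq> k" for k by (simp add: eventually_neq_at_within)
      fix n :: nat assume "0 < n"
      then obtain g where g: "g \<in> rational_units \<Gamma>"
        "\<forall>x\<in>finite_points \<Gamma>. real_of_ereal (G x) = real n * real_of_ereal (g x)"
        using div by blast
      have "pa_on (len \<Gamma> e) (\<lambda>v. real_of_ereal (g (edge_point \<Gamma> e (ereal v))))"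
        using rational_units_pl[OF g(1)] e by (auto simp: pl_function_def)
      then obtain m' c' where
        "\<forall>\<^sub>F v in at_right u. real_of_ereal (g (edge_point \<Gamma> e (ereal v))) = of_int m' * v + c'"
        using pa_on_germ_right u0 ul by (metis less_imp_le)
      moreover have "\<forall>\<^sub>F v in at_right u. v < t"
        by (rule eventually_at_rightI[of u t]) (use u in auto)
      ultimately have "\<forall>\<^sub>F v in at_right u. F v = real n * (of_int m' * v + c')"
        using gt
      proof eventually_elim
        case (elim v)
        then have "v \<in> finite_parameters \<Gamma> e" using u sub by auto
        then show ?case
          using g(2) finite_points_edge_point[OF e] elim(1) by (simp add: F_def)
      qed
      then show "\<exists>m'::int. \<exists>c'. \<forall>\<^sub>F v in at_right u. F v = real n * (of_int m' * v + c')"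
        by blast
    qed
    show "(F has_derivative (\<lambda>h. 0)) (at u within {s..t})"
    proof (rule has_derivative_transform_within_open[of "\<lambda>_. c"])
      show "((\<lambda>_. c) has_derivative (\<lambda>h. 0)) (at u within {s..t})" by simp
      show "open (ereal -` {a<..<b})"
        by (intro open_vimage continuous_on_ereal continuous_on_id) auto
      show "u \<in> ereal -` {a<..<b}" using a(1) b(1) by simp
      show "c = F v" if "v \<in> ereal -` {a<..<b}" for v
        using mc[of v] that \<open>m = 0\<close> by simp
    qed
  qed
  then show ?thesis
    using rational_units_finite[OF G finite_points_edge_point[OF e st(1)]]
      rational_units_finite[OF G finite_points_edge_point[OF e st(2)]]
    by (metis F_def)
qed

text \<open>
  If \<open>G\<close> is an \<open>n\<close>-fold product for every \<open>n\<close>, all its slopes are divisible by every \<open>n\<close>, hence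
  zero.  Since roots of real constants exist, this describes the constants in terms of multiplication
  only.
\<close>

lemma divisible_rational_function_constant:
  assumes G: "G \<in> rational_units \<Gamma>"
    and div: "\<And>n::nat. 0 < n \<Longrightarrow> \<exists>g\<in>rational_units \<Gamma>. \<forall>x\<in>finite_points \<Gamma>.
      real_of_ereal (G x) = real n * real_of_ereal (g x)"
  obtains c where "G = const_fun \<Gamma> (ereal c)"
proof -
  note edge = divisible_constant_on_edge[OF G div]
  have zero_par: "0 \<in> finite_parameters \<Gamma> e" if "e \<in> arcs (skeleton \<Gamma>)" for e
    using less_imp_le[OF len_pos[OF that]] by (simp add: finite_parameters_def zero_ereal_def)
  have ends: "G (Vertex (head (skeleton \<Gamma>) e)) = G (Vertex (tail (skeleton \<Gamma>) e))"
    if e: "e \<in> arcs (skeleton \<Gamma>)" for e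
  proof (cases "len \<Gamma> e")
    case (real l)
    have "0 < l" using len_pos[OF e] real by simp
    then have "edge_point \<Gamma> e (ereal l) = Vertex (head (skeleton \<Gamma>) e)" "l \<in> finite_parameters \<Gamma> e"
      using real by (auto simp: edge_point_def finite_parameters_def)
    then show ?thesis
      using edge[OF _ e zero_par[OF e], of l] \<open>0 < l\<close> by (simp add: edge_point_def)
  next
    case PInf
    have "\<forall>\<^sub>F s in at_top. G (edge_point \<Gamma> e (ereal s)) = G (Vertex (tail (skeleton \<Gamma>) e))"
      using eventually_ge_at_top[of 0]
    proof eventually_elim
      case (elim s)
      then show ?case
        using edge[OF _ e zero_par[OF e], of s] PInf by (simp add: edge_point_def finite_parameters_def)
    qed
    then have "((\<lambda>s. G (edge_point \<Gamma> e (ereal s))) \<longlongrightarrow> G (Vertex (tail (skeleton \<Gamma>) e))) at_top"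
      by (rule tendsto_eventually)
    moreover have "edge_point \<Gamma> e \<infinity> = Vertex (head (skeleton \<Gamma>) e)"
      using PInf by (simp add: edge_point_def)
    ultimately show ?thesis
      using rational_units_limit[OF G e PInf] tendsto_unique[OF trivial_limit_at_top_linorder] by metis
  qed (use len_pos[OF e] in auto)
  obtain v where v: "v \<in> verts (skeleton \<Gamma>)"
    using skeleton_connected by (auto simp: connected_def strongly_connected_def)
  have verts: "G (Vertex w) = G (Vertex v)" if w: "w \<in> verts (skeleton \<Gamma>)" for w
  proof -
    have "v \<rightarrow>\<^sup>*\<^bsub>with_proj (mk_symmetric (skeleton \<Gamma>))\<^esub> w"
      using skeleton_connected v w by (auto simp: connected_def strongly_connected_def)
    then have "(v, w) \<in> (arcs_ends (with_proj (mk_symmetric (skeleton \<Gamma>))))\<^sup>*"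
      by (rule reachable_rtranclI)
    then show ?thesis
    proof (induction rule: rtrancl_induct)
      case (step y z)
      then have "(y, z) \<in> parcs (mk_symmetric (skeleton \<Gamma>))" by auto
      then have "G (Vertex z) = G (Vertex y)"
        using ends by (auto simp: mk_symmetric_def)
      with step show ?case by simp
    qed simp
  qed
  have fin: "G x = G (Vertex v)" if x: "x \<in> finite_points \<Gamma>" for x
  proof (cases x)
    case (Vertex w)
    then show ?thesis using x verts by (auto simp: finite_points_def points_def)
  next
    case (Inner e t)
    then have e: "e \<in> arcs (skeleton \<Gamma>)" "0 < t" "ereal t < len \<Gamma> e"
      using x by (auto simp: Inner_finite_points)
    then have "G x = G (Vertex (tail (skeleton \<Gamma>) e))"
      using edge[OF _ e(1) zero_par[OF e(1)], of t] Inner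
      by (simp add: finite_parameters_def edge_point_Inner less_imp_le) (simp add: edge_point_def)
    then show ?thesis using verts e(1) by simp
  qed
  obtain x where x: "x \<in> finite_points \<Gamma>" using finite_points_nonempty by blast
  define c where "c = real_of_ereal (G x)"
  have "G y = ereal c" if "y \<in> finite_points \<Gamma>" for y
    using fin[OF that] fin[OF x] rational_units_finite[OF G x] by (simp add: c_def)
  then have "G = const_fun \<Gamma> (ereal c)"
    by (intro rational_units_eqI[OF G const_fun_unit]) (simp add: const_fun_def finite_points_def)
  then show ?thesis by (rule that)
qed

end

text \<open>
  On integers linearity is additivity, and \<open>n * x\<close> lies between two consecutive integers.  By
  monotonicity \<open>n\<close> times the deviation from linearity is bounded independently of \<open>n\<close>.
\<close>

lemma additive_mono_linear:
  fixes h :: "real \<Rightarrow> real"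
  assumes add: "\<And>a b. h (a + b) = h a + h b" and "mono h"
  shows "h x = h 1 * x"
proof -
  have nat: "h (real n * a) = real n * h a" for n a
  proof (induction n)
    case 0 show ?case using add[of 0 0] by simp
  next
    case (Suc n) then show ?case using add[of a "real n * a"] by (simp add: algebra_simps)
  qed
  have minus: "h (- a) = - h a" for a using add[of a "- a"] add[of 0 0] by simp
  have int: "h (of_int k) = of_int k * h 1" for k
    using nat[of "nat k" 1] nat[of "nat (- k)" 1] minus[of "of_int k"] by (cases "0 \<le> k") auto
  have "0 \<le> h 1" using monoD[OF \<open>mono h\<close>, of 0 1] add[of 0 0] by simp
  have bound: "real n * \<bar>h x - h 1 * x\<bar> \<le> h 1" for n
  proof -
    define k where "k = \<lfloor>real n * x\<rfloor>"
    have k: "of_int k \<le> real n * x" "real n * x \<le> of_int (k + 1)" by (simp_all add: k_def)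
    have "of_int k * h 1 \<le> real n * h x" "real n * h x \<le> of_int (k + 1) * h 1"
      using monoD[OF \<open>mono h\<close> k(1)] monoD[OF \<open>mono h\<close> k(2)] by (simp_all only: int nat)
    moreover have "of_int k * h 1 \<le> real n * x * h 1" "real n * x * h 1 \<le> of_int (k + 1) * h 1"
      using k \<open>0 \<le> h 1\<close> by (intro mult_right_mono; simp)+
    ultimately have "\<bar>real n * h x - real n * x * h 1\<bar> \<le> h 1"
      by (simp add: algebra_simps abs_le_iff)
    moreover have "real n * h x - real n * x * h 1 = real n * (h x - h 1 * x)"
      by (simp add: algebra_simps)
    ultimately show ?thesis by (simp add: abs_mult)
  qed
  have "\<not> 0 < \<bar>h x - h 1 * x\<bar>"
  proof
    assume "0 < \<bar>h x - h 1 * x\<bar>"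
    then obtain n :: nat where "h 1 < real n * \<bar>h x - h 1 * x\<bar>"
      using reals_Archimedean3 by blast
    with bound[of n] show False by simp
  qed
  then show ?thesis by simp
qed

section \<open>Isomorphisms of rational function semifields\<close>

locale rational_function_isomorphism =
  C1: tropical_curve \<Gamma>1 + C2: tropical_curve \<Gamma>2
  for \<Gamma>1 :: "('v1, 'e1) edge_weighted_graph" and \<Gamma>2 :: "('v2, 'e2) edge_weighted_graph" +
  fixes \<psi> :: "(('v1, 'e1) point \<Rightarrow> ereal) \<Rightarrow> ('v2, 'e2) point \<Rightarrow> ereal"
  assumes iso: "\<psi> \<in> semiring_iso (Rat \<Gamma>1) (Rat \<Gamma>2)"
begin

lemma units_carrier: "rational_units \<Gamma> \<subseteq> carrier (Rat \<Gamma>)"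
  by (auto simp: Rat_def rational_functions_def rational_units_def)

lemma iso_hom:
  assumes "f \<in> rational_units \<Gamma>1" "g \<in> rational_units \<Gamma>1"
  shows "\<psi> (f \<oplus>\<^bsub>Rat \<Gamma>1\<^esub> g) = \<psi> f \<oplus>\<^bsub>Rat \<Gamma>2\<^esub> \<psi> g"
    and "\<psi> (f \<otimes>\<^bsub>Rat \<Gamma>1\<^esub> g) = \<psi> f \<otimes>\<^bsub>Rat \<Gamma>2\<^esub> \<psi> g"
proof -
  have hom: "\<psi> \<in> ring_hom (Rat \<Gamma>1) (Rat \<Gamma>2)"
    using iso by (simp add: semiring_iso_def semiring_hom_def)
  have "f \<in> carrier (Rat \<Gamma>1)" "g \<in> carrier (Rat \<Gamma>1)" using assms units_carrier by blast+
  then show "\<psi> (f \<oplus>\<^bsub>Rat \<Gamma>1\<^esub> g) = \<psi> f \<oplus>\<^bsub>Rat \<Gamma>2\<^esub> \<psi> g"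
    and "\<psi> (f \<otimes>\<^bsub>Rat \<Gamma>1\<^esub> g) = \<psi> f \<otimes>\<^bsub>Rat \<Gamma>2\<^esub> \<psi> g"
    using ring_hom_add[OF hom] ring_hom_mult[OF hom] by auto
qed

lemma iso_unit:
  assumes f: "f \<in> rational_units \<Gamma>1"
  shows "\<psi> f \<in> rational_units \<Gamma>2"
proof -
  have bij: "bij_betw \<psi> (rational_functions \<Gamma>1) (rational_functions \<Gamma>2)"
    and zero: "\<psi> (const_fun \<Gamma>1 (-\<infinity>)) = const_fun \<Gamma>2 (-\<infinity>)"
    using iso by (auto simp: semiring_iso_def semiring_hom_def Rat_def)
  have f': "f \<in> rational_functions \<Gamma>1" "f \<noteq> const_fun \<Gamma>1 (-\<infinity>)"
    using f C1.rational_functions_nonzero by auto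
  have "const_fun \<Gamma>1 (-\<infinity>) \<in> rational_functions \<Gamma>1" by (simp add: rational_functions_def)
  then have "\<psi> f \<noteq> const_fun \<Gamma>2 (-\<infinity>)"
    using f' bij zero by (metis bij_betw_imp_inj_on inj_onD)
  moreover have "\<psi> f \<in> rational_functions \<Gamma>2" using bij f'(1) by (rule bij_betwE[THEN bspec])
  ultimately show ?thesis using C2.rational_functions_nonzero by auto
qed

abbreviation val1 :: "(('v1, 'e1) point \<Rightarrow> ereal) \<Rightarrow> ('v1, 'e1) point \<Rightarrow> real" where
  "val1 f x \<equiv> real_of_ereal (f x)"

abbreviation val2 :: "(('v2, 'e2) point \<Rightarrow> ereal) \<Rightarrow> ('v2, 'e2) point \<Rightarrow> real" where
  "val2 f x \<equiv> real_of_ereal (f x)"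

text \<open>
  The operations of the semifield are only defined up to continuous extension.  The following lemmas
  express what \<open>\<psi>\<close> preserves by values at finite points, where the operations are ordinary maximum
  and addition.
\<close>

lemma iso_max:
  assumes "f \<in> rational_units \<Gamma>1" "g \<in> rational_units \<Gamma>1" "h \<in> rational_units \<Gamma>1"
    and eq: "\<And>x. x \<in> finite_points \<Gamma>1 \<Longrightarrow> val1 h x = max (val1 f x) (val1 g x)"
    and y: "y \<in> finite_points \<Gamma>2"
  shows "val2 (\<psi> h) y = max (val2 (\<psi> f) y) (val2 (\<psi> g) y)"
proof -
  have "h x = max (f x) (g x)" if x: "x \<in> finite_points \<Gamma>1" for x
    using eq[OF x] assms(1-3)[THEN C1.rational_units_finite, OF x] by (metis ereal_max)
  then have "h = f \<oplus>\<^bsub>Rat \<Gamma>1\<^esub> g"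
    using assms(1-3) by (intro C1.rational_units_eqI C1.Rat_add_units(1)) (auto simp: C1.Rat_add_units(2))
  then have "\<psi> h y = max (\<psi> f y) (\<psi> g y)"
    using C2.Rat_add_units(2)[OF iso_unit[OF assms(1)] iso_unit[OF assms(2)] y] iso_hom(1)[OF assms(1,2)]
    by simp
  then show ?thesis
    using assms(1,2)[THEN iso_unit, THEN C2.rational_units_finite, OF y]
    by (metis ereal_max real_of_ereal.simps(1))
qed

lemma iso_plus:
  assumes "f \<in> rational_units \<Gamma>1" "g \<in> rational_units \<Gamma>1" "h \<in> rational_units \<Gamma>1"
    and eq: "\<And>x. x \<in> finite_points \<Gamma>1 \<Longrightarrow> val1 h x = val1 f x + val1 g x"
    and y: "y \<in> finite_points \<Gamma>2"
  shows "val2 (\<psi> h) y = val2 (\<psi> f) y + val2 (\<psi> g) y"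
proof -
  have "h x = f x + g x" if x: "x \<in> finite_points \<Gamma>1" for x
    using eq[OF x] assms(1-3)[THEN C1.rational_units_finite, OF x] by (metis plus_ereal.simps(1))
  then have "h = f \<otimes>\<^bsub>Rat \<Gamma>1\<^esub> g"
    using assms(1-3) by (intro C1.rational_units_eqI C1.Rat_mult_units(1)) (auto simp: C1.Rat_mult_units(2))
  then have "\<psi> h y = \<psi> f y + \<psi> g y"
    using C2.Rat_mult_units(2)[OF iso_unit[OF assms(1)] iso_unit[OF assms(2)] y] iso_hom(2)[OF assms(1,2)]
    by simp
  then show ?thesis
    using assms(1,2)[THEN iso_unit, THEN C2.rational_units_finite, OF y]
    by (metis plus_ereal.simps(1) real_of_ereal.simps(1))
qed

lemma iso_mono:
  assumes "f \<in> rational_units \<Gamma>1" "g \<in> rational_units \<Gamma>1"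
    and le: "\<And>x. x \<in> finite_points \<Gamma>1 \<Longrightarrow> val1 f x \<le> val1 g x"
    and y: "y \<in> finite_points \<Gamma>2"
  shows "val2 (\<psi> f) y \<le> val2 (\<psi> g) y"
  using iso_max[OF assms(1,2,2) _ y] le by (simp add: max_def split: if_splits)

lemma const_fun_finite_point: "x \<in> finite_points \<Gamma> \<Longrightarrow> const_fun \<Gamma> c x = c"
  by (simp add: const_fun_def finite_points_def)

lemma iso_zero_const:
  assumes "y \<in> finite_points \<Gamma>2"
  shows "val2 (\<psi> (const_fun \<Gamma>1 (ereal 0))) y = 0"
  using iso_plus[OF C1.const_fun_unit C1.const_fun_unit C1.const_fun_unit _ assms, of 0 0 0]
  by (simp add: const_fun_finite_point)

lemma iso_multiple:
  assumes f: "f \<in> rational_units \<Gamma>1" and "h \<in> rational_units \<Gamma>1"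
    and "\<And>x. x \<in> finite_points \<Gamma>1 \<Longrightarrow> val1 h x = real n * val1 f x"
    and y: "y \<in> finite_points \<Gamma>2"
  shows "val2 (\<psi> h) y = real n * val2 (\<psi> f) y"
  using assms(2,3)
proof (induction n arbitrary: h)
  case 0
  then have "h = const_fun \<Gamma>1 (ereal 0)"
    using C1.rational_units_finite[OF 0(1)]
    by (intro C1.rational_units_eqI C1.const_fun_unit) (force simp: const_fun_finite_point)+
  then show ?case using iso_zero_const[OF y] by simp
next
  case (Suc n)
  obtain k where k: "k \<in> rational_units \<Gamma>1"
    "\<And>x. x \<in> finite_points \<Gamma>1 \<Longrightarrow> k x = ereal (of_int (int n) * val1 f x)"
    using C1.pl_function_extension[OF pl_function_scale[OF C1.rational_units_pl[OF f], of "int n"]] by auto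
  have "val2 (\<psi> h) y = val2 (\<psi> k) y + val2 (\<psi> f) y"
    using Suc.prems k by (intro iso_plus f y) (auto simp: algebra_simps)
  moreover have "val2 (\<psi> k) y = real n * val2 (\<psi> f) y"
    using k by (intro Suc.IH) auto
  ultimately show ?case by (simp add: algebra_simps)
qed

text \<open>
  Constants go to constants because they are the divisible elements.  The resulting map of the real
  numbers is additive and monotone, so it is multiplication by its value at \<open>1\<close>.
\<close>

lemma iso_const:
  shows "\<psi> (const_fun \<Gamma>1 (ereal c)) = const_fun \<Gamma>2 (ereal (value_at_1 \<Gamma>1 \<Gamma>2 \<psi> * c))"
proof -
  have "\<exists>c'. \<psi> (const_fun \<Gamma>1 (ereal c)) = const_fun \<Gamma>2 (ereal c')" for c
  proof (rule C2.divisible_rational_function_constant)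
    show "\<psi> (const_fun \<Gamma>1 (ereal c)) \<in> rational_units \<Gamma>2"
      by (intro iso_unit C1.const_fun_unit)
    fix n :: nat assume "0 < n"
    \<comment> \<open>The \<open>n\<close>-th root of the constant \<open>c\<close> is the constant \<open>c / n\<close>.\<close>
    have "val2 (\<psi> (const_fun \<Gamma>1 (ereal c))) y = real n * val2 (\<psi> (const_fun \<Gamma>1 (ereal (c / real n)))) y"
      if "y \<in> finite_points \<Gamma>2" for y
      using that \<open>0 < n\<close> by (intro iso_multiple C1.const_fun_unit) (auto simp: const_fun_finite_point)
    then show "\<exists>g\<in>rational_units \<Gamma>2. \<forall>y\<in>finite_points \<Gamma>2.
        val2 (\<psi> (const_fun \<Gamma>1 (ereal c))) y = real n * val2 g y"
      by (intro bexI[of _ "\<psi> (const_fun \<Gamma>1 (ereal (c / real n)))"] iso_unit C1.const_fun_unit ballI)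
  qed blast
  then obtain h where h: "\<And>c. \<psi> (const_fun \<Gamma>1 (ereal c)) = const_fun \<Gamma>2 (ereal (h c))" by metis
  obtain y where y: "y \<in> finite_points \<Gamma>2" using C2.finite_points_nonempty by blast
  have val: "val2 (\<psi> (const_fun \<Gamma>1 (ereal c))) y = h c" for c
    using y by (simp add: h const_fun_finite_point)
  have "h (a + b) = h a + h b" for a b
    unfolding val[symmetric]
    by (intro iso_plus C1.const_fun_unit y) (simp add: const_fun_finite_point)
  moreover have "mono h"
    unfolding val[symmetric]
    by (intro monoI iso_mono C1.const_fun_unit y) (simp add: const_fun_finite_point)
  ultimately have linear: "h c = h 1 * c" by (rule additive_mono_linear)
  have "value_at_1 \<Gamma>1 \<Gamma>2 \<psi> = h 1"
    unfolding value_at_1_def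
  proof (rule the_equality)
    show "\<psi> (const_fun \<Gamma>1 1) = const_fun \<Gamma>2 (ereal (h 1))" using h[of 1] by (simp add: one_ereal_def)
    fix r assume "\<psi> (const_fun \<Gamma>1 1) = const_fun \<Gamma>2 (ereal r)"
    then have "const_fun \<Gamma>2 (ereal r) y = const_fun \<Gamma>2 (ereal (h 1)) y" using h[of 1] by (simp add: one_ereal_def)
    then show "r = h 1" using y by (simp add: const_fun_finite_point)
  qed
  then show ?thesis using h[of c] linear by metis
qed

lemma iso_negative:
  assumes "f \<in> rational_units \<Gamma>1" "g \<in> rational_units \<Gamma>1"
    and eq: "\<And>x. x \<in> finite_points \<Gamma>1 \<Longrightarrow> val1 g x = - val1 f x"
    and y: "y \<in> finite_points \<Gamma>2"
  shows "val2 (\<psi> g) y = - val2 (\<psi> f) y"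
  using iso_plus[OF assms(1,2) C1.const_fun_unit[of 0] _ y] iso_zero_const[OF y] eq
  by (simp add: const_fun_finite_point)

end

locale induced_expansive_map = rational_function_isomorphism \<Gamma>1 \<Gamma>2 \<psi>
  for \<Gamma>1 :: "('v1, 'e1) edge_weighted_graph" and \<Gamma>2 :: "('v2, 'e2) edge_weighted_graph"
    and \<psi> :: "(('v1, 'e1) point \<Rightarrow> ereal) \<Rightarrow> ('v2, 'e2) point \<Rightarrow> ereal" +
  fixes \<phi> :: "('v1, 'e1) point \<Rightarrow> ('v2, 'e2) point"
  assumes induced: "induced_map \<Gamma>1 \<Gamma>2 \<psi> \<phi>"
    and expansive: "expansive_map (value_at_1 \<Gamma>1 \<Gamma>2 \<psi>) \<Gamma>1 \<Gamma>2 \<phi>"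
begin

abbreviation r :: real where "r \<equiv> value_at_1 \<Gamma>1 \<Gamma>2 \<psi>"

lemma r_pos: "0 < r"
  using expansive by (simp add: expansive_map_def)

lemma map_finite_points: "bij_betw \<phi> (finite_points \<Gamma>1) (finite_points \<Gamma>2)"
  using expansive by (simp add: expansive_map_def)

lemma map_finite_point: "x \<in> finite_points \<Gamma>1 \<Longrightarrow> \<phi> x \<in> finite_points \<Gamma>2"
  using map_finite_points by (rule bij_betwE[THEN bspec])

lemma map_dist:
  "x \<in> finite_points \<Gamma>1 \<Longrightarrow> y \<in> finite_points \<Gamma>1 \<Longrightarrow>
    curve_dist \<Gamma>2 (\<phi> x) (\<phi> y) = ereal r * curve_dist \<Gamma>1 x y"
  using expansive by (simp add: expansive_map_def)

text \<open>
  With \<open>c = f x\<close>, the inequality \<open>c + n * CF {x} \<epsilon> \<le> max f (c - 1)\<close> is preserved by \<open>\<psi>\<close>, which sends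
  \<open>CF {x} \<epsilon>\<close> to \<open>CF {\<phi> x} (r * \<epsilon>)\<close>.  The latter vanishes at \<open>\<phi> x\<close>, so evaluation there gives
  \<open>r * c \<le> max (\<psi> f) (r * (c - 1))\<close>, and the second term of the maximum is too small to matter.
\<close>

lemma iso_value_ge:
  assumes f: "f \<in> rational_units \<Gamma>1" and x: "x \<in> finite_points \<Gamma>1"
  shows "r * val1 f x \<le> val2 (\<psi> f) (\<phi> x)"
proof -
  obtain \<epsilon> where "0 < \<epsilon>" and \<epsilon>: "\<psi> (CF \<Gamma>1 {x} (ereal \<epsilon>)) = CF \<Gamma>2 {\<phi> x} (ereal (r * \<epsilon>))"
    using induced x unfolding induced_map_def corresponds_finite_def by blast
  note y = map_finite_point[OF x]
  note CF1 = C1.CF_point_unit[OF x \<open>0 < \<epsilon>\<close>]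
  define c where "c = val1 f x"
  obtain n :: nat where n: "\<And>z. z \<in> finite_points \<Gamma>1 \<Longrightarrow>
      c + real n * val1 (CF \<Gamma>1 {x} (ereal \<epsilon>)) z \<le> max (val1 f z) (c - 1)"
    using C1.multiple_of_CF_below[OF f x \<open>0 < \<epsilon>\<close>, of c] c_def by auto
  obtain g where g: "g \<in> rational_units \<Gamma>1"
    "\<And>z. z \<in> finite_points \<Gamma>1 \<Longrightarrow> g z = ereal (max (val1 f z) (c - 1))"
    using C1.pl_function_extension[OF pl_function_max[OF C1.rational_units_pl[OF f] pl_function_const]] by blast
  then have g_val: "val1 g z = max (val1 f z) (c - 1)" if "z \<in> finite_points \<Gamma>1" for z
    using that by (metis real_of_ereal.simps(1))
  have pl: "pl_function \<Gamma>1 (\<lambda>z. of_int (int n) * val1 (CF \<Gamma>1 {x} (ereal \<epsilon>)) z)"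
    by (rule pl_function_scale[OF C1.rational_units_pl[OF CF1]])
  obtain m where m: "m \<in> rational_units \<Gamma>1"
    "\<And>z. z \<in> finite_points \<Gamma>1 \<Longrightarrow> m z = ereal (of_int (int n) * val1 (CF \<Gamma>1 {x} (ereal \<epsilon>)) z)"
    using C1.pl_function_extension[OF pl] by blast
  obtain k where k: "k \<in> rational_units \<Gamma>1"
    "\<And>z. z \<in> finite_points \<Gamma>1 \<Longrightarrow> k z = ereal (c + of_int (int n) * val1 (CF \<Gamma>1 {x} (ereal \<epsilon>)) z)"
    using C1.pl_function_extension[OF pl_function_add[OF pl_function_const pl]] by blast
  have const: "val2 (\<psi> (const_fun \<Gamma>1 (ereal a))) (\<phi> x) = r * a" for a
    using y by (simp add: iso_const const_fun_finite_point)
  have "CF \<Gamma>2 {\<phi> x} (ereal (r * \<epsilon>)) (\<phi> x) = 0"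
    using y C2.curve_dist_self[of "\<phi> x"] mult_pos_pos[OF r_pos \<open>0 < \<epsilon>\<close>]
    by (simp add: CF_def curve_setdist_def finite_points_def min_def)
  then have "val2 (\<psi> (CF \<Gamma>1 {x} (ereal \<epsilon>))) (\<phi> x) = 0" by (simp add: \<epsilon>)
  then have "val2 (\<psi> m) (\<phi> x) = 0"
    using iso_multiple[OF CF1 m(1) _ y, of n] m(2) by simp
  then have "val2 (\<psi> k) (\<phi> x) = r * c"
    using iso_plus[OF C1.const_fun_unit[of c] m(1) k(1) _ y] k(2) m(2) const[of c]
    by (simp add: const_fun_finite_point)
  moreover have "val2 (\<psi> k) (\<phi> x) \<le> val2 (\<psi> g) (\<phi> x)"
    using n g_val k(2) by (intro iso_mono k(1) g(1) y) simp
  moreover have "val2 (\<psi> g) (\<phi> x) = max (val2 (\<psi> f) (\<phi> x)) (r * (c - 1))"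
    using iso_max[OF f C1.const_fun_unit[of "c - 1"] g(1) _ y] g_val const[of "c - 1"]
    by (simp add: const_fun_finite_point)
  moreover have "r * (c - 1) < r * c" using r_pos by simp
  ultimately show ?thesis unfolding c_def[symmetric] by linarith
qed

lemma iso_value:
  assumes f: "f \<in> rational_units \<Gamma>1" and x: "x \<in> finite_points \<Gamma>1"
  shows "val2 (\<psi> f) (\<phi> x) = r * val1 f x"
proof (rule antisym)
  obtain g where g: "g \<in> rational_units \<Gamma>1"
    "\<And>z. z \<in> finite_points \<Gamma>1 \<Longrightarrow> g z = ereal (of_int (- 1) * val1 f z)"
    using C1.pl_function_extension[OF pl_function_scale[OF C1.rational_units_pl[OF f]]] by blast
  have "val2 (\<psi> g) (\<phi> x) = - val2 (\<psi> f) (\<phi> x)"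
    using g(2) by (intro iso_negative f g(1) map_finite_point x) simp
  moreover have "r * val1 g x \<le> val2 (\<psi> g) (\<phi> x)" using g(1) x by (rule iso_value_ge)
  ultimately show "val2 (\<psi> f) (\<phi> x) \<le> r * val1 f x" using g(2)[OF x] by simp
qed (rule iso_value_ge[OF f x])

text \<open>
  The map \<open>\<phi>\<close> carries the sphere of radius \<open>s\<close> around \<open>x\<close> onto the sphere of radius \<open>r * s\<close> around
  \<open>\<phi> x\<close>, and \<open>\<psi>\<close> multiplies increments by \<open>r\<close>.  So both sides of the formula for the slope sum
  are multiplied by \<open>r\<close>.
\<close>

lemma slope_sum_finite:
  assumes f: "f \<in> rational_units \<Gamma>1" and x: "x \<in> finite_points \<Gamma>1"
  shows "slope_sum \<Gamma>2 (\<psi> f) (\<phi> x) = slope_sum \<Gamma>1 f x"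
proof -
  define S1 where "S1 s = {y. y \<in> finite_points \<Gamma>1 \<and> curve_dist \<Gamma>1 y x = ereal s}" for s
  define S2 where "S2 s = {y. y \<in> finite_points \<Gamma>2 \<and> curve_dist \<Gamma>2 y (\<phi> x) = ereal s}" for s
  obtain b1 where b1: "0 < b1" "\<And>s. 0 < s \<Longrightarrow> s < b1 \<Longrightarrow>
      (\<Sum>y\<in>S1 s. val1 f y - val1 f x) = s * of_int (slope_sum \<Gamma>1 f x)"
    using C1.sum_over_sphere[OF f x] unfolding eventually_at_right_field S1_def by blast
  obtain b2 where b2: "0 < b2" "\<And>s. 0 < s \<Longrightarrow> s < b2 \<Longrightarrow>
      (\<Sum>y\<in>S2 s. val2 (\<psi> f) y - val2 (\<psi> f) (\<phi> x)) = s * of_int (slope_sum \<Gamma>2 (\<psi> f) (\<phi> x))"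
    using C2.sum_over_sphere[OF iso_unit[OF f] map_finite_point[OF x]]
    unfolding eventually_at_right_field S2_def by blast
  have "0 < min b1 (b2 / r)" using b1(1) b2(1) r_pos by simp
  then obtain s where "0 < s" "s < min b1 (b2 / r)" using dense by blast
  then have s: "0 < s" "s < b1" "r * s < b2" using r_pos by (auto simp: field_simps)
  have "bij_betw \<phi> (S1 s) (S2 (r * s))"
  proof (rule bij_betw_imageI)
    show "inj_on \<phi> (S1 s)"
      using map_finite_points by (auto simp: bij_betw_def S1_def intro: inj_on_subset)
    have dist: "curve_dist \<Gamma>2 (\<phi> y) (\<phi> x) = ereal (r * s) \<longleftrightarrow> curve_dist \<Gamma>1 y x = ereal s"
      if "y \<in> finite_points \<Gamma>1" for y
      using map_dist[OF that x] r_pos by (cases "curve_dist \<Gamma>1 y x") auto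
    show "\<phi> ` S1 s = S2 (r * s)"
    proof (intro equalityI subsetI)
      fix z assume "z \<in> \<phi> ` S1 s"
      then show "z \<in> S2 (r * s)" using dist map_finite_point by (auto simp: S1_def S2_def)
    next
      fix z assume z: "z \<in> S2 (r * s)"
      then have "z \<in> \<phi> ` finite_points \<Gamma>1"
        using map_finite_points by (auto simp: bij_betw_def S2_def)
      then show "z \<in> \<phi> ` S1 s" using z dist by (auto simp: S1_def S2_def)
    qed
  qed
  then have "(\<Sum>y\<in>S2 (r * s). val2 (\<psi> f) y - val2 (\<psi> f) (\<phi> x))
      = (\<Sum>y\<in>S1 s. val2 (\<psi> f) (\<phi> y) - val2 (\<psi> f) (\<phi> x))"
    by (rule sum.reindex_bij_betw[symmetric])
  also have "\<dots> = (\<Sum>y\<in>S1 s. r * (val1 f y - val1 f x))"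
    by (intro sum.cong) (auto simp: S1_def iso_value[OF f] x algebra_simps)
  also have "\<dots> = r * (s * of_int (slope_sum \<Gamma>1 f x))"
    using b1(2)[OF s(1,2)] by (simp add: sum_distrib_left[symmetric])
  finally have "(r * s) * of_int (slope_sum \<Gamma>2 (\<psi> f) (\<phi> x)) = (r * s) * of_int (slope_sum \<Gamma>1 f x)"
    using b2(2)[of "r * s"] s r_pos by simp
  then show ?thesis using s r_pos by simp
qed

lemma map_infinite_point:
  assumes "x \<in> points \<Gamma>1" "x \<notin> finite_points \<Gamma>1"
  shows "\<phi> x \<in> points \<Gamma>2" "\<phi> x \<notin> finite_points \<Gamma>2"
proof -
  have bij: "bij_betw \<phi> (points \<Gamma>1) (points \<Gamma>2)"
    using expansive by (simp add: expansive_map_def)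
  then show "\<phi> x \<in> points \<Gamma>2" using assms(1) by (rule bij_betwE[THEN bspec])
  show "\<phi> x \<notin> finite_points \<Gamma>2"
  proof
    assume "\<phi> x \<in> finite_points \<Gamma>2"
    then obtain z where "z \<in> finite_points \<Gamma>1" "\<phi> z = \<phi> x"
      using map_finite_points by (force simp: bij_betw_def)
    then have "z = x" using bij assms(1) by (auto simp: bij_betw_def inj_on_def finite_points_def)
    with \<open>z \<in> finite_points \<Gamma>1\<close> assms(2) show False by simp
  qed
qed

text \<open>
  This is where continuity of \<open>\<phi>\<close> at points at infinity enters: distances to such points are infinite
  and carry no information.
\<close>

lemma map_near_infinity:
  assumes e: "e \<in> arcs (skeleton \<Gamma>1)" "len \<Gamma>1 e = \<infinity>"
    and e': "e' \<in> arcs (skeleton \<Gamma>2)" "len \<Gamma>2 e' = \<infinity>"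
    and \<phi>: "\<phi> (edge_point \<Gamma>1 e \<infinity>) = edge_point \<Gamma>2 e' \<infinity>" and "0 \<le> T"
  shows "\<forall>\<^sub>F t in at_top. \<exists>s. T < s \<and> \<phi> (Inner e t) = Inner e' s"
proof -
  define U where "U = insert (edge_point \<Gamma>2 e' \<infinity>) {Inner e' t | t. T < t}"
  have "openin (curve_topology \<Gamma>2) U"
    unfolding openin_curve_topology U_def by (rule C2.neighbourhood_of_infinity[OF e' \<open>0 \<le> T\<close>])
  then have "openin (curve_topology \<Gamma>1) {x \<in> points \<Gamma>1. \<phi> x \<in> U}"
    using expansive openin_continuous_map_preimage
    unfolding expansive_map_def C1.topspace_curve_topology[symmetric] by blast
  moreover have "edge_point \<Gamma>1 e \<infinity> \<in> {x \<in> points \<Gamma>1. \<phi> x \<in> U}"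
    using C1.edge_point_in_points[of e \<infinity>] e \<phi> by (simp add: U_def)
  ultimately have "\<forall>\<^sub>F t in at_top. Inner e t \<in> {x \<in> points \<Gamma>1. \<phi> x \<in> U}"
    unfolding openin_curve_topology by (intro C1.neighbourhood_of_infinity_contains_ray e)
  then show ?thesis
    using eventually_gt_at_top[of 0]
  proof eventually_elim
    case (elim t)
    have "Inner e t \<in> finite_points \<Gamma>1" using elim(2) e by (simp add: C1.Inner_finite_points)
    then have "\<phi> (Inner e t) \<in> finite_points \<Gamma>2" by (rule map_finite_point)
    then have "\<phi> (Inner e t) \<noteq> edge_point \<Gamma>2 e' \<infinity>"
      using e' by (auto simp: finite_points_def infinite_points_def)
    then show ?case using elim(1) by (auto simp: U_def)
  qed
qed

text \<open>
  Two far points of the infinite edge at \<open>x\<close> go to two points of the infinite edge at \<open>\<phi> x\<close> whose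
  distance is \<open>r\<close> times as large.  Comparing the increments of \<open>f\<close> and \<open>\<psi> f\<close> gives equality of the
  slopes up to sign, and the sign is right because the second point can be taken so far out that its
  image lies beyond the image of the first.
\<close>

lemma slope_sum_infinite:
  assumes f: "f \<in> rational_units \<Gamma>1" and x: "x \<in> points \<Gamma>1" "x \<notin> finite_points \<Gamma>1"
  shows "slope_sum \<Gamma>2 (\<psi> f) (\<phi> x) = slope_sum \<Gamma>1 f x"
proof -
  obtain e where e: "e \<in> arcs (skeleton \<Gamma>1)" "len \<Gamma>1 e = \<infinity>" "x = edge_point \<Gamma>1 e \<infinity>"
    using C1.infinite_points_cases[OF x] by blast
  obtain e' where e': "e' \<in> arcs (skeleton \<Gamma>2)" "len \<Gamma>2 e' = \<infinity>" "\<phi> x = edge_point \<Gamma>2 e' \<infinity>"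
    using C2.infinite_points_cases[OF map_infinite_point[OF x]] by blast
  have \<phi>: "\<phi> (edge_point \<Gamma>1 e \<infinity>) = edge_point \<Gamma>2 e' \<infinity>" using e e' by simp
  define m1 :: real where "m1 = of_int (slope_sum \<Gamma>1 f x)"
  define m2 :: real where "m2 = of_int (slope_sum \<Gamma>2 (\<psi> f) (\<phi> x))"
  obtain c1 where c1: "\<forall>\<^sub>F s in at_top. val1 f (Inner e s) = - m1 * s + c1"
    using C1.slope_sum_at_infinity[OF f e(1,2)] unfolding m1_def e(3) by blast
  obtain c2 where "\<forall>\<^sub>F s in at_top. val2 (\<psi> f) (Inner e' s) = - m2 * s + c2"
    using C2.slope_sum_at_infinity[OF iso_unit[OF f] e'(1,2)] unfolding m2_def e'(3) by blast
  then obtain N where N: "\<And>s. N \<le> s \<Longrightarrow> val2 (\<psi> f) (Inner e' s) = - m2 * s + c2"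
    by (auto simp: eventually_at_top_linorder)
  have good: "\<forall>\<^sub>F t in at_top. \<exists>s. max T 0 < s \<and> 0 < t \<and> \<phi> (Inner e t) = Inner e' s \<and>
      - m2 * s + c2 = r * (- m1 * t + c1)" for T
  proof -
    have "\<forall>\<^sub>F t in at_top. \<exists>s. max (max T 0) N < s \<and> \<phi> (Inner e t) = Inner e' s"
      by (rule map_near_infinity[OF e(1,2) e'(1,2) \<phi>]) simp
    then show ?thesis
      using c1 eventually_gt_at_top[of 0]
    proof eventually_elim
    case (elim t)
    then obtain s where s: "max (max T 0) N < s" "\<phi> (Inner e t) = Inner e' s" by auto
    have "Inner e t \<in> finite_points \<Gamma>1" using elim(3) e by (simp add: C1.Inner_finite_points)
      from iso_value[OF f this] show ?case using s N[of s] elim by auto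
    qed
  qed
  obtain u v where uv: "0 < v" "0 < u" "\<phi> (Inner e u) = Inner e' v" "- m2 * v + c2 = r * (- m1 * u + c1)"
    using eventually_happens[OF good[of 0]] by auto
  \<comment> \<open>The condition \<open>v < s\<close> fixes the sign of \<open>s - v\<close>; otherwise only its absolute value would be known.\<close>
  obtain t s where ts: "v < s" "u < t" "\<phi> (Inner e t) = Inner e' s" "- m2 * s + c2 = r * (- m1 * t + c1)"
    using eventually_happens[OF eventually_conj[OF good[of v] eventually_gt_at_top[of u]]] by auto
  have "Inner e u \<in> finite_points \<Gamma>1" "Inner e t \<in> finite_points \<Gamma>1"
    using uv ts e by (auto simp: C1.Inner_finite_points)
  then have "curve_dist \<Gamma>2 (Inner e' s) (Inner e' v) = ereal r * curve_dist \<Gamma>1 (Inner e t) (Inner e u)"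
    using map_dist[of "Inner e t" "Inner e u"] uv(3) ts(3) by simp
  then have "ereal \<bar>s - v\<bar> = ereal r * ereal \<bar>t - u\<bar>"
    using C1.curve_dist_infinite_edge[OF e(1,2), of t u] C2.curve_dist_infinite_edge[OF e'(1,2), of s v] uv ts
    by simp
  then have sv: "s - v = r * (t - u)" using uv ts by simp
  have "m2 * (s - v) = r * m1 * (t - u)" using uv(4) ts(4) by (simp add: algebra_simps)
  then have "m2 * (r * (t - u)) = m1 * (r * (t - u))" unfolding sv by (simp add: algebra_simps)
  then have "m2 = m1" using r_pos ts(2) by simp
  then show ?thesis by (simp add: m1_def m2_def)
qed

lemma slope_sum_preserved:
  assumes "f \<in> rational_units \<Gamma>1" "x \<in> points \<Gamma>1"
  shows "slope_sum \<Gamma>2 (\<psi> f) (\<phi> x) = slope_sum \<Gamma>1 f x"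
  using assms slope_sum_finite slope_sum_infinite by blast

end

theorem corollary1p4:
  fixes \<Gamma>1 :: "('v1, 'e1) edge_weighted_graph"
    and \<Gamma>2 :: "('v2, 'e2) edge_weighted_graph"
    and \<psi> :: "(('v1, 'e1) point \<Rightarrow> ereal) \<Rightarrow> ('v2, 'e2) point \<Rightarrow> ereal"
    and \<phi> :: "('v1, 'e1) point \<Rightarrow> ('v2, 'e2) point"
  assumes "tropical_curve \<Gamma>1"
    and "tropical_curve \<Gamma>2"
    and "\<psi> \<in> semiring_iso (Rat \<Gamma>1) (Rat \<Gamma>2)"
    and "induced_map \<Gamma>1 \<Gamma>2 \<psi> \<phi>"
    and "expansive_map (value_at_1 \<Gamma>1 \<Gamma>2 \<psi>) \<Gamma>1 \<Gamma>2 \<phi>"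
  shows "\<forall>f \<in> carrier (Rat \<Gamma>1) - {\<zero>\<^bsub>Rat \<Gamma>1\<^esub>}. \<forall>x \<in> points \<Gamma>1. \<forall>d.
     (is_zero_of_degree \<Gamma>1 f d x \<longrightarrow> is_zero_of_degree \<Gamma>2 (\<psi> f) d (\<phi> x)) \<and>
     (is_pole_of_degree \<Gamma>1 f d x \<longrightarrow> is_pole_of_degree \<Gamma>2 (\<psi> f) d (\<phi> x))"
proof -
  interpret C1: tropical_curve \<Gamma>1 by (rule assms(1))
  interpret C2: tropical_curve \<Gamma>2 by (rule assms(2))
  interpret induced_expansive_map \<Gamma>1 \<Gamma>2 \<psi> \<phi>
    by unfold_locales (rule assms(3-5))+
  have "bij_betw \<phi> (points \<Gamma>1) (points \<Gamma>2)"
    using assms(5) by (simp add: expansive_map_def)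
  then have points: "\<phi> x \<in> points \<Gamma>2" if "x \<in> points \<Gamma>1" for x
    using that by (rule bij_betwE[THEN bspec])
  show ?thesis
    unfolding is_zero_of_degree_def is_pole_of_degree_def
      C1.rational_functions_nonzero C2.rational_functions_nonzero
    using iso_unit slope_sum_preserved points by auto
qed

end
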